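(* Let $\mathcal{C}$ be a split-closed algebraic triangulated category over $\mathbb{K}$ and let $\mathcal{D}\subset\mathcal{C}$ be a thick subcategory. Let $M\cong M_1\oplus\cdots\oplus M_n\in\mathcal{C}$ be a basic silting object where each $M_i$ is indecomposable. Suppose that the following conditions hold: (1) $\mathrm{Hom}_{\mathcal{C}}(M,M)$ is finite dimensional. (2) There is a collection $\{S_1,\dots,S_n\}\subset\mathcal{D}$ of objects which split-generates $\mathcal{D}$ such that $$\mathrm{Hom}_{\mathcal{C}}(M_i,S_j[p])\cong\begin{cases}\mathbb{K} & (i=j\text{ and }p=0),\\ 0&(\text{otherwise}).\end{cases}$$ Then $(\mathcal{C},\mathcal{D},M)$ is an ST-triple. If moreover $(\mathcal{C},\mathcal{D})$ is relative $(d+1)$-Calabi--Yau, then $(\mathcal{C},\mathcal{D},M)$ is a $(d+1)$-Calabi--Yau triple.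
   Context: $\mathbb{K}$ is an algebraically closed field of characteristic zero; all triangulated categories and exact functors are $\mathbb{K}$-linear. A subcategory $\mathcal{D}$ is split-generated by a collection of objects $\mathcal{X}$ if $\mathcal{D}$ is the smallest thick subcategory containing $\mathcal{X}$; $M$ is a split-generator of $\mathcal{C}$ if $\{M\}$ split-generates $\mathcal{C}$. A silting object of $\mathcal{C}$ is a split-generator $M$ with $\mathrm{Hom}_{\mathcal{C}}(M,M[p])=0$ for all $p>0$. Basic means that the indecomposable summands $M_i$ are pairwise non-isomorphic. For an object $M$ of a triangulated category $\mathcal{C}$ put $\mathcal{C}_M^{\le 0}=\{X\in\mathcal{C}\mid \mathrm{Hom}_{\mathcal{C}}(M,X[p])=0\ \forall p>0\}$ and $\mathcal{C}_M^{\ge 0}=\{X\in\mathcal{C}\mid \mathrm{Hom}_{\mathcal{C}}(M,X[p])=0\ \forall p<0\}$. For a thick subcategory $\mathcal{D}$ put $\mathcal{D}_M^{\le 0}=\mathcal{D}\cap\mathcal{C}_M^{\le 0}$ and $\mathcal{D}_M^{\ge 0}=\mathcal{D}\cap\mathcal{C}_M^{\ge 0}$. For a split-closed triangulated category $\mathcal{C}$, an object $M\in\mathcal{C}$ and a thick subcategory $\mathcal{D}\subset\mathcal{C}$, the triple $(\mathcal{C},\mathcal{D},M)$ is an ST-triple if: (i) $M$ is a silting object of $\mathcal{C}$ and $\mathrm{Hom}_{\mathcal{C}}(M,X)$ is finite dimensional for every $X\in\mathcal{D}$; (ii) $(\mathcal{C}_M^{\le 0},\mathcal{C}_M^{\ge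 0})$ is a t-structure on $\mathcal{C}$; (iii) $\mathcal{C}_M^{\ge 0}\subset\mathcal{D}$ and $(\mathcal{D}_M^{\le 0},\mathcal{D}_M^{\ge 0})$ is a bounded t-structure on $\mathcal{D}$. The pair $(\mathcal{C},\mathcal{D})$ is relative $(d+1)$-Calabi--Yau if $\mathrm{Hom}_{\mathcal{C}}(X,Y)$ is finite dimensional for all $X\in\mathcal{D}$, $Y\in\mathcal{C}$ and there is an isomorphism $D\mathrm{Hom}_{\mathcal{C}}(X,Y)\cong\mathrm{Hom}_{\mathcal{C}}(Y,X[d+1])$ natural in $X\in\mathcal{D}$ and $Y\in\mathcal{C}$, where $D$ is the $\mathbb{K}$-linear dual. A $(d+1)$-Calabi--Yau triple ($d\ge 1$) is an ST-triple $(\mathcal{C},\mathcal{D},M)$ such that $(\mathcal{C},\mathcal{D})$ is relative $(d+1)$-Calabi--Yau. *)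

theory Defs
  imports "HOL-Algebra.Algebraic_Closure" "Jordan_Normal_Form.Missing_VectorSpace"
begin

(* \<open>X\<close> is used for objects below *)
no_notation var (\<open>X\<index>\<close>)

section \<open>Linear algebra over the ground field\<close>

definition char_zero :: "'k ring \<Rightarrow> bool" where
  "char_zero K \<longleftrightarrow> (\<forall>n::nat. 0 < n \<longrightarrow> add_pow K n \<one>\<^bsub>K\<^esub> \<noteq> \<zero>\<^bsub>K\<^esub>)"

definition self_module :: "'k ring \<Rightarrow> ('k, 'k) module" where
  "self_module K = \<lparr>carrier = carrier K, monoid.mult = (\<otimes>\<^bsub>K\<^esub>), one = \<one>\<^bsub>K\<^esub>, ring.zero = \<zero>\<^bsub>K\<^esub>,
     ring.add = (\<oplus>\<^bsub>K\<^esub>), module.smult = (\<otimes>\<^bsub>K\<^esub>)\<rparr>"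

definition dual_space :: "'k ring \<Rightarrow> ('k, 'm) module \<Rightarrow> ('k, 'm \<Rightarrow> 'k) module" where
  "dual_space K V = (ring.func_space K (carrier V))
     \<lparr>carrier := {\<phi> \<in> extensional (carrier V). linear_map K V (self_module K) \<phi>}\<rparr>"

definition linear_iso ::
  "'k ring \<Rightarrow> ('k, 'm) module \<Rightarrow> ('k, 'n) module \<Rightarrow> ('m \<Rightarrow> 'n) \<Rightarrow> bool" where
  "linear_iso K V W T \<longleftrightarrow> linear_map K V W T \<and> bij_betw T (carrier V) (carrier W)"

definition lin_isomorphic :: "'k ring \<Rightarrow> ('k, 'm) module \<Rightarrow> ('k, 'n) module \<Rightarrow> bool" where
  "lin_isomorphic K V W \<longleftrightarrow> (\<exists>T. linear_iso K V W T)"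

section \<open>Linear and additive categories\<close>

text \<open>
  Composition \<open>g \<star> f\<close> is in the usual order (first \<open>f\<close>, then \<open>g\<close>).  The \<open>mult\<close> and \<open>one\<close>
  fields of the module record \<open>Hom C X Y\<close> are never used.
\<close>

record ('k, 'o, 'm) kcat =
  Obj :: "'o set"
  Hom :: "'o \<Rightarrow> 'o \<Rightarrow> ('k, 'm) module"
  Ide :: "'o \<Rightarrow> 'm"
  Comp :: "'m \<Rightarrow> 'm \<Rightarrow> 'm" (infixl \<open>\<star>\<index>\<close> 70)

abbreviation mor :: "('k, 'o, 'm, 'z) kcat_scheme \<Rightarrow> 'o \<Rightarrow> 'o \<Rightarrow> 'm set" where
  "mor C X Y \<equiv> carrier (Hom C X Y)"

abbreviation zero_mor :: "('k, 'o, 'm, 'z) kcat_scheme \<Rightarrow> 'o \<Rightarrow> 'o \<Rightarrow> 'm" where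
  "zero_mor C X Y \<equiv> \<zero>\<^bsub>Hom C X Y\<^esub>"

definition hom_zero :: "('k, 'o, 'm, 'z) kcat_scheme \<Rightarrow> 'o \<Rightarrow> 'o \<Rightarrow> bool" where
  "hom_zero C X Y \<longleftrightarrow> mor C X Y = {zero_mor C X Y}"

definition is_iso :: "('k, 'o, 'm, 'z) kcat_scheme \<Rightarrow> 'o \<Rightarrow> 'o \<Rightarrow> 'm \<Rightarrow> bool" where
  "is_iso C X Y f \<longleftrightarrow> f \<in> mor C X Y \<and>
     (\<exists>g \<in> mor C Y X. g \<star>\<^bsub>C\<^esub> f = Ide C X \<and> f \<star>\<^bsub>C\<^esub> g = Ide C Y)"

definition isomorphic :: "('k, 'o, 'm, 'z) kcat_scheme \<Rightarrow> 'o \<Rightarrow> 'o \<Rightarrow> bool" where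
  "isomorphic C X Y \<longleftrightarrow> (\<exists>f. is_iso C X Y f)"

definition zero_object :: "('k, 'o, 'm, 'z) kcat_scheme \<Rightarrow> 'o \<Rightarrow> bool" where
  "zero_object C Z \<longleftrightarrow> Z \<in> Obj C \<and> (\<forall>X \<in> Obj C. hom_zero C X Z \<and> hom_zero C Z X)"

definition finite_direct_sum ::
  "('k, 'o, 'm, 'z) kcat_scheme \<Rightarrow> 'i set \<Rightarrow> ('i \<Rightarrow> 'o) \<Rightarrow> 'o \<Rightarrow> bool" where
  "finite_direct_sum C I A B \<longleftrightarrow> finite I \<and> (\<forall>i \<in> I. A i \<in> Obj C) \<and> B \<in> Obj C \<and>
     (\<exists>\<iota> \<pi>. (\<forall>i \<in> I. \<iota> i \<in> mor C (A i) B \<and> \<pi> i \<in> mor C B (A i)) \<and>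
       (\<forall>i \<in> I. \<forall>j \<in> I. \<pi> j \<star>\<^bsub>C\<^esub> \<iota> i = (if i = j then Ide C (A i) else zero_mor C (A i) (A j))) \<and>
       finsum (Hom C B B) (\<lambda>i. \<iota> i \<star>\<^bsub>C\<^esub> \<pi> i) I = Ide C B)"

abbreviation direct_sum2 :: "('k, 'o, 'm, 'z) kcat_scheme \<Rightarrow> 'o \<Rightarrow> 'o \<Rightarrow> 'o \<Rightarrow> bool" where
  "direct_sum2 C X Y B \<equiv> finite_direct_sum C {False, True} (\<lambda>b. if b then Y else X) B"

definition indecomposable :: "('k, 'o, 'm, 'z) kcat_scheme \<Rightarrow> 'o \<Rightarrow> bool" where
  "indecomposable C X \<longleftrightarrow> X \<in> Obj C \<and> \<not> zero_object C X \<and>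
     (\<forall>A B. direct_sum2 C A B X \<longrightarrow> zero_object C A \<or> zero_object C B)"

definition split_closed :: "('k, 'o, 'm, 'z) kcat_scheme \<Rightarrow> bool" where
  "split_closed C \<longleftrightarrow> (\<forall>X \<in> Obj C. \<forall>e \<in> mor C X X. e \<star>\<^bsub>C\<^esub> e = e \<longrightarrow>
     (\<exists>Y \<in> Obj C. \<exists>r \<in> mor C X Y. \<exists>s \<in> mor C Y X. r \<star>\<^bsub>C\<^esub> s = Ide C Y \<and> s \<star>\<^bsub>C\<^esub> r = e))"

locale linear_category =
  fixes K :: "'k ring" and C :: "('k, 'o, 'm, 'z) kcat_scheme" (structure)
  assumes ground_field: "field K"
    and hom_vectorspace: "\<lbrakk>X \<in> Obj C; Y \<in> Obj C\<rbrakk> \<Longrightarrow> vectorspace K (Hom C X Y)"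
    and hom_disjoint: "\<lbrakk>X \<in> Obj C; Y \<in> Obj C; X' \<in> Obj C; Y' \<in> Obj C;
      f \<in> mor C X Y; f \<in> mor C X' Y'\<rbrakk> \<Longrightarrow> X = X' \<and> Y = Y'"
    and id_closed: "X \<in> Obj C \<Longrightarrow> Ide C X \<in> mor C X X"
    and comp_closed: "\<lbrakk>X \<in> Obj C; Y \<in> Obj C; Z \<in> Obj C; f \<in> mor C X Y; g \<in> mor C Y Z\<rbrakk>
      \<Longrightarrow> g \<star> f \<in> mor C X Z"
    and id_left: "\<lbrakk>X \<in> Obj C; Y \<in> Obj C; f \<in> mor C X Y\<rbrakk> \<Longrightarrow> Ide C Y \<star> f = f"
    and id_right: "\<lbrakk>X \<in> Obj C; Y \<in> Obj C; f \<in> mor C X Y\<rbrakk> \<Longrightarrow> f \<star> Ide C X = f"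
    and comp_assoc: "\<lbrakk>W \<in> Obj C; X \<in> Obj C; Y \<in> Obj C; Z \<in> Obj C;
      f \<in> mor C W X; g \<in> mor C X Y; h \<in> mor C Y Z\<rbrakk> \<Longrightarrow> (h \<star> g) \<star> f = h \<star> (g \<star> f)"
    and comp_linear_right: "\<lbrakk>X \<in> Obj C; Y \<in> Obj C; Z \<in> Obj C; g \<in> mor C Y Z\<rbrakk>
      \<Longrightarrow> linear_map K (Hom C X Y) (Hom C X Z) (\<lambda>f. g \<star> f)"
    and comp_linear_left: "\<lbrakk>X \<in> Obj C; Y \<in> Obj C; Z \<in> Obj C; f \<in> mor C X Y\<rbrakk>
      \<Longrightarrow> linear_map K (Hom C Y Z) (Hom C X Z) (\<lambda>g. g \<star> f)"

locale additive_category = linear_category +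
  assumes has_zero: "\<exists>Z. zero_object C Z"
    and has_sums: "\<lbrakk>X \<in> Obj C; Y \<in> Obj C\<rbrakk> \<Longrightarrow> \<exists>B. direct_sum2 C X Y B"

definition linear_functor :: "'k ring \<Rightarrow> ('k, 'o, 'm, 'z) kcat_scheme \<Rightarrow>
    ('k, 'p, 'n, 'y) kcat_scheme \<Rightarrow> ('o \<Rightarrow> 'p) \<Rightarrow> ('m \<Rightarrow> 'n) \<Rightarrow> bool" where
  "linear_functor K C T Fo Fm \<longleftrightarrow>
     (\<forall>X \<in> Obj C. Fo X \<in> Obj T \<and> Fm (Ide C X) = Ide T (Fo X)) \<and>
     (\<forall>X \<in> Obj C. \<forall>Y \<in> Obj C. linear_map K (Hom C X Y) (Hom T (Fo X) (Fo Y)) Fm) \<and>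
     (\<forall>X \<in> Obj C. \<forall>Y \<in> Obj C. \<forall>Z \<in> Obj C. \<forall>f \<in> mor C X Y. \<forall>g \<in> mor C Y Z.
        Fm (g \<star>\<^bsub>C\<^esub> f) = Fm g \<star>\<^bsub>T\<^esub> Fm f)"

definition linear_equivalence :: "'k ring \<Rightarrow> ('k, 'o, 'm, 'z) kcat_scheme \<Rightarrow>
    ('k, 'p, 'n, 'y) kcat_scheme \<Rightarrow> ('o \<Rightarrow> 'p) \<Rightarrow> ('m \<Rightarrow> 'n) \<Rightarrow> bool" where
  "linear_equivalence K C T Fo Fm \<longleftrightarrow> linear_functor K C T Fo Fm \<and>
     (\<forall>X \<in> Obj C. \<forall>Y \<in> Obj C. bij_betw Fm (mor C X Y) (mor T (Fo X) (Fo Y))) \<and>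
     (\<forall>Z \<in> Obj T. \<exists>X \<in> Obj C. isomorphic T (Fo X) Z)"

section \<open>Triangulated categories\<close>

text \<open>
  \<open>(X, Y, Z, f, g, h) \<in> Tri C\<close> is the distinguished triangle
  \<open>X \<rightarrow> Y \<rightarrow> Z \<rightarrow> X[1]\<close> with maps \<open>f\<close>, \<open>g\<close>, \<open>h\<close>; \<open>Sho\<close> and \<open>Shm\<close> are the shift on objects
  and on morphisms.
\<close>

record ('k, 'o, 'm) tcat = "('k, 'o, 'm) kcat" +
  Sho :: "'o \<Rightarrow> 'o"
  Shm :: "'m \<Rightarrow> 'm"
  Tri :: "('o \<times> 'o \<times> 'o \<times> 'm \<times> 'm \<times> 'm) set"

definition candidate_triangle ::
  "('k, 'o, 'm, 'z) tcat_scheme \<Rightarrow> 'o \<times> 'o \<times> 'o \<times> 'm \<times> 'm \<times> 'm \<Rightarrow> bool" where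
  "candidate_triangle C = (\<lambda>(X, Y, Z, f, g, h). X \<in> Obj C \<and> Y \<in> Obj C \<and> Z \<in> Obj C \<and>
     f \<in> mor C X Y \<and> g \<in> mor C Y Z \<and> h \<in> mor C Z (Sho C X))"

definition triangle_isomorphic :: "('k, 'o, 'm, 'z) tcat_scheme \<Rightarrow>
    'o \<times> 'o \<times> 'o \<times> 'm \<times> 'm \<times> 'm \<Rightarrow> 'o \<times> 'o \<times> 'o \<times> 'm \<times> 'm \<times> 'm \<Rightarrow> bool" where
  "triangle_isomorphic C = (\<lambda>(X, Y, Z, f, g, h) (X', Y', Z', f', g', h').
     (\<exists>a b c. is_iso C X X' a \<and> is_iso C Y Y' b \<and> is_iso C Z Z' c \<and>
       f' \<star>\<^bsub>C\<^esub> a = b \<star>\<^bsub>C\<^esub> f \<and> g' \<star>\<^bsub>C\<^esub> b = c \<star>\<^bsub>C\<^esub> g \<and> h' \<star>\<^bsub>C\<^esub> c = Shm C a \<star>\<^bsub>C\<^esub> h))"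

text \<open>
  The shift is only required to be an autoequivalence, not an automorphism, so that stable
  categories of Frobenius categories are covered as they stand.  In \<open>TR4\<close>, \<open>Z'\<close>, \<open>X'\<close> and
  \<open>Y'\<close> are the cones of \<open>f\<close>, \<open>g\<close> and \<open>g \<star> f\<close>.
\<close>

locale triangulated_category = additive_category K C
  for K :: "'k ring" and C :: "('k, 'o, 'm, 'z) tcat_scheme" (structure) +
  assumes shift_equivalence: "linear_equivalence K C C (Sho C) (Shm C)"
    and tri_candidate: "t \<in> Tri C \<Longrightarrow> candidate_triangle C t"
    and tri_iso: "\<lbrakk>t \<in> Tri C; candidate_triangle C t'; triangle_isomorphic C t t'\<rbrakk> \<Longrightarrow> t' \<in> Tri C"
    and TR1_id: "\<lbrakk>X \<in> Obj C; zero_object C Z\<rbrakk>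
      \<Longrightarrow> (X, X, Z, Ide C X, zero_mor C X Z, zero_mor C Z (Sho C X)) \<in> Tri C"
    and TR1_cone: "\<lbrakk>X \<in> Obj C; Y \<in> Obj C; f \<in> mor C X Y\<rbrakk> \<Longrightarrow> \<exists>Z g h. (X, Y, Z, f, g, h) \<in> Tri C"
    and TR2: "candidate_triangle C (X, Y, Z, f, g, h) \<Longrightarrow>
      (X, Y, Z, f, g, h) \<in> Tri C \<longleftrightarrow>
      (Y, Z, Sho C X, g, h, \<ominus>\<^bsub>Hom C (Sho C X) (Sho C Y)\<^esub> Shm C f) \<in> Tri C"
    and TR3: "\<lbrakk>(X, Y, Z, f, g, h) \<in> Tri C; (X', Y', Z', f', g', h') \<in> Tri C;
      a \<in> mor C X X'; b \<in> mor C Y Y'; f' \<star> a = b \<star> f\<rbrakk>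
      \<Longrightarrow> \<exists>c \<in> mor C Z Z'. g' \<star> b = c \<star> g \<and> h' \<star> c = Shm C a \<star> h"
    and TR4: "\<lbrakk>(X, Y, Z', f, i, i') \<in> Tri C; (Y, Z, X', g, j, j') \<in> Tri C;
      (X, Z, Y', g \<star> f, k, k') \<in> Tri C\<rbrakk>
      \<Longrightarrow> \<exists>u \<in> mor C Z' Y'. \<exists>v \<in> mor C Y' X'. (Z', Y', X', u, v, Shm C i \<star> j') \<in> Tri C \<and>
        u \<star> i = k \<star> g \<and> k' \<star> u = i' \<and> v \<star> k = j \<and> j' \<star> v = Shm C f \<star> k'"

definition triangle_equivalence :: "'k ring \<Rightarrow> ('k, 'o, 'm, 'z) tcat_scheme \<Rightarrow>
    ('k, 'p, 'n, 'y) tcat_scheme \<Rightarrow> ('o \<Rightarrow> 'p) \<Rightarrow> ('m \<Rightarrow> 'n) \<Rightarrow> ('o \<Rightarrow> 'n) \<Rightarrow> bool" where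
  "triangle_equivalence K C T Fo Fm \<phi> \<longleftrightarrow> linear_equivalence K C T Fo Fm \<and>
     (\<forall>X \<in> Obj C. is_iso T (Fo (Sho C X)) (Sho T (Fo X)) (\<phi> X)) \<and>
     (\<forall>X \<in> Obj C. \<forall>Y \<in> Obj C. \<forall>f \<in> mor C X Y.
        \<phi> Y \<star>\<^bsub>T\<^esub> Fm (Shm C f) = Shm T (Fm f) \<star>\<^bsub>T\<^esub> \<phi> X) \<and>
     (\<forall>X Y Z f g h. (X, Y, Z, f, g, h) \<in> Tri C \<longrightarrow>
        (Fo X, Fo Y, Fo Z, Fm f, Fm g, \<phi> X \<star>\<^bsub>T\<^esub> Fm h) \<in> Tri T)"

definition triangle_equivalent ::
  "'k ring \<Rightarrow> ('k, 'o, 'm, 'z) tcat_scheme \<Rightarrow> ('k, 'p, 'n, 'y) tcat_scheme \<Rightarrow> bool" where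
  "triangle_equivalent K C T \<longleftrightarrow> (\<exists>Fo Fm \<phi>. triangle_equivalence K C T Fo Fm \<phi>)"

text \<open>
  \<open>X[p]\<close>.  For \<open>p < 0\<close> this is some \<open>Y\<close> with \<open>Y[-p] \<cong> X\<close>: it is determined up to isomorphism,
  and all notions below depend on it only up to isomorphism.
\<close>

definition shift :: "('k, 'o, 'm, 'z) tcat_scheme \<Rightarrow> 'o \<Rightarrow> int \<Rightarrow> 'o" where
  "shift C X p = (if 0 \<le> p then (Sho C ^^ nat p) X
     else (SOME Y. Y \<in> Obj C \<and> isomorphic C ((Sho C ^^ nat (- p)) Y) X))"

section \<open>Algebraic triangulated categories\<close>

subsection \<open>Frobenius exact categories\<close>

record ('k, 'o, 'm) ecat = "('k, 'o, 'm) kcat" +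
  Conf :: "('o \<times> 'o \<times> 'o \<times> 'm \<times> 'm) set"

definition kernel_of :: "('k, 'o, 'm, 'z) kcat_scheme \<Rightarrow> 'o \<Rightarrow> 'o \<Rightarrow> 'o \<Rightarrow> 'm \<Rightarrow> 'm \<Rightarrow> bool" where
  "kernel_of C X Y Z i p \<longleftrightarrow> p \<star>\<^bsub>C\<^esub> i = zero_mor C X Z \<and>
     (\<forall>W \<in> Obj C. \<forall>u \<in> mor C W Y. p \<star>\<^bsub>C\<^esub> u = zero_mor C W Z \<longrightarrow>
        (\<exists>!v. v \<in> mor C W X \<and> i \<star>\<^bsub>C\<^esub> v = u))"

definition cokernel_of :: "('k, 'o, 'm, 'z) kcat_scheme \<Rightarrow> 'o \<Rightarrow> 'o \<Rightarrow> 'o \<Rightarrow> 'm \<Rightarrow> 'm \<Rightarrow> bool" where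
  "cokernel_of C X Y Z i p \<longleftrightarrow> p \<star>\<^bsub>C\<^esub> i = zero_mor C X Z \<and>
     (\<forall>W \<in> Obj C. \<forall>u \<in> mor C Y W. u \<star>\<^bsub>C\<^esub> i = zero_mor C X W \<longrightarrow>
        (\<exists>!v. v \<in> mor C Z W \<and> v \<star>\<^bsub>C\<^esub> p = u))"

definition kernel_cokernel_pair ::
  "('k, 'o, 'm, 'z) kcat_scheme \<Rightarrow> 'o \<times> 'o \<times> 'o \<times> 'm \<times> 'm \<Rightarrow> bool" where
  "kernel_cokernel_pair C = (\<lambda>(X, Y, Z, i, p). X \<in> Obj C \<and> Y \<in> Obj C \<and> Z \<in> Obj C \<and>
     i \<in> mor C X Y \<and> p \<in> mor C Y Z \<and> kernel_of C X Y Z i p \<and> cokernel_of C X Y Z i p)"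

text \<open>The square \<open>f' \<star> i = i' \<star> f\<close> with \<open>i : A \<rightarrow> B\<close>, \<open>f : A \<rightarrow> A'\<close>, \<open>i' : A' \<rightarrow> B'\<close>,
  \<open>f' : B \<rightarrow> B'\<close> is a pushout.\<close>

definition pushout :: "('k, 'o, 'm, 'z) kcat_scheme \<Rightarrow>
    'o \<Rightarrow> 'o \<Rightarrow> 'o \<Rightarrow> 'o \<Rightarrow> 'm \<Rightarrow> 'm \<Rightarrow> 'm \<Rightarrow> 'm \<Rightarrow> bool" where
  "pushout C A B A' B' i f i' f' \<longleftrightarrow> B' \<in> Obj C \<and> i' \<in> mor C A' B' \<and> f' \<in> mor C B B' \<and>
     f' \<star>\<^bsub>C\<^esub> i = i' \<star>\<^bsub>C\<^esub> f \<and>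
     (\<forall>W \<in> Obj C. \<forall>s \<in> mor C B W. \<forall>t \<in> mor C A' W. s \<star>\<^bsub>C\<^esub> i = t \<star>\<^bsub>C\<^esub> f \<longrightarrow>
        (\<exists>!v. v \<in> mor C B' W \<and> v \<star>\<^bsub>C\<^esub> f' = s \<and> v \<star>\<^bsub>C\<^esub> i' = t))"

text \<open>The square \<open>p \<star> f' = f \<star> p'\<close> with \<open>p : B \<rightarrow> A\<close>, \<open>f : A' \<rightarrow> A\<close>, \<open>p' : B' \<rightarrow> A'\<close>,
  \<open>f' : B' \<rightarrow> B\<close> is a pullback.\<close>

definition pullback :: "('k, 'o, 'm, 'z) kcat_scheme \<Rightarrow>
    'o \<Rightarrow> 'o \<Rightarrow> 'o \<Rightarrow> 'o \<Rightarrow> 'm \<Rightarrow> 'm \<Rightarrow> 'm \<Rightarrow> 'm \<Rightarrow> bool" where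
  "pullback C A B A' B' p f p' f' \<longleftrightarrow> B' \<in> Obj C \<and> p' \<in> mor C B' A' \<and> f' \<in> mor C B' B \<and>
     p \<star>\<^bsub>C\<^esub> f' = f \<star>\<^bsub>C\<^esub> p' \<and>
     (\<forall>W \<in> Obj C. \<forall>s \<in> mor C W B. \<forall>t \<in> mor C W A'. p \<star>\<^bsub>C\<^esub> s = f \<star>\<^bsub>C\<^esub> t \<longrightarrow>
        (\<exists>!v. v \<in> mor C W B' \<and> f' \<star>\<^bsub>C\<^esub> v = s \<and> p' \<star>\<^bsub>C\<^esub> v = t))"

definition inflation :: "('k, 'o, 'm, 'z) ecat_scheme \<Rightarrow> 'o \<Rightarrow> 'o \<Rightarrow> 'm \<Rightarrow> bool" where
  "inflation E X Y i \<longleftrightarrow> (\<exists>Z p. (X, Y, Z, i, p) \<in> Conf E)"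

definition deflation :: "('k, 'o, 'm, 'z) ecat_scheme \<Rightarrow> 'o \<Rightarrow> 'o \<Rightarrow> 'm \<Rightarrow> bool" where
  "deflation E Y Z p \<longleftrightarrow> (\<exists>X i. (X, Y, Z, i, p) \<in> Conf E)"

text \<open>Exact categories in the sense of Quillen.\<close>

locale exact_category = additive_category K E
  for K :: "'k ring" and E :: "('k, 'o, 'm, 'z) ecat_scheme" (structure) +
  assumes conf_pair: "s \<in> Conf E \<Longrightarrow> kernel_cokernel_pair E s"
    and conf_iso: "\<lbrakk>(X, Y, Z, i, p) \<in> Conf E; X' \<in> Obj E; Y' \<in> Obj E; Z' \<in> Obj E;
      i' \<in> mor E X' Y'; p' \<in> mor E Y' Z'; is_iso E X X' a; is_iso E Y Y' b; is_iso E Z Z' c;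
      i' \<star> a = b \<star> i; p' \<star> b = c \<star> p\<rbrakk> \<Longrightarrow> (X', Y', Z', i', p') \<in> Conf E"
    and id_inflation: "X \<in> Obj E \<Longrightarrow> inflation E X X (Ide E X)"
    and id_deflation: "X \<in> Obj E \<Longrightarrow> deflation E X X (Ide E X)"
    and inflation_comp: "\<lbrakk>inflation E X Y i; inflation E Y Z j\<rbrakk> \<Longrightarrow> inflation E X Z (j \<star> i)"
    and deflation_comp: "\<lbrakk>deflation E X Y p; deflation E Y Z q\<rbrakk> \<Longrightarrow> deflation E X Z (q \<star> p)"
    and inflation_pushout: "\<lbrakk>inflation E A B i; A' \<in> Obj E; f \<in> mor E A A'\<rbrakk>
      \<Longrightarrow> \<exists>B' i' f'. pushout E A B A' B' i f i' f' \<and> inflation E A' B' i'"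
    and deflation_pullback: "\<lbrakk>deflation E B A p; A' \<in> Obj E; f \<in> mor E A' A\<rbrakk>
      \<Longrightarrow> \<exists>B' p' f'. pullback E A B A' B' p f p' f' \<and> deflation E B' A' p'"

definition injective_object :: "('k, 'o, 'm, 'z) ecat_scheme \<Rightarrow> 'o \<Rightarrow> bool" where
  "injective_object E I \<longleftrightarrow> I \<in> Obj E \<and>
     (\<forall>X Y i. inflation E X Y i \<longrightarrow> (\<forall>f \<in> mor E X I. \<exists>g \<in> mor E Y I. g \<star>\<^bsub>E\<^esub> i = f))"

definition projective_object :: "('k, 'o, 'm, 'z) ecat_scheme \<Rightarrow> 'o \<Rightarrow> bool" where
  "projective_object E P \<longleftrightarrow> P \<in> Obj E \<and>
     (\<forall>Y Z p. deflation E Y Z p \<longrightarrow> (\<forall>f \<in> mor E P Z. \<exists>g \<in> mor E P Y. p \<star>\<^bsub>E\<^esub> g = f))"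

locale frobenius_category = exact_category +
  assumes enough_injectives: "X \<in> Obj E \<Longrightarrow> \<exists>I i. injective_object E I \<and> inflation E X I i"
    and enough_projectives: "X \<in> Obj E \<Longrightarrow> \<exists>P p. projective_object E P \<and> deflation E P X p"
    and injective_iff_projective: "injective_object E I \<longleftrightarrow> projective_object E I"

subsection \<open>The stable category\<close>

definition null_mor :: "('k, 'o, 'm, 'z) ecat_scheme \<Rightarrow> 'o \<Rightarrow> 'o \<Rightarrow> 'm set" where
  "null_mor E X Y =
     {b \<star>\<^bsub>E\<^esub> a | I a b. injective_object E I \<and> a \<in> mor E X I \<and> b \<in> mor E I Y}"

text \<open>A morphism \<open>X \<rightarrow> Y\<close> of the stable category is \<open>(X, Y, A)\<close> with \<open>A\<close> a coset of
  \<open>null_mor E X Y\<close>; recording \<open>X\<close> and \<open>Y\<close> keeps source and target determined.\<close>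

definition stable_class ::
  "('k, 'o, 'm, 'z) ecat_scheme \<Rightarrow> 'o \<Rightarrow> 'o \<Rightarrow> 'm \<Rightarrow> 'o \<times> 'o \<times> 'm set" where
  "stable_class E X Y f = (X, Y, null_mor E X Y +>\<^bsub>Hom E X Y\<^esub> f)"

definition stable_hom ::
  "('k, 'o, 'm, 'z) ecat_scheme \<Rightarrow> 'o \<Rightarrow> 'o \<Rightarrow> ('k, 'o \<times> 'o \<times> 'm set) module" where
  "stable_hom E X Y = \<lparr>carrier = stable_class E X Y ` mor E X Y,
     monoid.mult = undefined, one = undefined,
     ring.zero = stable_class E X Y (zero_mor E X Y),
     ring.add = (\<lambda>(_, _, A) (_, _, B). (X, Y, A <+>\<^bsub>Hom E X Y\<^esub> B)),
     module.smult = (\<lambda>c (_, _, A). (X, Y, \<Union>a\<in>A. null_mor E X Y +>\<^bsub>Hom E X Y\<^esub> (c \<odot>\<^bsub>Hom E X Y\<^esub> a)))\<rparr>"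

text \<open>The chosen conflation \<open>X \<rightarrow> I \<rightarrow> S\<close> with \<open>I\<close> injective, as \<open>(I, S, i, p)\<close>; \<open>S\<close> is the
  shift of \<open>X\<close> in the stable category.\<close>

definition injective_conf :: "('k, 'o, 'm, 'z) ecat_scheme \<Rightarrow> 'o \<Rightarrow> 'o \<times> 'o \<times> 'm \<times> 'm" where
  "injective_conf E X = (SOME (I, S, i, p). injective_object E I \<and> (X, I, S, i, p) \<in> Conf E)"

definition cosyzygy :: "('k, 'o, 'm, 'z) ecat_scheme \<Rightarrow> 'o \<Rightarrow> 'o" where
  "cosyzygy E X = (case injective_conf E X of (I, S, i, p) \<Rightarrow> S)"

text \<open>\<open>cosyzygy_lift E X Y f g\<close>: the map \<open>g\<close> completes \<open>f : X \<rightarrow> Y\<close> to a morphism between the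
  chosen conflations of \<open>X\<close> and \<open>Y\<close>.\<close>

definition cosyzygy_lift ::
  "('k, 'o, 'm, 'z) ecat_scheme \<Rightarrow> 'o \<Rightarrow> 'o \<Rightarrow> 'm \<Rightarrow> 'm \<Rightarrow> bool" where
  "cosyzygy_lift E X Y f g = (case (injective_conf E X, injective_conf E Y) of
     ((I, S, i, p), (I', S', i', p')) \<Rightarrow> g \<in> mor E S S' \<and>
       (\<exists>b \<in> mor E I I'. b \<star>\<^bsub>E\<^esub> i = i' \<star>\<^bsub>E\<^esub> f \<and> g \<star>\<^bsub>E\<^esub> p = p' \<star>\<^bsub>E\<^esub> b))"

text \<open>\<open>connecting E X Y Z f g w\<close>: the map \<open>w\<close> is part of a morphism from the conflation \<open>X \<rightarrow> Y \<rightarrow> Z\<close>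
  to the chosen conflation \<open>X \<rightarrow> I \<rightarrow> S\<close> that is the identity on \<open>X\<close>.\<close>

definition connecting ::
  "('k, 'o, 'm, 'z) ecat_scheme \<Rightarrow> 'o \<Rightarrow> 'o \<Rightarrow> 'o \<Rightarrow> 'm \<Rightarrow> 'm \<Rightarrow> 'm \<Rightarrow> bool" where
  "connecting E X Y Z f g w = (case injective_conf E X of (I, S, i, p) \<Rightarrow>
     w \<in> mor E Z S \<and> (\<exists>u \<in> mor E Y I. u \<star>\<^bsub>E\<^esub> f = i \<and> w \<star>\<^bsub>E\<^esub> g = p \<star>\<^bsub>E\<^esub> u))"

definition stable_pre ::
  "('k, 'o, 'm, 'z) ecat_scheme \<Rightarrow> ('k, 'o, 'o \<times> 'o \<times> 'm set) tcat" where
  "stable_pre E = \<lparr>Obj = Obj E,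
     Hom = stable_hom E,
     Ide = (\<lambda>X. stable_class E X X (Ide E X)),
     Comp = (\<lambda>(Y', Z, B) (X, Y, A).
       (X, Z, \<Union>b\<in>B. \<Union>a\<in>A. null_mor E X Z +>\<^bsub>Hom E X Z\<^esub> (b \<star>\<^bsub>E\<^esub> a))),
     Sho = cosyzygy E,
     Shm = (\<lambda>(X, Y, A). (cosyzygy E X, cosyzygy E Y,
       \<Union>g \<in> {g. \<exists>a \<in> A. cosyzygy_lift E X Y a g}.
         null_mor E (cosyzygy E X) (cosyzygy E Y)
           +>\<^bsub>Hom E (cosyzygy E X) (cosyzygy E Y)\<^esub> g)),
     Tri = {(X, Y, Z, stable_class E X Y f, stable_class E Y Z g,
             stable_class E Z (cosyzygy E X) w) | X Y Z f g w.
             (X, Y, Z, f, g) \<in> Conf E \<and> connecting E X Y Z f g w}\<rparr>"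

text \<open>
  The distinguished triangles are those isomorphic to the standard triangle of a conflation.
  Some authors use the connecting map with the opposite sign; the two triangulated structures are
  triangle equivalent (identity functor, \<open>\<phi> = -1\<close>), so \<open>algebraic_model\<close> does not depend on it,
  nor on the choice made in \<open>injective_conf\<close>.
\<close>

definition stable_category ::
  "('k, 'o, 'm, 'z) ecat_scheme \<Rightarrow> ('k, 'o, 'o \<times> 'o \<times> 'm set) tcat" where
  "stable_category E = (stable_pre E)\<lparr>Tri := {t. candidate_triangle (stable_pre E) t \<and>
     (\<exists>s \<in> Tri (stable_pre E). triangle_isomorphic (stable_pre E) s t)}\<rparr>"

text \<open>
  A triangulated category is algebraic if it is triangle equivalent to the stable category of some
  Frobenius category \<open>E\<close>.  HOL has no quantifier over the types of objects and morphisms of \<open>E\<close>;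
  as a hypothesis with \<open>E\<close> and its types universally quantified outside, \<open>algebraic_model K C E\<close>
  says exactly that \<open>C\<close> is algebraic.
\<close>

definition algebraic_model ::
  "'k ring \<Rightarrow> ('k, 'o, 'm, 'z) tcat_scheme \<Rightarrow> ('k, 'p, 'n, 'y) ecat_scheme \<Rightarrow> bool" where
  "algebraic_model K C E \<longleftrightarrow> frobenius_category K E \<and> triangle_equivalent K C (stable_category E)"

section \<open>Thick subcategories, silting objects and t-structures\<close>

text \<open>Full subcategories are given by their sets of objects; thick ones are strictly full.\<close>

definition iso_closed :: "('k, 'o, 'm, 'z) kcat_scheme \<Rightarrow> 'o set \<Rightarrow> bool" where
  "iso_closed C D \<longleftrightarrow> (\<forall>X \<in> D. \<forall>Y \<in> Obj C. isomorphic C X Y \<longrightarrow> Y \<in> D)"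

definition thick :: "('k, 'o, 'm, 'z) tcat_scheme \<Rightarrow> 'o set \<Rightarrow> bool" where
  "thick C D \<longleftrightarrow> D \<subseteq> Obj C \<and> (\<exists>Z \<in> D. zero_object C Z) \<and> iso_closed C D \<and>
     (\<forall>X \<in> Obj C. X \<in> D \<longleftrightarrow> Sho C X \<in> D) \<and>
     (\<forall>X Y Z f g h. (X, Y, Z, f, g, h) \<in> Tri C \<longrightarrow> X \<in> D \<longrightarrow> Y \<in> D \<longrightarrow> Z \<in> D) \<and>
     (\<forall>A B X. direct_sum2 C A B X \<longrightarrow> X \<in> D \<longrightarrow> A \<in> D \<and> B \<in> D)"

definition split_generates :: "('k, 'o, 'm, 'z) tcat_scheme \<Rightarrow> 'o set \<Rightarrow> 'o set \<Rightarrow> bool" where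
  "split_generates C S D \<longleftrightarrow> thick C D \<and> S \<subseteq> D \<and> (\<forall>T. thick C T \<and> S \<subseteq> T \<longrightarrow> D \<subseteq> T)"

definition silting :: "('k, 'o, 'm, 'z) tcat_scheme \<Rightarrow> 'o \<Rightarrow> bool" where
  "silting C M \<longleftrightarrow> M \<in> Obj C \<and> split_generates C {M} (Obj C) \<and>
     (\<forall>p > 0. hom_zero C M (shift C M p))"

definition le0 :: "('k, 'o, 'm, 'z) tcat_scheme \<Rightarrow> 'o \<Rightarrow> 'o set" where
  "le0 C M = {X \<in> Obj C. \<forall>p > 0. hom_zero C M (shift C X p)}"

definition ge0 :: "('k, 'o, 'm, 'z) tcat_scheme \<Rightarrow> 'o \<Rightarrow> 'o set" where
  "ge0 C M = {X \<in> Obj C. \<forall>p < 0. hom_zero C M (shift C X p)}"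

text \<open>
  \<open>(A, B) = (D\<^sup>\<le>\<^sup>0, D\<^sup>\<ge>\<^sup>0)\<close> is a t-structure on the full triangulated subcategory \<open>D\<close> of \<open>C\<close>.
  Membership of \<open>Y\<close> in \<open>D\<^sup>\<ge>\<^sup>1 = D\<^sup>\<ge>\<^sup>0[-1]\<close> is expressed as \<open>Y[1] \<in> D\<^sup>\<ge>\<^sup>0\<close>.
\<close>

definition t_structure_on ::
  "('k, 'o, 'm, 'z) tcat_scheme \<Rightarrow> 'o set \<Rightarrow> 'o set \<Rightarrow> 'o set \<Rightarrow> bool" where
  "t_structure_on C D A B \<longleftrightarrow> A \<subseteq> D \<and> B \<subseteq> D \<and> iso_closed C A \<and> iso_closed C B \<and>
     (\<forall>X \<in> A. Sho C X \<in> A) \<and>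
     (\<forall>Y \<in> D. Sho C Y \<in> B \<longrightarrow> Y \<in> B) \<and>
     (\<forall>X \<in> A. \<forall>Y \<in> D. Sho C Y \<in> B \<longrightarrow> hom_zero C X Y) \<and>
     (\<forall>X \<in> D. \<exists>U \<in> A. \<exists>V \<in> D. Sho C V \<in> B \<and> (\<exists>f g h. (U, X, V, f, g, h) \<in> Tri C))"

definition bounded_t_structure_on ::
  "('k, 'o, 'm, 'z) tcat_scheme \<Rightarrow> 'o set \<Rightarrow> 'o set \<Rightarrow> 'o set \<Rightarrow> bool" where
  "bounded_t_structure_on C D A B \<longleftrightarrow> t_structure_on C D A B \<and>
     (\<forall>X \<in> D. \<exists>m n. shift C X m \<in> A \<and> shift C X n \<in> B)"

section \<open>ST-triples and Calabi--Yau triples\<close>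

definition ST_triple :: "'k ring \<Rightarrow> ('k, 'o, 'm, 'z) tcat_scheme \<Rightarrow> 'o set \<Rightarrow> 'o \<Rightarrow> bool" where
  "ST_triple K C D M \<longleftrightarrow>
     triangulated_category K C \<and> split_closed C \<and> M \<in> Obj C \<and> thick C D \<and>
     silting C M \<and> (\<forall>X \<in> D. vectorspace.fin_dim K (Hom C M X)) \<and>
     t_structure_on C (Obj C) (le0 C M) (ge0 C M) \<and>
     ge0 C M \<subseteq> D \<and> bounded_t_structure_on C D (D \<inter> le0 C M) (D \<inter> ge0 C M)"

text \<open>
  \<open>relative_CY K C D m\<close>: the pair is relative \<open>m\<close>-Calabi--Yau; here \<open>X[m]\<close> is the \<open>m\<close>-fold
  iterate of the shift functor.  The last clause is naturality in both variables, with
  \<open>f : X \<rightarrow> X'\<close> in \<open>D\<close> and \<open>g : Y' \<rightarrow> Y\<close> in \<open>C\<close>: the functional \<open>u \<mapsto> \<phi> (g \<star> u \<star> f)\<close> is the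
  image of \<open>\<phi>\<close> under the map of duals induced by \<open>f\<close> and \<open>g\<close>.
\<close>

definition relative_CY :: "'k ring \<Rightarrow> ('k, 'o, 'm, 'z) tcat_scheme \<Rightarrow> 'o set \<Rightarrow> nat \<Rightarrow> bool" where
  "relative_CY K C D m \<longleftrightarrow>
     (\<forall>X \<in> D. \<forall>Y \<in> Obj C. vectorspace.fin_dim K (Hom C X Y)) \<and>
     (\<exists>\<eta>. (\<forall>X \<in> D. \<forall>Y \<in> Obj C.
            linear_iso K (dual_space K (Hom C X Y)) (Hom C Y ((Sho C ^^ m) X)) (\<eta> X Y)) \<and>
          (\<forall>X \<in> D. \<forall>X' \<in> D. \<forall>Y \<in> Obj C. \<forall>Y' \<in> Obj C. \<forall>f \<in> mor C X X'. \<forall>g \<in> mor C Y' Y.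
            \<forall>\<phi> \<in> carrier (dual_space K (Hom C X Y)).
              \<eta> X' Y' (\<lambda>u \<in> mor C X' Y'. \<phi> (g \<star>\<^bsub>C\<^esub> u \<star>\<^bsub>C\<^esub> f)) =
              (Shm C ^^ m) f \<star>\<^bsub>C\<^esub> \<eta> X Y \<phi> \<star>\<^bsub>C\<^esub> g))"

text \<open>\<open>CY_triple K C D M m\<close> is an \<open>m\<close>-Calabi--Yau triple, where \<open>m = d + 1\<close> with \<open>d \<ge> 1\<close>.\<close>

definition CY_triple ::
  "'k ring \<Rightarrow> ('k, 'o, 'm, 'z) tcat_scheme \<Rightarrow> 'o set \<Rightarrow> 'o \<Rightarrow> nat \<Rightarrow> bool" where
  "CY_triple K C D M m \<longleftrightarrow> 2 \<le> m \<and> ST_triple K C D M \<and> relative_CY K C D m"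

end

theory Submission
  imports Defs
begin

text \<open>
  Write \<open>H\<^sup>q(X) = Hom(M, X[q])\<close>. Devissage over the thick subcategories generated by \<open>M\<close> shows that every
  object is bounded above, that it has no maps to sufficiently negative objects, and that the top
  cohomology of an object is finite dimensional.

  Orthogonality: for \<open>X\<close> in \<open>C\<^sup>\<le>\<^sup>0\<close>, coning off finitely many maps \<open>M \<rightarrow> X\<close> gives \<open>X \<rightarrow> X'\<close> with \<open>X'\<close>
  in \<open>C\<^sup>\<le>\<^sup>-\<^sup>1\<close> through which every map to an object of \<open>C\<^sup>\<ge>\<^sup>1\<close> factors. Iterating, such a map factors
  through arbitrarily negative objects, hence vanishes.

  Truncation: if \<open>X\<close> is in \<open>C\<^sup>\<le>\<^sup>0\<close> and \<open>H\<^sup>0(X) \<noteq> 0\<close>, coning off maps \<open>M\<^sub>i \<rightarrow> X\<close> reduces to the case that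
  one \<open>x : M\<^sub>i \<rightarrow> X\<close> generates \<open>H\<^sup>0(X)\<close>. By Fitting's lemma for \<open>End(M\<^sub>i)\<close>, the nonzero map
  \<open>\<sigma>\<^sub>i : M\<^sub>i \<rightarrow> S\<^sub>i\<close> kills every \<open>M \<rightarrow> M\<^sub>i\<close> that \<open>x\<close> kills, so it extends along \<open>x\<close> to a map \<open>X \<rightarrow> S\<^sub>i\<close>. Its
  fibre is again in \<open>C\<^sup>\<le>\<^sup>0\<close> with smaller \<open>H\<^sup>0\<close>. Descending induction yields the truncation triangles,
  whose third terms are built from shifts of the \<open>S\<^sub>i\<close>. An object of \<open>C\<^sup>\<ge>\<^sup>0\<close> equals such a third term because its
  truncation has no cohomology and \<open>M\<close> generates.
\<close>

section \<open>Linear algebra\<close>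

text \<open>Only \<open>Hom(M, M)\<close> is assumed finite dimensional; nothing is said about
  \<open>Hom(M, M[p])\<close> for negative \<open>p\<close>, so finiteness cannot be propagated in
  all degrees at once. Finiteness of the top degree alone is not visibly closed under extensions
  either, because the outer terms of a triangle may reach higher degrees than the middle one. What
  does pass to extensions is a property of maps: every map into an object of \<open>LE p\<close>
  factors through an object of \<open>LE p\<close> with finite dimensional degree \<open>p\<close>.
  Applied to an identity it gives the claim for objects. Orthogonality has to precede truncation.
  Objects of \<open>LE 0\<close> are defined by vanishing conditions and do not come built from
  \<open>M\<close>, so testing on \<open>M\<close> does not show that a map from such an object to
  \<open>S i\<close> is zero. The tests only make it factor through \<open>LE (-1)\<close>, and
  orthogonality does the rest. The shift is merely an autoequivalence. Desuspension therefore works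
  up to isomorphism, which is the origin of the many inverse pairs \<open>e\<close>,
  \<open>e'\<close>.\<close>

lemma fin_dim_if_inj:
  assumes T: "linear_map K V W T" and inj: "inj_on T (carrier V)" and fd: "vectorspace.fin_dim K W"
  shows "vectorspace.fin_dim K V"
    and "T ` carrier V \<noteq> carrier W \<Longrightarrow> vectorspace.dim K V < vectorspace.dim K W"
proof -
  interpret V: vectorspace K V using linear_map.axioms(1)[OF T] .
  interpret W: vectorspace K W using linear_map.axioms(2)[OF T] .
  interpret linear_map K V W T by fact
  have indpt: "W.lin_indpt (T ` A)" if A: "finite A" "A \<subseteq> carrier V" "V.lin_indpt A" for A
  proof (rule W.finite_lin_indpt2)
    fix a assume a: "a \<in> T ` A \<rightarrow> carrier K" and lc: "W.lincomb a (T ` A) = \<zero>\<^bsub>W\<^esub>"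
    have aT: "a \<circ> T \<in> A \<rightarrow> carrier K" using a by auto
    have "T (V.lincomb (a \<circ> T) A) = T \<zero>\<^bsub>V\<^esub>"
      using lc lincomb_linear_image[OF inj A(2) a A(1)] by simp
    moreover have "V.lincomb (a \<circ> T) A \<in> carrier V" using aT A(2) by (rule V.lincomb_closed[rotated])
    ultimately have "V.lincomb (a \<circ> T) A = \<zero>\<^bsub>V\<^esub>"
      using inj_onD[OF inj] V.M.zero_closed by blast
    then have "a \<circ> T \<in> A \<rightarrow> {\<zero>\<^bsub>K\<^esub>}"
      using V.not_lindepD[OF A(3) A(1) subset_refl aT] by blast
    then show "\<forall>v\<in>T ` A. a v = \<zero>\<^bsub>K\<^esub>" by auto
  qed (use A in auto)
  have card_le: "finite A \<and> card A \<le> W.dim" if A: "A \<subseteq> carrier V" "V.lin_indpt A" for A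
  proof -
    have fin_le: "card B \<le> W.dim" if "finite B" "B \<subseteq> A" for B
    proof -
      have B: "B \<subseteq> carrier V" "V.lin_indpt B" using A that V.subset_li_is_li by auto
      have "card (T ` B) = card B" using inj B(1) by (meson card_image inj_on_subset)
      then show ?thesis using W.li_le_dim(2)[OF fd _ indpt[OF that(1) B]] B(1) by auto
    qed
    have "finite A"
    proof (rule ccontr)
      assume "infinite A"
      then obtain B where "B \<subseteq> A" "finite B" "card B = Suc W.dim"
        by (metis infinite_arbitrarily_large)
      then show False using fin_le[of B] by simp
    qed
    then show ?thesis using fin_le by auto
  qed
  obtain A where A: "finite A" "maximal A (\<lambda>S. S \<subseteq> carrier V \<and> V.lin_indpt S)"
    using maximal_exists[of "\<lambda>S. S \<subseteq> carrier V \<and> V.lin_indpt S" W.dim "{}"] card_le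
      V.finite_lin_indpt2[of "{}"] by auto
  have bas: "V.basis A" using V.max_li_is_basis[OF A(2)] .
  then have AV: "A \<subseteq> carrier V" "V.lin_indpt A" "V.gen_set A" unfolding V.basis_def by auto
  show "V.fin_dim" unfolding V.fin_dim_def using A(1) AV by auto
  show "V.dim < W.dim" if nsurj: "T ` carrier V \<noteq> carrier W"
  proof -
    have dimV: "V.dim = card A" using V.dim_basis[OF A(1) bas] .
    have cT: "card (T ` A) = card A" using inj AV(1) by (meson card_image inj_on_subset)
    have "\<not> W.dim \<le> card A"
    proof
      assume "W.dim \<le> card A"
      then have "W.basis (T ` A)"
        using W.dim_li_is_basis[OF fd _ _ indpt[OF A(1) AV(1,2)]] A(1) AV(1) cT by auto
      then have gen: "carrier W = W.span (T ` A)" and TA: "T ` A \<subseteq> carrier W"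
        unfolding W.basis_def by auto
      have "w \<in> T ` carrier V" if w: "w \<in> carrier W" for w
      proof -
        obtain a where a: "a \<in> T ` A \<rightarrow> carrier K" "W.lincomb a (T ` A) = w"
          using W.finite_in_span[OF finite_imageI[OF A(1)] TA, of w] w gen by auto
        then have "w = T (V.lincomb (a \<circ> T) A)"
          using lincomb_linear_image[OF inj AV(1) a(1) A(1)] by simp
        moreover have "V.lincomb (a \<circ> T) A \<in> carrier V" using a AV(1) by (intro V.lincomb_closed) auto
        ultimately show ?thesis by blast
      qed
      then show False using nsurj by auto
    qed
    then show ?thesis using dimV by simp
  qed
qed

lemma fin_dim_if_surj:
  assumes T: "linear_map K V W T" and surj: "T ` carrier V = carrier W" and fd: "vectorspace.fin_dim K V"
  shows "vectorspace.fin_dim K W"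
  using linear_map.surj_fin_dim[OF T fd surj] .

text \<open>Rank-nullity: the kernel contains \<open>v\<close>, hence has positive
  dimension.\<close>

lemma dim_less_if_surj:
  assumes T: "linear_map K V W T" and surj: "T ` carrier V = carrier W" and fd: "vectorspace.fin_dim K V"
    and v: "v \<in> carrier V" "T v = \<zero>\<^bsub>W\<^esub>" "v \<noteq> \<zero>\<^bsub>V\<^esub>"
  shows "vectorspace.dim K W < vectorspace.dim K V"
proof -
  interpret V: vectorspace K V using linear_map.axioms(1)[OF T] .
  interpret W: vectorspace K W using linear_map.axioms(2)[OF T] .
  interpret linear_map K V W T by fact
  interpret Ker: vectorspace K "V.vs kerT" using kerT_is_subspace V.subspace_is_vs by blast
  have "linear_map K (V.vs kerT) V (\<lambda>v. v)"
    by unfold_locales (auto simp: module_hom_def ker_def)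
  then have fdk: "Ker.fin_dim" by (rule fin_dim_if_inj) (use fd in \<open>auto simp: inj_on_def\<close>)
  have "Ker.dim \<noteq> 0"
  proof
    assume d0: "Ker.dim = 0"
    obtain B where B: "finite B" "Ker.basis B" using Ker.finite_basis_exists[OF fdk] by auto
    then have "B = {}" using Ker.dim_basis[OF B] d0 by auto
    then have "carrier (V.vs kerT) = {\<zero>\<^bsub>V\<^esub>}" using B(2) Ker.span_empty unfolding Ker.basis_def by auto
    then show False using v by (auto simp: ker_def)
  qed
  moreover have "W.vs imT = W" using surj by (simp add: im_def)
  ultimately show ?thesis using rank_nullity[OF fd] by simp
qed

text \<open>\<open>V\<close> is generated by the images of generators of \<open>U\<close> together
  with lifts of generators of the image of \<open>T\<close>: subtracting from \<open>v\<close> a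
  lift of \<open>T v\<close> leaves an element that comes from \<open>U\<close> by
  exactness.\<close>

lemma fin_dim_exact:
  assumes S: "linear_map K U V S" and T: "linear_map K V W T"
    and exact: "\<And>v. v \<in> carrier V \<Longrightarrow> T v = \<zero>\<^bsub>W\<^esub> \<Longrightarrow> v \<in> S ` carrier U"
    and fdU: "vectorspace.fin_dim K U" and fdW: "vectorspace.fin_dim K W"
  shows "vectorspace.fin_dim K V"
proof -
  interpret U: vectorspace K U using linear_map.axioms(1)[OF S] .
  interpret V: vectorspace K V using linear_map.axioms(1)[OF T] .
  interpret W: vectorspace K W using linear_map.axioms(2)[OF T] .
  interpret S: linear_map K U V S by fact
  interpret linear_map K V W T by fact
  interpret Im: vectorspace K "W.vs imT" using imT_is_subspace W.subspace_is_vs by blast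
  have "linear_map K (W.vs imT) W (\<lambda>v. v)"
    by unfold_locales (auto simp: module_hom_def im_def)
  then have "Im.fin_dim" by (rule fin_dim_if_inj) (use fdW in \<open>auto simp: inj_on_def\<close>)
  then obtain B where B: "finite B" "B \<subseteq> imT" "carrier (W.vs imT) = Im.span B"
    unfolding Im.fin_dim_def by auto
  obtain A where A: "finite A" "A \<subseteq> carrier U" "carrier U = U.span A"
    using fdU unfolding U.fin_dim_def by auto
  have "\<exists>B'. B' \<subseteq> carrier V \<and> finite B' \<and> B = T ` B'"
    using B(1,2) finite_subset_image[of B T "carrier V"] by (auto simp: im_def)
  then obtain B' where B': "B' \<subseteq> carrier V" "finite B'" "B = T ` B'" by auto
  let ?G = "S ` A \<union> B'"
  have GV: "?G \<subseteq> carrier V" using A(2) B'(1) by auto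
  have sub: "submodule K (V.span ?G) V" using V.span_is_submodule[OF GV] .
  interpret sub: submodule K "V.span ?G" V by fact
  have inG: "x \<in> V.span ?G" if "x \<in> ?G" for x using V.in_own_span[OF GV] that by auto
  have SU: "S u \<in> V.span ?G" if "u \<in> carrier U" for u
  proof -
    have lc: "S (U.lincomb a F) \<in> V.span ?G" if "finite F" "F \<subseteq> A" "a \<in> F \<rightarrow> carrier K" for F a
      using that
    proof (induct F rule: finite_induct)
      case (insert x F)
      have x: "x \<in> carrier U" "F \<subseteq> carrier U" "a \<in> F \<rightarrow> carrier K" using insert A(2) by auto
      have "U.lincomb a (insert x F) = a x \<odot>\<^bsub>U\<^esub> x \<oplus>\<^bsub>U\<^esub> U.lincomb a F"
        using insert x by (intro U.lincomb_insert2) auto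
      moreover have "U.lincomb a F \<in> carrier U" using x by auto
      ultimately have "S (U.lincomb a (insert x F)) = a x \<odot>\<^bsub>V\<^esub> S x \<oplus>\<^bsub>V\<^esub> S (U.lincomb a F)"
        using x insert by (simp add: Pi_iff)
      then show ?case using insert inG by (auto intro!: sub.m_closed sub.smult_closed)
    qed simp
    show ?thesis using U.finite_in_span[OF A(1,2)] that A(3) lc[OF A(1) subset_refl] by metis
  qed
  have Tsp: "\<exists>v\<in>V.span ?G. T v = w" if w: "w \<in> imT" for w
  proof -
    have lc: "\<exists>v\<in>V.span ?G. T v = Im.lincomb a F" if "finite F" "F \<subseteq> B" "a \<in> F \<rightarrow> carrier K" for F a
      using that
    proof (induct F rule: finite_induct)
      case empty
      show ?case by (rule bexI[of _ "\<zero>\<^bsub>V\<^esub>"]) simp_all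
    next
      case (insert x F)
      have x: "x \<in> imT" "F \<subseteq> imT" "a \<in> F \<rightarrow> carrier K" using insert B(2) by auto
      have eq: "Im.lincomb a (insert x F) = a x \<odot>\<^bsub>W\<^esub> x \<oplus>\<^bsub>W\<^esub> Im.lincomb a F"
        using Im.lincomb_insert2[of F a x] insert x by auto
      obtain y where y: "y \<in> B'" "x = T y" using insert B'(3) by auto
      obtain v where v: "v \<in> V.span ?G" "T v = Im.lincomb a F" using insert by auto
      have mem: "y \<in> carrier V" "v \<in> carrier V" "a x \<in> carrier K"
        using y B'(1) v sub.subset insert by auto
      show ?case
        by (rule bexI[of _ "a x \<odot>\<^bsub>V\<^esub> y \<oplus>\<^bsub>V\<^esub> v"])
          (use mem y v eq inG in \<open>auto intro!: sub.m_closed sub.smult_closed\<close>)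
    qed
    have "w \<in> Im.span B" using w B(3) by auto
    then obtain a where "a \<in> B \<rightarrow> carrier K" "Im.lincomb a B = w"
      using Im.finite_in_span[OF B(1)] B(2) by auto
    then show ?thesis using lc[OF B(1) subset_refl] by metis
  qed
  have "v \<in> V.span ?G" if v: "v \<in> carrier V" for v
  proof -
    have "T v \<in> imT" using v by (auto simp: im_def)
    from Tsp[OF this] obtain v' where v': "v' \<in> V.span ?G" "T v' = T v" by auto
    have v'V: "v' \<in> carrier V" using v' sub.subset by auto
    have "T (v \<ominus>\<^bsub>V\<^esub> v') = \<zero>\<^bsub>W\<^esub>" using v v'V v' by (simp add: W.M.r_neg W.M.minus_eq)
    then obtain u where "u \<in> carrier U" "v \<ominus>\<^bsub>V\<^esub> v' = S u" using exact v v'V by blast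
    then have "v \<ominus>\<^bsub>V\<^esub> v' \<in> V.span ?G" using SU by simp
    then have "(v \<ominus>\<^bsub>V\<^esub> v') \<oplus>\<^bsub>V\<^esub> v' \<in> V.span ?G" using v'(1) by (rule sub.m_closed)
    moreover have "(v \<ominus>\<^bsub>V\<^esub> v') \<oplus>\<^bsub>V\<^esub> v' = v" using v v'V
      by (simp add: V.M.minus_eq V.M.a_assoc V.M.l_neg)
    ultimately show ?thesis by simp
  qed
  then have "V.gen_set ?G" using sub.subset by auto
  moreover have "finite ?G" using A(1) B'(2) by simp
  ultimately show ?thesis using GV V.fin_dim_def by metis
qed

text \<open>The images form a descending chain of subspaces, and each strict inclusion lowers the
  dimension. This is the finite dimensional input to Fitting's lemma.\<close>

lemma image_powers_stabilize:
  assumes T: "linear_map K V V T" and fd: "vectorspace.fin_dim K V"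
  shows "\<exists>n. (T ^^ n) ` carrier V = (T ^^ Suc n) ` carrier V"
proof -
  interpret linear_map K V V T by fact
  define P where "P n = V.vs ((T ^^ n) ` carrier V)" for n
  have lin: "linear_map K V V (T ^^ n)" for n
  proof (induct n)
    case 0
    show ?case by unfold_locales (auto simp: module_hom_def)
  next
    case (Suc n)
    interpret n: linear_map K V V "T ^^ n" by fact
    show ?case by unfold_locales (auto simp: module_hom_def)
  qed
  have sub: "(T ^^ n) ` carrier V \<subseteq> carrier V" for n
  proof -
    interpret n: linear_map K V V "T ^^ n" by (rule lin)
    show ?thesis by auto
  qed
  have dec: "(T ^^ Suc n) ` carrier V \<subseteq> (T ^^ n) ` carrier V" for n
  proof -
    have "(T ^^ Suc n) v = (T ^^ n) (T v)" for v by (simp add: funpow_swap1)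
    then show ?thesis by auto
  qed
  have vs: "vectorspace K (P n)" for n
  proof -
    interpret n: linear_map K V V "T ^^ n" by (rule lin)
    show ?thesis using V.subspace_is_vs[OF n.imT_is_subspace] by (simp add: P_def n.im_def)
  qed
  have incl: "linear_map K (P n) V (\<lambda>v. v)" for n
  proof -
    interpret n: vectorspace K "P n" by (rule vs)
    show ?thesis by unfold_locales (use sub in \<open>auto simp: module_hom_def P_def\<close>)
  qed
  have fdP: "vectorspace.fin_dim K (P n)" for n
    by (rule fin_dim_if_inj[OF incl _ fd]) (auto simp: inj_on_def)
  have incl': "linear_map K (P (Suc n)) (P n) (\<lambda>v. v)" for n
  proof -
    interpret n: vectorspace K "P n" by (rule vs)
    interpret Sn: vectorspace K "P (Suc n)" by (rule vs)
    show ?thesis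
      by unfold_locales (use dec[of n] in \<open>auto simp: module_hom_def P_def simp del: funpow.simps\<close>)
  qed
  show ?thesis
  proof (rule ccontr)
    assume "\<not> ?thesis"
    then have "(\<lambda>v. v) ` carrier (P (Suc n)) \<noteq> carrier (P n)" for n
      by (simp add: P_def del: funpow.simps) metis
    then have less: "vectorspace.dim K (P (Suc n)) < vectorspace.dim K (P n)" for n
      using fin_dim_if_inj(2)[OF incl' _ fdP] by (auto simp: inj_on_def)
    then have "vectorspace.dim K (P n) + n \<le> vectorspace.dim K (P 0)" for n
    proof (induct n)
      case (Suc n)
      then show ?case using less[of n] by fastforce
    qed simp
    from this[of "Suc (vectorspace.dim K (P 0))"] show False by simp
  qed
qed

section \<open>Linear categories\<close>

context linear_category begin

text \<open>The category axioms ask for the membership of every object separately; bundling it with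
  the morphism lets rules be chained by \<open>OF\<close>.\<close>

definition arr :: "'m \<Rightarrow> 'o \<Rightarrow> 'o \<Rightarrow> bool" where
  "arr f X Y \<longleftrightarrow> X \<in> Obj C \<and> Y \<in> Obj C \<and> f \<in> mor C X Y"

lemma arr_obj: "arr f X Y \<Longrightarrow> X \<in> Obj C" "arr f X Y \<Longrightarrow> Y \<in> Obj C"
  by (auto simp: arr_def)

lemma arr_mor: "arr f X Y \<Longrightarrow> f \<in> mor C X Y"
  by (auto simp: arr_def)

lemma ide_arr: "X \<in> Obj C \<Longrightarrow> arr (Ide C X) X X"
  by (simp add: arr_def id_closed)

lemma comp_arr: "arr f X Y \<Longrightarrow> arr g Y Z \<Longrightarrow> arr (g \<star> f) X Z"
  using comp_closed[of X Y Z f g] by (simp add: arr_def)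

lemma arr_assoc: "arr f W X \<Longrightarrow> arr g X Y \<Longrightarrow> arr h Y Z \<Longrightarrow> (h \<star> g) \<star> f = h \<star> (g \<star> f)"
  using comp_assoc[of W X Y Z f g h] by (simp add: arr_def)

lemma arr_id_left: "arr f X Y \<Longrightarrow> Ide C Y \<star> f = f"
  and arr_id_right: "arr f X Y \<Longrightarrow> f \<star> Ide C X = f"
  using id_left[of X Y f] id_right[of X Y f] by (simp_all add: arr_def)

lemma zero_arr: "X \<in> Obj C \<Longrightarrow> Y \<in> Obj C \<Longrightarrow> arr (zero_mor C X Y) X Y"
proof -
  assume "X \<in> Obj C" "Y \<in> Obj C"
  then interpret vectorspace K "Hom C X Y" by (rule hom_vectorspace)
  show ?thesis by (simp add: arr_def \<open>X \<in> Obj C\<close> \<open>Y \<in> Obj C\<close>)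
qed

lemma add_arr: "arr f X Y \<Longrightarrow> arr g X Y \<Longrightarrow> arr (f \<oplus>\<^bsub>Hom C X Y\<^esub> g) X Y"
proof -
  assume *: "arr f X Y" "arr g X Y"
  then interpret vectorspace K "Hom C X Y" by (simp add: hom_vectorspace arr_def)
  show ?thesis using * by (simp add: arr_def)
qed

lemma neg_arr: "arr f X Y \<Longrightarrow> arr (\<ominus>\<^bsub>Hom C X Y\<^esub> f) X Y"
proof -
  assume *: "arr f X Y"
  then interpret vectorspace K "Hom C X Y" by (simp add: hom_vectorspace arr_def)
  show ?thesis using * by (simp add: arr_def)
qed

lemma minus_arr: "arr f X Y \<Longrightarrow> arr g X Y \<Longrightarrow> arr (f \<ominus>\<^bsub>Hom C X Y\<^esub> g) X Y"
  by (simp add: a_minus_def add_arr neg_arr)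

lemma smult_arr: "c \<in> carrier K \<Longrightarrow> arr f X Y \<Longrightarrow> arr (c \<odot>\<^bsub>Hom C X Y\<^esub> f) X Y"
proof -
  assume *: "c \<in> carrier K" "arr f X Y"
  then interpret vectorspace K "Hom C X Y" by (simp add: hom_vectorspace arr_def)
  show ?thesis using * by (simp add: arr_def)
qed

lemma neg_neg: "arr f X Y \<Longrightarrow> \<ominus>\<^bsub>Hom C X Y\<^esub> (\<ominus>\<^bsub>Hom C X Y\<^esub> f) = f"
proof -
  assume *: "arr f X Y"
  then interpret vectorspace K "Hom C X Y" by (simp add: hom_vectorspace arr_def)
  show ?thesis using * by (simp add: arr_def)
qed

lemma minus_eq_zero: "arr f X Y \<Longrightarrow> arr g X Y \<Longrightarrow> f \<ominus>\<^bsub>Hom C X Y\<^esub> g = zero_mor C X Y \<Longrightarrow> f = g"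
proof -
  assume *: "arr f X Y" "arr g X Y" "f \<ominus>\<^bsub>Hom C X Y\<^esub> g = zero_mor C X Y"
  then interpret vectorspace K "Hom C X Y" by (simp add: hom_vectorspace arr_def)
  show ?thesis using * M.minus_other_side[of f] by (simp add: arr_def)
qed

lemma minus_self: "arr f X Y \<Longrightarrow> f \<ominus>\<^bsub>Hom C X Y\<^esub> f = zero_mor C X Y"
proof -
  assume *: "arr f X Y"
  then interpret vectorspace K "Hom C X Y" by (simp add: hom_vectorspace arr_def)
  show ?thesis using * by (simp add: arr_def M.r_neg M.minus_eq)
qed

lemma add_minus_cancel: "arr f X Y \<Longrightarrow> arr g X Y \<Longrightarrow> g \<oplus>\<^bsub>Hom C X Y\<^esub> (f \<ominus>\<^bsub>Hom C X Y\<^esub> g) = f"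
proof -
  assume *: "arr f X Y" "arr g X Y"
  then interpret vectorspace K "Hom C X Y" by (simp add: hom_vectorspace arr_def)
  show ?thesis using * by (simp add: arr_def M.minus_eq M.a_lcomm[of g] M.r_neg)
qed

lemma add_zero: "arr f X Y \<Longrightarrow> f \<oplus>\<^bsub>Hom C X Y\<^esub> zero_mor C X Y = f"
  and zero_add: "arr f X Y \<Longrightarrow> zero_mor C X Y \<oplus>\<^bsub>Hom C X Y\<^esub> f = f"
proof -
  assume *: "arr f X Y"
  then interpret vectorspace K "Hom C X Y" by (simp add: hom_vectorspace arr_def)
  show "f \<oplus>\<^bsub>Hom C X Y\<^esub> zero_mor C X Y = f" "zero_mor C X Y \<oplus>\<^bsub>Hom C X Y\<^esub> f = f"
    using * by (simp_all add: arr_def)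
qed

lemma lin_post: "arr g Y Z \<Longrightarrow> X \<in> Obj C \<Longrightarrow> linear_map K (Hom C X Y) (Hom C X Z) (\<lambda>f. g \<star> f)"
  and lin_pre: "arr f X Y \<Longrightarrow> Z \<in> Obj C \<Longrightarrow> linear_map K (Hom C Y Z) (Hom C X Z) (\<lambda>g. g \<star> f)"
  using comp_linear_right[of X Y Z g] comp_linear_left[of X Y Z f] by (simp_all add: arr_def)

lemma
  assumes g: "arr g Y Z" and f: "arr f X Y"
  shows comp_add_right: "arr f' X Y \<Longrightarrow> g \<star> (f \<oplus>\<^bsub>Hom C X Y\<^esub> f') = g \<star> f \<oplus>\<^bsub>Hom C X Z\<^esub> g \<star> f'"
    and comp_neg_right: "g \<star> (\<ominus>\<^bsub>Hom C X Y\<^esub> f) = \<ominus>\<^bsub>Hom C X Z\<^esub> (g \<star> f)"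
    and comp_minus_right: "arr f' X Y \<Longrightarrow> g \<star> (f \<ominus>\<^bsub>Hom C X Y\<^esub> f') = g \<star> f \<ominus>\<^bsub>Hom C X Z\<^esub> g \<star> f'"
    and comp_smult_right: "c \<in> carrier K \<Longrightarrow> g \<star> (c \<odot>\<^bsub>Hom C X Y\<^esub> f) = c \<odot>\<^bsub>Hom C X Z\<^esub> (g \<star> f)"
proof -
  interpret linear_map K "Hom C X Y" "Hom C X Z" "\<lambda>f. g \<star> f" using lin_post[OF g] f arr_def by auto
  show "arr f' X Y \<Longrightarrow> g \<star> (f \<oplus>\<^bsub>Hom C X Y\<^esub> f') = g \<star> f \<oplus>\<^bsub>Hom C X Z\<^esub> g \<star> f'"
    "g \<star> (\<ominus>\<^bsub>Hom C X Y\<^esub> f) = \<ominus>\<^bsub>Hom C X Z\<^esub> (g \<star> f)"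
    "arr f' X Y \<Longrightarrow> g \<star> (f \<ominus>\<^bsub>Hom C X Y\<^esub> f') = g \<star> f \<ominus>\<^bsub>Hom C X Z\<^esub> g \<star> f'"
    "c \<in> carrier K \<Longrightarrow> g \<star> (c \<odot>\<^bsub>Hom C X Y\<^esub> f) = c \<odot>\<^bsub>Hom C X Z\<^esub> (g \<star> f)"
    using f unfolding arr_def by simp_all
qed

lemma
  assumes g: "arr g Y Z" and f: "arr f X Y"
  shows comp_add_left: "arr g' Y Z \<Longrightarrow> (g \<oplus>\<^bsub>Hom C Y Z\<^esub> g') \<star> f = g \<star> f \<oplus>\<^bsub>Hom C X Z\<^esub> g' \<star> f"
    and comp_neg_left: "(\<ominus>\<^bsub>Hom C Y Z\<^esub> g) \<star> f = \<ominus>\<^bsub>Hom C X Z\<^esub> (g \<star> f)"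
    and comp_minus_left: "arr g' Y Z \<Longrightarrow> (g \<ominus>\<^bsub>Hom C Y Z\<^esub> g') \<star> f = g \<star> f \<ominus>\<^bsub>Hom C X Z\<^esub> g' \<star> f"
    and comp_smult_left: "c \<in> carrier K \<Longrightarrow> (c \<odot>\<^bsub>Hom C Y Z\<^esub> g) \<star> f = c \<odot>\<^bsub>Hom C X Z\<^esub> (g \<star> f)"
proof -
  interpret linear_map K "Hom C Y Z" "Hom C X Z" "\<lambda>g. g \<star> f" using lin_pre[OF f] g arr_def by auto
  show "arr g' Y Z \<Longrightarrow> (g \<oplus>\<^bsub>Hom C Y Z\<^esub> g') \<star> f = g \<star> f \<oplus>\<^bsub>Hom C X Z\<^esub> g' \<star> f"
    "(\<ominus>\<^bsub>Hom C Y Z\<^esub> g) \<star> f = \<ominus>\<^bsub>Hom C X Z\<^esub> (g \<star> f)"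
    "arr g' Y Z \<Longrightarrow> (g \<ominus>\<^bsub>Hom C Y Z\<^esub> g') \<star> f = g \<star> f \<ominus>\<^bsub>Hom C X Z\<^esub> g' \<star> f"
    "c \<in> carrier K \<Longrightarrow> (c \<odot>\<^bsub>Hom C Y Z\<^esub> g) \<star> f = c \<odot>\<^bsub>Hom C X Z\<^esub> (g \<star> f)"
    using g unfolding arr_def by simp_all
qed

lemma comp_zero_right: "arr g Y Z \<Longrightarrow> X \<in> Obj C \<Longrightarrow> g \<star> zero_mor C X Y = zero_mor C X Z"
proof -
  assume g: "arr g Y Z" and "X \<in> Obj C"
  then interpret linear_map K "Hom C X Y" "Hom C X Z" "\<lambda>f. g \<star> f" by (rule lin_post)
  show ?thesis by simp
qed

lemma comp_zero_left: "arr f X Y \<Longrightarrow> Z \<in> Obj C \<Longrightarrow> zero_mor C Y Z \<star> f = zero_mor C X Z"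
proof -
  assume f: "arr f X Y" and "Z \<in> Obj C"
  then interpret linear_map K "Hom C Y Z" "Hom C X Z" "\<lambda>g. g \<star> f" by (rule lin_pre)
  show ?thesis by simp
qed

lemma neg_eq_zeroD: "arr f X Y \<Longrightarrow> \<ominus>\<^bsub>Hom C X Y\<^esub> f = zero_mor C X Y \<Longrightarrow> f = zero_mor C X Y"
proof -
  assume *: "arr f X Y" "\<ominus>\<^bsub>Hom C X Y\<^esub> f = zero_mor C X Y"
  then interpret vectorspace K "Hom C X Y" by (simp add: hom_vectorspace arr_def)
  show ?thesis using neg_neg[OF *(1)] M.minus_equality[of "zero_mor C X Y" "zero_mor C X Y"] by (simp add: *(2))
qed

lemma neg_zero: "X \<in> Obj C \<Longrightarrow> Y \<in> Obj C \<Longrightarrow> \<ominus>\<^bsub>Hom C X Y\<^esub> zero_mor C X Y = zero_mor C X Y"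
  using neg_eq_zeroD[OF neg_arr[OF zero_arr], of X Y] neg_neg[OF zero_arr, of X Y] by simp

lemma hom_zero_iff:
  "X \<in> Obj C \<Longrightarrow> Y \<in> Obj C \<Longrightarrow> hom_zero C X Y \<longleftrightarrow> (\<forall>f. arr f X Y \<longrightarrow> f = zero_mor C X Y)"
  unfolding hom_zero_def using zero_arr[of X Y] by (auto simp: arr_def)

lemma hom_zeroD: "hom_zero C X Y \<Longrightarrow> arr f X Y \<Longrightarrow> f = zero_mor C X Y"
  by (auto simp: hom_zero_def arr_def)

lemma hom_zero_fin_dim:
  assumes "X \<in> Obj C" "Y \<in> Obj C" "hom_zero C X Y"
  shows "vectorspace.fin_dim K (Hom C X Y)"
proof -
  interpret vectorspace K "Hom C X Y" using assms by (simp add: hom_vectorspace)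
  have "gen_set {}" using assms(3) by (simp add: hom_zero_def span_empty)
  then show ?thesis unfolding fin_dim_def by auto
qed

text \<open>Isomorphic objects and direct summands are both retracts, so one closure proof serves
  both.\<close>

definition retract :: "'o \<Rightarrow> 'o \<Rightarrow> bool" where
  "retract Y X \<longleftrightarrow> (\<exists>s r. arr s Y X \<and> arr r X Y \<and> r \<star> s = Ide C Y)"

lemma retract_obj: "retract Y X \<Longrightarrow> Y \<in> Obj C" "retract Y X \<Longrightarrow> X \<in> Obj C"
  by (auto simp: retract_def arr_def)

lemma hom_zero_retract_left:
  assumes "retract Y X" "hom_zero C X W" "W \<in> Obj C"
  shows "hom_zero C Y W"
proof -
  obtain s r where *: "arr s Y X" "arr r X Y" "r \<star> s = Ide C Y" using assms by (auto simp: retract_def)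
  have "f = zero_mor C Y W" if f: "arr f Y W" for f
  proof -
    have "f = (f \<star> r) \<star> s" using * f by (metis arr_assoc arr_id_right)
    also have "f \<star> r = zero_mor C X W" using hom_zeroD[OF assms(2)] comp_arr * f by blast
    finally show ?thesis using * assms(3) by (simp add: comp_zero_left)
  qed
  then show ?thesis using hom_zero_iff retract_obj assms by blast
qed

lemma hom_zero_retract_right:
  assumes "retract Y X" "hom_zero C W X" "W \<in> Obj C"
  shows "hom_zero C W Y"
proof -
  obtain s r where *: "arr s Y X" "arr r X Y" "r \<star> s = Ide C Y" using assms by (auto simp: retract_def)
  have "f = zero_mor C W Y" if f: "arr f W Y" for f
  proof -
    have "f = r \<star> (s \<star> f)" using * f by (metis arr_assoc arr_id_left)
    also have "s \<star> f = zero_mor C W X" using hom_zeroD[OF assms(2)] comp_arr * f by blast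
    finally show ?thesis using * assms(3) by (simp add: comp_zero_right)
  qed
  then show ?thesis using hom_zero_iff retract_obj assms by blast
qed

lemma fin_dim_retract_left:
  assumes "retract Y X" "W \<in> Obj C" "vectorspace.fin_dim K (Hom C X W)"
  shows "vectorspace.fin_dim K (Hom C Y W)"
proof -
  obtain s r where *: "arr s Y X" "arr r X Y" "r \<star> s = Ide C Y" using assms by (auto simp: retract_def)
  have "f = (f \<star> r) \<star> s" if "arr f Y W" for f using * that by (metis arr_assoc arr_id_right)
  then have "inj_on (\<lambda>f. f \<star> r) (mor C Y W)"
    using retract_obj[OF assms(1)] assms(2) unfolding arr_def by (intro inj_on_inverseI[of _ "\<lambda>f. f \<star> s"]) simp
  then show ?thesis using fin_dim_if_inj(1)[OF lin_pre[OF *(2) assms(2)]] assms(3) by blast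
qed

lemma fin_dim_retract_right:
  assumes "retract Y X" "W \<in> Obj C" "vectorspace.fin_dim K (Hom C W X)"
  shows "vectorspace.fin_dim K (Hom C W Y)"
proof -
  obtain s r where *: "arr s Y X" "arr r X Y" "r \<star> s = Ide C Y" using assms by (auto simp: retract_def)
  have "f = r \<star> (s \<star> f)" if "arr f W Y" for f using * that by (metis arr_assoc arr_id_left)
  then have "inj_on (\<lambda>f. s \<star> f) (mor C W Y)"
    using retract_obj[OF assms(1)] assms(2) unfolding arr_def by (intro inj_on_inverseI[of _ "\<lambda>f. r \<star> f"]) simp
  then show ?thesis using fin_dim_if_inj(1)[OF lin_post[OF *(1) assms(2)]] assms(3) by blast
qed

lemma is_iso_iff:
  "is_iso C X Y f \<longleftrightarrow> f \<in> mor C X Y \<and> (\<exists>g. g \<in> mor C Y X \<and> g \<star> f = Ide C X \<and> f \<star> g = Ide C Y)"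
  by (auto simp: is_iso_def)

lemma is_isoE:
  assumes "is_iso C X Y f" "X \<in> Obj C" "Y \<in> Obj C"
  obtains g where "arr f X Y" "arr g Y X" "g \<star> f = Ide C X" "f \<star> g = Ide C Y"
proof -
  from assms(1) obtain g where "g \<in> mor C Y X" "g \<star> f = Ide C X" "f \<star> g = Ide C Y" "f \<in> mor C X Y"
    by (auto simp: is_iso_iff)
  then show thesis using that[of g] assms by (simp add: arr_def)
qed

lemma is_isoI: "arr f X Y \<Longrightarrow> arr g Y X \<Longrightarrow> g \<star> f = Ide C X \<Longrightarrow> f \<star> g = Ide C Y \<Longrightarrow> is_iso C X Y f"
  by (auto simp: is_iso_iff arr_def)

lemma isomorphicE:
  assumes "isomorphic C X Y" "X \<in> Obj C" "Y \<in> Obj C"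
  obtains f g where "arr f X Y" "arr g Y X" "g \<star> f = Ide C X" "f \<star> g = Ide C Y"
proof -
  from assms(1) obtain f where "is_iso C X Y f" by (auto simp: isomorphic_def)
  then show thesis by (rule is_isoE) (use assms that in auto)
qed

lemma isomorphicI: "arr f X Y \<Longrightarrow> arr g Y X \<Longrightarrow> g \<star> f = Ide C X \<Longrightarrow> f \<star> g = Ide C Y \<Longrightarrow> isomorphic C X Y"
  unfolding isomorphic_def by (rule exI, rule is_isoI)

lemma is_iso_ide: "X \<in> Obj C \<Longrightarrow> is_iso C X X (Ide C X)"
  by (rule is_isoI) (auto intro: ide_arr simp: id_left id_closed)

lemma isomorphic_retract: "isomorphic C X Y \<Longrightarrow> X \<in> Obj C \<Longrightarrow> Y \<in> Obj C \<Longrightarrow> retract X Y"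
  using isomorphicE[of X Y] retract_def by metis

lemma isomorphic_sym: "isomorphic C X Y \<Longrightarrow> X \<in> Obj C \<Longrightarrow> Y \<in> Obj C \<Longrightarrow> isomorphic C Y X"
  using isomorphicE[of X Y] isomorphicI by metis

lemma isomorphic_refl: "X \<in> Obj C \<Longrightarrow> isomorphic C X X"
  unfolding isomorphic_def using is_iso_ide by blast

lemma isomorphic_trans:
  "isomorphic C X Y \<Longrightarrow> isomorphic C Y Z \<Longrightarrow> X \<in> Obj C \<Longrightarrow> Y \<in> Obj C \<Longrightarrow> Z \<in> Obj C \<Longrightarrow> isomorphic C X Z"
proof -
  assume "isomorphic C X Y" "isomorphic C Y Z" and o: "X \<in> Obj C" "Y \<in> Obj C" "Z \<in> Obj C"
  obtain f g where f: "arr f X Y" "arr g Y X" "g \<star> f = Ide C X" "f \<star> g = Ide C Y"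
    by (rule isomorphicE[OF \<open>isomorphic C X Y\<close> o(1,2)])
  obtain f' g' where f': "arr f' Y Z" "arr g' Z Y" "g' \<star> f' = Ide C Y" "f' \<star> g' = Ide C Z"
    by (rule isomorphicE[OF \<open>isomorphic C Y Z\<close> o(2,3)])
  note * = f f'
  have "(g \<star> g') \<star> (f' \<star> f) = g \<star> ((g' \<star> f') \<star> f)"
    using arr_assoc[OF comp_arr[OF *(1,5)] *(6,2)] arr_assoc[OF *(1,5,6)] by simp
  moreover have "(f' \<star> f) \<star> (g \<star> g') = f' \<star> ((f \<star> g) \<star> g')"
    using arr_assoc[OF comp_arr[OF *(6,2)] *(1,5)] arr_assoc[OF *(6,2,1)] by simp
  ultimately show ?thesis
    using * comp_arr by (intro isomorphicI[of "f' \<star> f" _ _ "g \<star> g'"]) (auto simp: arr_id_left)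
qed

lemma hom_zero_iso:
  assumes "isomorphic C X X'" "isomorphic C Y Y'" "X \<in> Obj C" "X' \<in> Obj C" "Y \<in> Obj C" "Y' \<in> Obj C"
  shows "hom_zero C X Y \<longleftrightarrow> hom_zero C X' Y'"
proof -
  have "retract X X'" "retract X' X" "retract Y Y'" "retract Y' Y"
    using assms isomorphic_retract isomorphic_sym by auto
  then show ?thesis using assms hom_zero_retract_left hom_zero_retract_right by blast
qed

lemma zero_object_homs:
  assumes "zero_object C Z" "X \<in> Obj C"
  shows "hom_zero C X Z" "hom_zero C Z X"
  using assms by (auto simp: zero_object_def)

lemma zero_object_iff: "X \<in> Obj C \<Longrightarrow> zero_object C X \<longleftrightarrow> Ide C X = zero_mor C X X"
proof
  assume X: "X \<in> Obj C" and "Ide C X = zero_mor C X X"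
  moreover have "f = zero_mor C X Y" if "arr f X Y" for f Y
    using that X calculation(2) by (metis arr_id_right arr_obj(2) comp_zero_right)
  moreover have "f = zero_mor C Y X" if "arr f Y X" for f Y
    using that X calculation(2) by (metis arr_id_left arr_obj(1) comp_zero_left)
  ultimately show "zero_object C X" by (simp add: zero_object_def hom_zero_iff)
next
  assume "X \<in> Obj C" "zero_object C X"
  then show "Ide C X = zero_mor C X X" by (metis zero_object_def hom_zeroD ide_arr)
qed

lemma retract_zero_object: "zero_object C Z \<Longrightarrow> X \<in> Obj C \<Longrightarrow> retract Z X"
proof -
  assume Z: "zero_object C Z" and X: "X \<in> Obj C"
  then have "Z \<in> Obj C" "zero_mor C Z Z = Ide C Z" using zero_object_iff by (auto simp: zero_object_def)
  then show ?thesis unfolding retract_def using X zero_arr comp_zero_left by metis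
qed

text \<open>The equation for the sum of the \<open>\<iota> i \<star> \<pi> i\<close> is traded for
  its two useful consequences: inclusions jointly detect zero maps out of \<open>B\<close>,
  projections zero maps into \<open>B\<close>. Both come from inserting the identity as this sum,
  after which \<open>finsum\<close> does not have to be touched again.\<close>

lemma finite_direct_sumE:
  assumes "finite_direct_sum C I A B"
  obtains \<iota> \<pi> where "\<And>i. i \<in> I \<Longrightarrow> arr (\<iota> i) (A i) B" "\<And>i. i \<in> I \<Longrightarrow> arr (\<pi> i) B (A i)"
    "\<And>i. i \<in> I \<Longrightarrow> \<pi> i \<star> \<iota> i = Ide C (A i)"
    "\<And>i j. i \<in> I \<Longrightarrow> j \<in> I \<Longrightarrow> i \<noteq> j \<Longrightarrow> \<pi> j \<star> \<iota> i = zero_mor C (A i) (A j)"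
    "\<And>f X. arr f B X \<Longrightarrow> (\<And>i. i \<in> I \<Longrightarrow> f \<star> \<iota> i = zero_mor C (A i) X) \<Longrightarrow> f = zero_mor C B X"
    "\<And>f X. arr f X B \<Longrightarrow> (\<And>i. i \<in> I \<Longrightarrow> \<pi> i \<star> f = zero_mor C X (A i)) \<Longrightarrow> f = zero_mor C X B"
proof -
  have I: "finite I" and A: "\<And>i. i \<in> I \<Longrightarrow> A i \<in> Obj C" and B: "B \<in> Obj C"
    using assms by (auto simp: finite_direct_sum_def)
  obtain \<iota> \<pi> where *: "\<forall>i\<in>I. \<iota> i \<in> mor C (A i) B \<and> \<pi> i \<in> mor C B (A i)"
    "\<forall>i\<in>I. \<forall>j\<in>I. \<pi> j \<star> \<iota> i = (if i = j then Ide C (A i) else zero_mor C (A i) (A j))"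
    "finsum (Hom C B B) (\<lambda>i. \<iota> i \<star> \<pi> i) I = Ide C B"
    using assms unfolding finite_direct_sum_def by blast
  have i: "arr (\<iota> i) (A i) B" and p: "arr (\<pi> i) B (A i)" if "i \<in> I" for i
    using * A B that by (auto simp: arr_def)
  have ip: "(\<lambda>i. \<iota> i \<star> \<pi> i) \<in> I \<rightarrow> mor C B B"
    using comp_arr[OF p i] by (auto simp: arr_def)
  interpret BB: vectorspace K "Hom C B B" using B by (simp add: hom_vectorspace)
  have l: "f = zero_mor C B X" if f: "arr f B X" and z: "\<And>i. i \<in> I \<Longrightarrow> f \<star> \<iota> i = zero_mor C (A i) X" for f X
  proof -
    have X: "X \<in> Obj C" using f arr_obj by blast
    interpret WW: vectorspace K "Hom C B X" using B X by (simp add: hom_vectorspace)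
    interpret linear_map K "Hom C B B" "Hom C B X" "\<lambda>g. f \<star> g" using lin_post[OF f B] .
    have "f = f \<star> finsum (Hom C B B) (\<lambda>i. \<iota> i \<star> \<pi> i) I" using *(3) f by (simp add: arr_id_right)
    also have "\<dots> = finsum (Hom C B X) (\<lambda>i. f \<star> (\<iota> i \<star> \<pi> i)) I"
    proof -
      have "f \<star> finsum (Hom C B B) (\<lambda>i. \<iota> i \<star> \<pi> i) J = finsum (Hom C B X) (\<lambda>i. f \<star> (\<iota> i \<star> \<pi> i)) J"
        if "finite J" "J \<subseteq> I" for J using that
      proof (induct J rule: finite_induct)
        case (insert x J)
        have 1: "(\<lambda>i. \<iota> i \<star> \<pi> i) \<in> J \<rightarrow> mor C B B" "\<iota> x \<star> \<pi> x \<in> mor C B B" using ip insert by auto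
        then have 2: "(\<lambda>i. f \<star> (\<iota> i \<star> \<pi> i)) \<in> J \<rightarrow> mor C B X" "f \<star> (\<iota> x \<star> \<pi> x) \<in> mor C B X" by auto
        show ?case using insert 1 2 by (simp add: BB.M.finsum_insert WW.M.finsum_insert)
      qed simp
      then show ?thesis using I by simp
    qed
    also have "\<dots> = finsum (Hom C B X) (\<lambda>i. zero_mor C B X) I"
    proof (rule WW.M.finsum_cong')
      fix j assume j: "j \<in> I"
      have "f \<star> (\<iota> j \<star> \<pi> j) = (f \<star> \<iota> j) \<star> \<pi> j" using arr_assoc p[OF j] i[OF j] f by metis
      then show "f \<star> (\<iota> j \<star> \<pi> j) = zero_mor C B X" using z[OF j] p[OF j] X by (simp add: comp_zero_left)
    qed auto
    finally show ?thesis by simp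
  qed
  have r: "f = zero_mor C X B" if f: "arr f X B" and z: "\<And>i. i \<in> I \<Longrightarrow> \<pi> i \<star> f = zero_mor C X (A i)" for f X
  proof -
    have X: "X \<in> Obj C" using f arr_obj by blast
    interpret WW: vectorspace K "Hom C X B" using B X by (simp add: hom_vectorspace)
    interpret linear_map K "Hom C B B" "Hom C X B" "\<lambda>g. g \<star> f" using lin_pre[OF f B] .
    have "f = finsum (Hom C B B) (\<lambda>i. \<iota> i \<star> \<pi> i) I \<star> f" using *(3) f by (simp add: arr_id_left)
    also have "\<dots> = finsum (Hom C X B) (\<lambda>i. (\<iota> i \<star> \<pi> i) \<star> f) I"
    proof -
      have "finsum (Hom C B B) (\<lambda>i. \<iota> i \<star> \<pi> i) J \<star> f = finsum (Hom C X B) (\<lambda>i. (\<iota> i \<star> \<pi> i) \<star> f) J"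
        if "finite J" "J \<subseteq> I" for J using that
      proof (induct J rule: finite_induct)
        case (insert x J)
        have 1: "(\<lambda>i. \<iota> i \<star> \<pi> i) \<in> J \<rightarrow> mor C B B" "\<iota> x \<star> \<pi> x \<in> mor C B B" using ip insert by auto
        then have 2: "(\<lambda>i. (\<iota> i \<star> \<pi> i) \<star> f) \<in> J \<rightarrow> mor C X B" "(\<iota> x \<star> \<pi> x) \<star> f \<in> mor C X B" by auto
        show ?case using insert 1 2 by (simp add: BB.M.finsum_insert WW.M.finsum_insert)
      qed simp
      then show ?thesis using I by simp
    qed
    also have "\<dots> = finsum (Hom C X B) (\<lambda>i. zero_mor C X B) I"
    proof (rule WW.M.finsum_cong')
      fix j assume j: "j \<in> I"
      have "(\<iota> j \<star> \<pi> j) \<star> f = \<iota> j \<star> (\<pi> j \<star> f)" using arr_assoc p[OF j] i[OF j] f by metis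
      then show "(\<iota> j \<star> \<pi> j) \<star> f = zero_mor C X B" using z[OF j] i[OF j] X by (simp add: comp_zero_right)
    qed auto
    finally show ?thesis by simp
  qed
  show thesis by (rule that[of \<iota> \<pi>]) (use i p *(2) l r in auto)
qed

lemma direct_sum2I:
  assumes "arr i1 X B" "arr i2 Y B" "arr p1 B X" "arr p2 B Y"
    "p1 \<star> i1 = Ide C X" "p2 \<star> i2 = Ide C Y" "p2 \<star> i1 = zero_mor C X Y" "p1 \<star> i2 = zero_mor C Y X"
    "(i1 \<star> p1) \<oplus>\<^bsub>Hom C B B\<^esub> (i2 \<star> p2) = Ide C B"
  shows "direct_sum2 C X Y B"
proof -
  have B: "B \<in> Obj C" using assms arr_obj by blast
  interpret vectorspace K "Hom C B B" using B by (simp add: hom_vectorspace)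
  have 1: "i1 \<star> p1 \<in> mor C B B" "i2 \<star> p2 \<in> mor C B B"
    using assms comp_arr arr_mor by blast+
  have "finsum (Hom C B B) (\<lambda>b. (if b then i2 else i1) \<star> (if b then p2 else p1)) {False, True} = Ide C B"
    using 1 assms(9) by (simp add: M.finsum_insert)
  then have "\<exists>\<iota> \<pi>. (\<forall>i\<in>{False, True}. \<iota> i \<in> mor C (if i then Y else X) B \<and> \<pi> i \<in> mor C B (if i then Y else X)) \<and>
       (\<forall>i\<in>{False, True}. \<forall>j\<in>{False, True}. \<pi> j \<star> \<iota> i =
          (if i = j then Ide C (if i then Y else X) else zero_mor C (if i then Y else X) (if j then Y else X))) \<and>
       finsum (Hom C B B) (\<lambda>i. \<iota> i \<star> \<pi> i) {False, True} = Ide C B"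
    using assms(1-8)
    by (intro exI[of _ "\<lambda>b. if b then i2 else i1"] exI[of _ "\<lambda>b. if b then p2 else p1"])
      (simp add: arr_def)
  then show ?thesis unfolding finite_direct_sum_def using assms(1-4) by (simp add: arr_def)
qed

lemma direct_sum2E:
  assumes "direct_sum2 C X Y B"
  obtains i1 i2 p1 p2 where "arr i1 X B" "arr i2 Y B" "arr p1 B X" "arr p2 B Y"
    "p1 \<star> i1 = Ide C X" "p2 \<star> i2 = Ide C Y" "p2 \<star> i1 = zero_mor C X Y" "p1 \<star> i2 = zero_mor C Y X"
    "\<And>f Z. arr f Z B \<Longrightarrow> p1 \<star> f = zero_mor C Z X \<Longrightarrow> p2 \<star> f = zero_mor C Z Y \<Longrightarrow> f = zero_mor C Z B"
proof -
  show thesis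
  proof (rule finite_direct_sumE[OF assms])
    fix i p
    assume
      i: "\<And>b. b \<in> {False, True} \<Longrightarrow> arr (i b) (if b then Y else X) B"
      and p: "\<And>b. b \<in> {False, True} \<Longrightarrow> arr (p b) B (if b then Y else X)"
      and 1: "\<And>b. b \<in> {False, True} \<Longrightarrow> p b \<star> i b = Ide C (if b then Y else X)"
      and 2: "\<And>b c. b \<in> {False, True} \<Longrightarrow> c \<in> {False, True} \<Longrightarrow> b \<noteq> c \<Longrightarrow>
         p c \<star> i b = zero_mor C (if b then Y else X) (if c then Y else X)"
      and 3: "\<And>f Z. arr f Z B \<Longrightarrow> (\<And>b. b \<in> {False, True} \<Longrightarrow> p b \<star> f = zero_mor C Z (if b then Y else X)) \<Longrightarrow> f = zero_mor C Z B"
    have 4: "f = zero_mor C Z B" if "arr f Z B" "p False \<star> f = zero_mor C Z X" "p True \<star> f = zero_mor C Z Y" for f Z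
      by (rule 3) (use that in auto)
    show thesis
      by (rule that[of "i False" "i True" "p False" "p True"])
        (use i[of False] i[of True] p[of False] p[of True] 1[of False] 1[of True] 2[of True False] 2[of False True] 4 in auto)
  qed
qed

lemma direct_sum2_retracts: "direct_sum2 C X Y B \<Longrightarrow> retract X B \<and> retract Y B"
  by (erule direct_sum2E) (simp add: retract_def, blast)

end

section \<open>Triangulated categories\<close>

context triangulated_category begin

lemma Sho_obj: "X \<in> Obj C \<Longrightarrow> Sho C X \<in> Obj C"
  and Shm_ide: "X \<in> Obj C \<Longrightarrow> Shm C (Ide C X) = Ide C (Sho C X)"
  using shift_equivalence by (auto simp: linear_equivalence_def linear_functor_def)

lemma Shm_linear: "X \<in> Obj C \<Longrightarrow> Y \<in> Obj C \<Longrightarrow> linear_map K (Hom C X Y) (Hom C (Sho C X) (Sho C Y)) (Shm C)"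
  and Shm_bij: "X \<in> Obj C \<Longrightarrow> Y \<in> Obj C \<Longrightarrow> bij_betw (Shm C) (mor C X Y) (mor C (Sho C X) (Sho C Y))"
  and Sho_surj: "X \<in> Obj C \<Longrightarrow> \<exists>Y\<in>Obj C. isomorphic C (Sho C Y) X"
  using shift_equivalence by (auto simp: linear_equivalence_def linear_functor_def)

lemma Shm_comp: "arr f X Y \<Longrightarrow> arr g Y Z \<Longrightarrow> Shm C (g \<star> f) = Shm C g \<star> Shm C f"
  using shift_equivalence unfolding linear_equivalence_def linear_functor_def arr_def by blast

lemma Shm_arr: "arr f X Y \<Longrightarrow> arr (Shm C f) (Sho C X) (Sho C Y)"
  using Shm_bij[of X Y] by (auto simp: arr_def bij_betw_def Sho_obj)

lemma Shm_inj: "Shm C f = Shm C g \<Longrightarrow> arr f X Y \<Longrightarrow> arr g X Y \<Longrightarrow> f = g"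
  using Shm_bij[of X Y] by (auto simp: arr_def bij_betw_def dest: inj_onD)

lemma Shm_full: "arr f (Sho C X) (Sho C Y) \<Longrightarrow> X \<in> Obj C \<Longrightarrow> Y \<in> Obj C \<Longrightarrow> \<exists>g. arr g X Y \<and> Shm C g = f"
proof -
  assume f: "arr f (Sho C X) (Sho C Y)" and o: "X \<in> Obj C" "Y \<in> Obj C"
  have "f \<in> Shm C ` mor C X Y" using Shm_bij[OF o] f by (simp add: bij_betw_def arr_def)
  then show ?thesis using o by (auto simp: arr_def)
qed

lemma Shm_neg: "arr f X Y \<Longrightarrow> Shm C (\<ominus>\<^bsub>Hom C X Y\<^esub> f) = \<ominus>\<^bsub>Hom C (Sho C X) (Sho C Y)\<^esub> Shm C f"
proof -
  assume f: "arr f X Y"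
  interpret linear_map K "Hom C X Y" "Hom C (Sho C X) (Sho C Y)" "Shm C"
    using Shm_linear f arr_obj by blast
  show ?thesis using f by (simp add: arr_def)
qed

lemma Shm_zero: "X \<in> Obj C \<Longrightarrow> Y \<in> Obj C \<Longrightarrow> Shm C (zero_mor C X Y) = zero_mor C (Sho C X) (Sho C Y)"
proof -
  assume "X \<in> Obj C" "Y \<in> Obj C"
  then interpret linear_map K "Hom C X Y" "Hom C (Sho C X) (Sho C Y)" "Shm C" by (rule Shm_linear)
  show ?thesis by simp
qed

lemma hom_zero_Sho: "X \<in> Obj C \<Longrightarrow> Y \<in> Obj C \<Longrightarrow> hom_zero C (Sho C X) (Sho C Y) \<longleftrightarrow> hom_zero C X Y"
proof -
  assume o: "X \<in> Obj C" "Y \<in> Obj C"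
  have "hom_zero C X Y" if h: "hom_zero C (Sho C X) (Sho C Y)"
  proof -
    have "f = zero_mor C X Y" if f: "arr f X Y" for f
      using hom_zeroD[OF h Shm_arr[OF f]] Shm_zero[OF o] Shm_inj[OF _ f zero_arr[OF o]] by simp
    then show ?thesis using o by (simp add: hom_zero_iff)
  qed
  moreover have "hom_zero C (Sho C X) (Sho C Y)" if h: "hom_zero C X Y"
  proof -
    have "f = zero_mor C (Sho C X) (Sho C Y)" if f: "arr f (Sho C X) (Sho C Y)" for f
      using Shm_full[OF f o] hom_zeroD[OF h] Shm_zero[OF o] by auto
    then show ?thesis using o by (simp add: hom_zero_iff Sho_obj)
  qed
  ultimately show ?thesis by blast
qed

lemma fin_dim_Sho:
  assumes o: "X \<in> Obj C" "Y \<in> Obj C"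
  shows "vectorspace.fin_dim K (Hom C (Sho C X) (Sho C Y)) \<longleftrightarrow> vectorspace.fin_dim K (Hom C X Y)"
proof -
  have b: "inj_on (Shm C) (mor C X Y)" "Shm C ` mor C X Y = mor C (Sho C X) (Sho C Y)"
    using Shm_bij[OF o] by (auto simp: bij_betw_def)
  show ?thesis
    using fin_dim_if_inj(1)[OF Shm_linear[OF o] b(1)] fin_dim_if_surj[OF Shm_linear[OF o] b(2)] by blast
qed

lemma isomorphic_Sho: "X \<in> Obj C \<Longrightarrow> Y \<in> Obj C \<Longrightarrow> isomorphic C (Sho C X) (Sho C Y) \<longleftrightarrow> isomorphic C X Y"
proof
  assume o: "X \<in> Obj C" "Y \<in> Obj C" and "isomorphic C (Sho C X) (Sho C Y)"
  then obtain f g where f: "arr f (Sho C X) (Sho C Y)" "arr g (Sho C Y) (Sho C X)"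
    "g \<star> f = Ide C (Sho C X)" "f \<star> g = Ide C (Sho C Y)"
    using isomorphicE Sho_obj by metis
  obtain f' where f': "arr f' X Y" "Shm C f' = f" using Shm_full f o by blast
  obtain g' where g': "arr g' Y X" "Shm C g' = g" using Shm_full f o by blast
  have "g' \<star> f' = Ide C X"
    by (rule Shm_inj[of _ _ X X]) (use f f' g' o in \<open>auto simp: Shm_comp Shm_ide intro: comp_arr ide_arr\<close>)
  moreover have "f' \<star> g' = Ide C Y"
    by (rule Shm_inj[of _ _ Y Y]) (use f f' g' o in \<open>auto simp: Shm_comp Shm_ide intro: comp_arr ide_arr\<close>)
  ultimately show "isomorphic C X Y" using f' g' isomorphicI by blast
next
  assume o: "X \<in> Obj C" "Y \<in> Obj C" and "isomorphic C X Y"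
  then obtain f g where f: "arr f X Y" "arr g Y X" "g \<star> f = Ide C X" "f \<star> g = Ide C Y"
    using isomorphicE by metis
  then show "isomorphic C (Sho C X) (Sho C Y)"
    using Shm_comp[OF f(1,2)] Shm_comp[OF f(2,1)] o Shm_ide Shm_arr
    by (intro isomorphicI[of "Shm C f" _ _ "Shm C g"]) auto
qed

section \<open>Exactness of Hom functors on triangles\<close>

abbreviation tri :: "'o \<Rightarrow> 'o \<Rightarrow> 'o \<Rightarrow> 'm \<Rightarrow> 'm \<Rightarrow> 'm \<Rightarrow> bool" where
  "tri X Y Z f g h \<equiv> (X, Y, Z, f, g, h) \<in> Tri C"

lemma triD:
  assumes "tri X Y Z f g h"
  shows "arr f X Y" "arr g Y Z" "arr h Z (Sho C X)"
  using tri_candidate[OF assms] by (auto simp: candidate_triangle_def arr_def Sho_obj)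

lemma candI: "arr f X Y \<Longrightarrow> arr g Y Z \<Longrightarrow> arr h Z (Sho C X) \<Longrightarrow> candidate_triangle C (X, Y, Z, f, g, h)"
  by (auto simp: candidate_triangle_def arr_def)

lemma rot: "tri X Y Z f g h \<Longrightarrow> tri Y Z (Sho C X) g h (\<ominus>\<^bsub>Hom C (Sho C X) (Sho C Y)\<^esub> Shm C f)"
  using TR2[OF tri_candidate] by blast

lemma unrot:
  "tri Y Z (Sho C X) g h (\<ominus>\<^bsub>Hom C (Sho C X) (Sho C Y)\<^esub> Shm C f) \<Longrightarrow> arr f X Y \<Longrightarrow> tri X Y Z f g h"
  using TR2[of X Y Z f g h] triD candI by meson

lemma tri_cone: "arr f X Y \<Longrightarrow> \<exists>Z g h. tri X Y Z f g h"
  using TR1_cone by (simp add: arr_def)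

lemma TR3_arr:
  assumes "tri X Y Z f g h" "tri X' Y' Z' f' g' h'" "arr a X X'" "arr b Y Y'" "f' \<star> a = b \<star> f"
  obtains c where "arr c Z Z'" "g' \<star> b = c \<star> g" "h' \<star> c = Shm C a \<star> h"
  using TR3[OF assms(1,2) arr_mor[OF assms(3)] arr_mor[OF assms(4)] assms(5)]
    triD(2)[OF assms(1)] triD(2)[OF assms(2)] that by (auto simp: arr_def)

text \<open>The pair (identity, \<open>f\<close>) maps the trivial triangle on \<open>X\<close> to
  the given one, so \<open>TR3\<close> factors \<open>g \<star> f\<close> through a zero
  object.\<close>

lemma tri_comp_zero: "tri X Y Z f g h \<Longrightarrow> g \<star> f = zero_mor C X Z"
proof -
  assume t: "tri X Y Z f g h"
  note d = triD[OF t]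
  obtain O' where O': "zero_object C O'" using has_zero by blast
  then have o: "O' \<in> Obj C" "X \<in> Obj C" using d arr_obj by (auto simp: zero_object_def)
  obtain c where "arr c O' Z" "g \<star> f = c \<star> zero_mor C X O'"
    by (rule TR3_arr[OF TR1_id[OF o(2) O'] t ide_arr[OF o(2)] d(1)]) simp_all
  then show ?thesis using o comp_zero_right by simp
qed

lemma tri_comp_zero': "tri X Y Z f g h \<Longrightarrow> h \<star> g = zero_mor C Y (Sho C X)"
  using tri_comp_zero[OF rot] .

text \<open>\<open>TR3\<close> is applied to the rotated trivial triangle \<open>W\<close>,
  \<open>0\<close>, \<open>W[1]\<close> and the rotated given one. It produces a map
  \<open>W[1]\<close> to \<open>X[1]\<close>, which descends to the lift because the shift is full;
  the two rotation signs cancel.\<close>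

lemma exact_Y:
  assumes t: "tri X Y Z f g h" and a: "arr a W Y" and z: "g \<star> a = zero_mor C W Z"
  shows "\<exists>b. arr b W X \<and> f \<star> b = a"
proof -
  note d = triD[OF t]
  obtain O' where O': "zero_object C O'" using has_zero by blast
  have o: "O' \<in> Obj C" "W \<in> Obj C" "X \<in> Obj C" "Z \<in> Obj C" "Y \<in> Obj C"
    using d a O' by (auto simp: zero_object_def arr_def)
  have t0: "tri W O' (Sho C W) (zero_mor C W O') (zero_mor C O' (Sho C W)) (\<ominus>\<^bsub>Hom C (Sho C W) (Sho C W)\<^esub> Shm C (Ide C W))"
    using rot[OF TR1_id[OF o(2) O']] .
  obtain c where c: "arr c (Sho C W) (Sho C X)"
    "(\<ominus>\<^bsub>Hom C (Sho C X) (Sho C Y)\<^esub> Shm C f) \<star> c = Shm C a \<star> (\<ominus>\<^bsub>Hom C (Sho C W) (Sho C W)\<^esub> Shm C (Ide C W))"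
  proof (rule TR3_arr[OF t0 rot[OF t] a zero_arr[OF o(1,4)]])
    show "g \<star> a = zero_mor C O' Z \<star> zero_mor C W O'"
      using z o comp_zero_right[OF zero_arr[OF o(1,4)] o(2)] by simp
  qed auto
  have "(\<ominus>\<^bsub>Hom C (Sho C X) (Sho C Y)\<^esub> Shm C f) \<star> c = \<ominus>\<^bsub>Hom C (Sho C W) (Sho C Y)\<^esub> (Shm C f \<star> c)"
    using comp_neg_left[OF Shm_arr[OF d(1)] c(1)] .
  moreover have "Shm C a \<star> (\<ominus>\<^bsub>Hom C (Sho C W) (Sho C W)\<^esub> Shm C (Ide C W)) = \<ominus>\<^bsub>Hom C (Sho C W) (Sho C Y)\<^esub> Shm C a"
    using comp_neg_right[OF Shm_arr[OF a] ide_arr[OF Sho_obj[OF o(2)]]] Shm_ide[OF o(2)] arr_id_right[OF Shm_arr[OF a]] by simp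
  ultimately have "Shm C f \<star> c = Shm C a"
    using c(2) neg_neg[OF comp_arr[OF c(1) Shm_arr[OF d(1)]]] neg_neg[OF Shm_arr[OF a]] by metis
  moreover obtain b where b: "arr b W X" "Shm C b = c" using Shm_full[OF c(1) o(2,3)] by blast
  ultimately have "Shm C (f \<star> b) = Shm C a" using Shm_comp[OF b(1) d(1)] by simp
  then have "f \<star> b = a" using Shm_inj comp_arr[OF b(1) d(1)] a by blast
  then show ?thesis using b by blast
qed

lemma exact_Z:
  assumes t: "tri X Y Z f g h" and a: "arr a W Z" and z: "h \<star> a = zero_mor C W (Sho C X)"
  shows "\<exists>b. arr b W Y \<and> g \<star> b = a"
  using exact_Y[OF rot[OF t] a z] .

lemma exact_SX:
  assumes t: "tri X Y Z f g h" and a: "arr a W (Sho C X)" and z: "Shm C f \<star> a = zero_mor C W (Sho C Y)"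
  shows "\<exists>b. arr b W Z \<and> h \<star> b = a"
proof (rule exact_Y[OF rot[OF rot[OF t]] a])
  have W: "W \<in> Obj C" using a arr_obj by blast
  note d = triD[OF t]
  have "(\<ominus>\<^bsub>Hom C (Sho C X) (Sho C Y)\<^esub> Shm C f) \<star> a = (\<ominus>\<^bsub>Hom C W (Sho C Y)\<^esub> (Shm C f \<star> a))"
    using comp_neg_left[OF Shm_arr[OF d(1)] a] .
  also have "\<dots> = zero_mor C W (Sho C Y)"
    using z neg_zero[OF W Sho_obj[OF arr_obj(2)[OF d(1)]]] by simp
  finally show "(\<ominus>\<^bsub>Hom C (Sho C X) (Sho C Y)\<^esub> Shm C f) \<star> a = zero_mor C W (Sho C Y)" .
qed

text \<open>Dual comparison, with the triangle \<open>0\<close>, \<open>W\<close>, \<open>W\<close>,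
  \<open>0[1]\<close> as target. That triangle is obtained by rotating the trivial one backwards,
  which uses that \<open>Sho C O'\<close> is again a zero object.\<close>

lemma coexact_Y:
  assumes t: "tri X Y Z f g h" and a: "arr a Y W" and z: "a \<star> f = zero_mor C X W"
  shows "\<exists>b. arr b Z W \<and> b \<star> g = a"
proof -
  note d = triD[OF t]
  obtain O' where O': "zero_object C O'" using has_zero by blast
  have o: "O' \<in> Obj C" "W \<in> Obj C" "X \<in> Obj C" using d a O' by (auto simp: zero_object_def arr_def)
  have SO: "zero_object C (Sho C O')"
    using O' o(1) Shm_ide[OF o(1)] Shm_zero[OF o(1) o(1)] by (simp add: zero_object_iff Sho_obj)
  have eq: "\<ominus>\<^bsub>Hom C (Sho C O') (Sho C W)\<^esub> Shm C (zero_mor C O' W) = zero_mor C (Sho C O') (Sho C W)"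
    using hom_zeroD[OF zero_object_homs(2)[OF SO Sho_obj[OF o(2)]] neg_arr[OF Shm_arr[OF zero_arr[OF o(1,2)]]]] by simp
  have t0: "tri O' W W (zero_mor C O' W) (Ide C W) (zero_mor C W (Sho C O'))"
    by (rule unrot[OF _ zero_arr[OF o(1,2)]]) (use TR1_id[OF o(2) SO] in \<open>simp only: eq\<close>)
  obtain c where "arr c Z W" "Ide C W \<star> a = c \<star> g"
    by (rule TR3_arr[OF t t0 zero_arr[OF o(3,1)] a])
      (use z comp_zero_right[OF zero_arr[OF o(1,2)] o(3)] in simp_all)
  then show ?thesis using arr_id_left[OF a] by metis
qed

lemma coexact_Z:
  assumes t: "tri X Y Z f g h" and a: "arr a Z W" and z: "a \<star> g = zero_mor C Y W"
  shows "\<exists>b. arr b (Sho C X) W \<and> b \<star> h = a"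
  using coexact_Y[OF rot[OF t] a z] .

text \<open>The composite of \<open>Shm C a\<close> with the connecting map is the obstruction to
  extending \<open>a\<close> along \<open>f\<close>. Exactness in the rotated triangle gives an
  extension up to sign, hence the negated witness.\<close>

lemma coexact_X:
  assumes t: "tri X Y Z f g h" and a: "arr a X W" and z: "Shm C a \<star> h = zero_mor C Z (Sho C W)"
  shows "\<exists>b. arr b Y W \<and> b \<star> f = a"
proof -
  note d = triD[OF t]
  have o: "Y \<in> Obj C" "W \<in> Obj C" using d a arr_obj by blast+
  obtain b0 where b0: "arr b0 (Sho C Y) (Sho C W)" "b0 \<star> (\<ominus>\<^bsub>Hom C (Sho C X) (Sho C Y)\<^esub> Shm C f) = Shm C a"
    using coexact_Z[OF rot[OF t] Shm_arr[OF a] z] by blast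
  obtain b where b: "arr b Y W" "Shm C b = b0" using Shm_full[OF b0(1) o] by blast
  have "Shm C ((\<ominus>\<^bsub>Hom C Y W\<^esub> b) \<star> f) = Shm C a"
    using Shm_comp[OF d(1) neg_arr[OF b(1)]] Shm_neg[OF b(1)] b(2)
      comp_neg_left[OF b0(1) Shm_arr[OF d(1)]] comp_neg_right[OF b0(1) Shm_arr[OF d(1)]] b0(2) by simp
  then show ?thesis using Shm_inj comp_arr[OF d(1) neg_arr[OF b(1)]] a neg_arr[OF b(1)] by blast
qed

lemma tri_Shm_comp_zero: "tri X Y Z f g h \<Longrightarrow> Shm C f \<star> h = zero_mor C Z (Sho C Y)"
proof -
  assume t: "tri X Y Z f g h"
  note d = triD[OF t]
  show ?thesis
    using tri_comp_zero'[OF rot[OF t]] comp_neg_left[OF Shm_arr[OF d(1)] d(3)]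
      neg_eq_zeroD[OF comp_arr[OF d(3) Shm_arr[OF d(1)]]] by simp
qed

section \<open>Fibres, extensions and desuspension of triangles\<close>

text \<open>Rotating backwards requires the third object to be literally of the form
  \<open>Sho C U\<close>. The cone of \<open>f\<close> is only isomorphic to such an object, so the
  triangle is first transported along this isomorphism.\<close>

lemma tri_fibre:
  assumes f: "arr f X Y"
  obtains U u h where "tri U X Y u f h"
proof -
  obtain Z g h where t: "tri X Y Z f g h" using tri_cone[OF f] by blast
  note d = triD[OF t]
  have o: "X \<in> Obj C" "Y \<in> Obj C" "Z \<in> Obj C" using d arr_obj by blast+
  obtain U where U: "U \<in> Obj C" "isomorphic C (Sho C U) Z" using Sho_surj[OF o(3)] by blast
  obtain e e' where e: "arr e Z (Sho C U)" "arr e' (Sho C U) Z" "e' \<star> e = Ide C Z" "e \<star> e' = Ide C (Sho C U)"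
    using isomorphicE[OF U(2) Sho_obj[OF U(1)] o(3)] by metis
  have t2: "tri X Y (Sho C U) f (e \<star> g) (h \<star> e')"
  proof (rule tri_iso[OF t])
    show "candidate_triangle C (X, Y, Sho C U, f, e \<star> g, h \<star> e')"
      using d e by (intro candI comp_arr)
    have "h \<star> e' \<star> e = h" using arr_assoc[OF e(1,2) d(3)] e(3) arr_id_right[OF d(3)] by simp
    then show "triangle_isomorphic C (X, Y, Z, f, g, h) (X, Y, Sho C U, f, e \<star> g, h \<star> e')"
      unfolding triangle_isomorphic_def split_conv
      using is_iso_ide[OF o(1)] is_iso_ide[OF o(2)] is_isoI[OF e] Shm_ide[OF o(1)] arr_id_left[OF d(1)]
        arr_id_right[OF d(1)] arr_id_left[OF d(3)] arr_id_right[OF comp_arr[OF d(2) e(1)]] by metis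
  qed
  obtain u where u: "arr u U X" "Shm C u = h \<star> e'" using Shm_full[OF comp_arr[OF e(2) d(3)] U(1) o(1)] by blast
  have "tri U X Y (\<ominus>\<^bsub>Hom C U X\<^esub> u) f (e \<star> g)"
  proof (rule unrot)
    have "\<ominus>\<^bsub>Hom C (Sho C U) (Sho C X)\<^esub> Shm C (\<ominus>\<^bsub>Hom C U X\<^esub> u) = h \<star> e'"
      using Shm_neg[OF u(1)] u(2) neg_neg[OF Shm_arr[OF u(1)]] by simp
    then show "tri X Y (Sho C U) f (e \<star> g) (\<ominus>\<^bsub>Hom C (Sho C U) (Sho C X)\<^esub> Shm C (\<ominus>\<^bsub>Hom C U X\<^esub> u))"
      using t2 by simp
  qed (rule neg_arr[OF u(1)])
  then show thesis by (rule that)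
qed

text \<open>\<open>Y\<close> is the fibre of \<open>w\<close>; its connecting map out of
  \<open>Sho C A\<close> descends to the map from \<open>A\<close>.\<close>

lemma tri_extension:
  assumes w: "arr w B (Sho C A)" and A: "A \<in> Obj C"
  obtains Y f g where "tri A Y B f g w"
proof -
  obtain Y g k where t: "tri Y B (Sho C A) g w k" by (rule tri_fibre[OF w])
  note d = triD[OF t]
  obtain f where f: "arr f A Y" "Shm C f = k" using Shm_full[OF d(3) A] d(1) arr_obj by blast
  have "tri A Y B (\<ominus>\<^bsub>Hom C A Y\<^esub> f) g w"
  proof (rule unrot)
    have "\<ominus>\<^bsub>Hom C (Sho C A) (Sho C Y)\<^esub> Shm C (\<ominus>\<^bsub>Hom C A Y\<^esub> f) = k"
      using Shm_neg[OF f(1)] f(2) neg_neg[OF Shm_arr[OF f(1)]] by simp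
    then show "tri Y B (Sho C A) g w (\<ominus>\<^bsub>Hom C (Sho C A) (Sho C Y)\<^esub> Shm C (\<ominus>\<^bsub>Hom C A Y\<^esub> f))"
      using t by simp
  qed (rule neg_arr[OF f(1)])
  then show thesis by (rule that)
qed

text \<open>Once the outer terms are replaced by shifts, all three maps descend by fullness. Three
  backward rotations undo the shift and put a sign on each map, so the negated descended maps are
  used.\<close>

lemma tri_unshift:
  assumes t: "tri U (Sho C X) V f g h" and X: "X \<in> Obj C"
  obtains U' V' f' g' h' where "tri U' X V' f' g' h'" "isomorphic C (Sho C U') U" "isomorphic C (Sho C V') V"
proof -
  note d = triD[OF t]
  have o: "U \<in> Obj C" "V \<in> Obj C" "Sho C X \<in> Obj C" using d arr_obj by blast+
  obtain U' where U': "U' \<in> Obj C" "isomorphic C (Sho C U') U" using Sho_surj[OF o(1)] by blast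
  obtain V' where V': "V' \<in> Obj C" "isomorphic C (Sho C V') V" using Sho_surj[OF o(2)] by blast
  obtain a a' where a: "arr a U (Sho C U')" "arr a' (Sho C U') U" "a' \<star> a = Ide C U" "a \<star> a' = Ide C (Sho C U')"
    using isomorphicE[OF U'(2) Sho_obj[OF U'(1)] o(1)] by metis
  obtain c c' where c: "arr c V (Sho C V')" "arr c' (Sho C V') V" "c' \<star> c = Ide C V" "c \<star> c' = Ide C (Sho C V')"
    using isomorphicE[OF V'(2) Sho_obj[OF V'(1)] o(2)] by metis
  let ?h = "Shm C a \<star> (h \<star> c')"
  have fa: "arr (f \<star> a') (Sho C U') (Sho C X)" and gc: "arr (c \<star> g) (Sho C X) (Sho C V')"
    and h: "arr ?h (Sho C V') (Sho C (Sho C U'))"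
    using a c d Shm_arr[OF a(1)] comp_arr by blast+
  have t2: "tri (Sho C U') (Sho C X) (Sho C V') (f \<star> a') (c \<star> g) ?h"
  proof (rule tri_iso[OF t])
    show "candidate_triangle C (Sho C U', Sho C X, Sho C V', f \<star> a', c \<star> g, ?h)"
      using fa gc h by (rule candI)
    have 1: "(f \<star> a') \<star> a = f" using arr_assoc[OF a(1,2) d(1)] a(3) arr_id_right[OF d(1)] by simp
    have 2: "?h \<star> c = Shm C a \<star> h"
      using arr_assoc[OF c(1) comp_arr[OF c(2) d(3)] Shm_arr[OF a(1)]] arr_assoc[OF c(1,2) d(3)]
        c(3) arr_id_right[OF d(3)] by simp
    show "triangle_isomorphic C (U, Sho C X, V, f, g, h) (Sho C U', Sho C X, Sho C V', f \<star> a', c \<star> g, ?h)"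
      unfolding triangle_isomorphic_def split_conv
      using is_isoI[OF a] is_isoI[OF c] is_iso_ide[OF o(3)] 1 2 arr_id_left[OF d(1)] arr_id_right[OF gc] by metis
  qed
  obtain f0 where f0: "arr f0 U' X" "Shm C f0 = f \<star> a'" using Shm_full[OF fa U'(1) X] by blast
  obtain g0 where g0: "arr g0 X V'" "Shm C g0 = c \<star> g" using Shm_full[OF gc X V'(1)] by blast
  obtain h0 where h0: "arr h0 V' (Sho C U')" "Shm C h0 = ?h" using Shm_full[OF h V'(1) Sho_obj[OF U'(1)]] by blast
  note n = neg_arr[OF f0(1)] neg_arr[OF g0(1)] neg_arr[OF h0(1)]
  have e: "\<ominus>\<^bsub>Hom C (Sho C U') (Sho C X)\<^esub> Shm C (\<ominus>\<^bsub>Hom C U' X\<^esub> f0) = f \<star> a'"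
    "\<ominus>\<^bsub>Hom C (Sho C X) (Sho C V')\<^esub> Shm C (\<ominus>\<^bsub>Hom C X V'\<^esub> g0) = c \<star> g"
    "\<ominus>\<^bsub>Hom C (Sho C V') (Sho C (Sho C U'))\<^esub> Shm C (\<ominus>\<^bsub>Hom C V' (Sho C U')\<^esub> h0) = ?h"
    using Shm_neg[OF f0(1)] Shm_neg[OF g0(1)] Shm_neg[OF h0(1)] f0(2) g0(2) h0(2)
      neg_neg[OF fa] neg_neg[OF gc] neg_neg[OF h] by simp_all
  have "tri U' X V' (\<ominus>\<^bsub>Hom C U' X\<^esub> f0) (\<ominus>\<^bsub>Hom C X V'\<^esub> g0) (\<ominus>\<^bsub>Hom C V' (Sho C U')\<^esub> h0)"
    by (rule unrot[OF unrot[OF unrot[OF _ n(3)] n(2)] n(1)]) (simp only: e t2)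
  then show thesis using U' V' that by blast
qed

lemma tri_hom_zero:
  assumes t: "tri X Y Z f g h" and W: "W \<in> Obj C"
  shows "hom_zero C W X \<Longrightarrow> hom_zero C W Z \<Longrightarrow> hom_zero C W Y"
    and "hom_zero C W Y \<Longrightarrow> hom_zero C W (Sho C X) \<Longrightarrow> hom_zero C W Z"
    and "hom_zero C X W \<Longrightarrow> hom_zero C Z W \<Longrightarrow> hom_zero C Y W"
    and "hom_zero C Y W \<Longrightarrow> hom_zero C (Sho C X) W \<Longrightarrow> hom_zero C Z W"
proof -
  have cov: "hom_zero C W X \<Longrightarrow> hom_zero C W Z \<Longrightarrow> hom_zero C W Y"
    if t: "tri X Y Z f g h" for X Y Z f g h
  proof -
    assume h1: "hom_zero C W X" and h2: "hom_zero C W Z"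
    note d = triD[OF t]
    have Y: "Y \<in> Obj C" using d arr_obj by blast
    have "a = zero_mor C W Y" if a: "arr a W Y" for a
    proof -
      have "g \<star> a = zero_mor C W Z" using hom_zeroD[OF h2 comp_arr[OF a d(2)]] .
      then obtain b where "arr b W X" "f \<star> b = a" using exact_Y[OF t a] by blast
      then show ?thesis using hom_zeroD[OF h1] comp_zero_right[OF d(1) W] by metis
    qed
    then show ?thesis using hom_zero_iff W Y by blast
  qed
  have contra: "hom_zero C X W \<Longrightarrow> hom_zero C Z W \<Longrightarrow> hom_zero C Y W"
    if t: "tri X Y Z f g h" for X Y Z f g h
  proof -
    assume h1: "hom_zero C X W" and h2: "hom_zero C Z W"
    note d = triD[OF t]
    have Y: "Y \<in> Obj C" using d arr_obj by blast
    have "a = zero_mor C Y W" if a: "arr a Y W" for a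
    proof -
      have "a \<star> f = zero_mor C X W" using hom_zeroD[OF h1 comp_arr[OF d(1) a]] .
      then obtain b where "arr b Z W" "b \<star> g = a" using coexact_Y[OF t a] by blast
      then show ?thesis using hom_zeroD[OF h2] comp_zero_left[OF d(2) W] by metis
    qed
    then show ?thesis using hom_zero_iff W Y by blast
  qed
  show "hom_zero C W X \<Longrightarrow> hom_zero C W Z \<Longrightarrow> hom_zero C W Y"
    "hom_zero C W Y \<Longrightarrow> hom_zero C W (Sho C X) \<Longrightarrow> hom_zero C W Z"
    "hom_zero C X W \<Longrightarrow> hom_zero C Z W \<Longrightarrow> hom_zero C Y W"
    "hom_zero C Y W \<Longrightarrow> hom_zero C (Sho C X) W \<Longrightarrow> hom_zero C Z W"
    using cov[OF t] cov[OF rot[OF t]] contra[OF t] contra[OF rot[OF t]] by blast+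
qed

lemma tri_fin_dim:
  assumes t: "tri X Y Z f g h" and W: "W \<in> Obj C"
    and fd: "vectorspace.fin_dim K (Hom C W X)" "vectorspace.fin_dim K (Hom C W Z)"
  shows "vectorspace.fin_dim K (Hom C W Y)"
proof (rule fin_dim_exact[OF lin_post[OF triD(1)[OF t] W] lin_post[OF triD(2)[OF t] W] _ fd])
  fix a assume "a \<in> mor C W Y" and z: "g \<star> a = zero_mor C W Z"
  then have "arr a W Y" using W triD(1)[OF t] by (simp add: arr_def)
  then show "a \<in> (\<lambda>b. f \<star> b) ` mor C W X" using exact_Y[OF t _ z] by (auto simp: arr_def)
qed

section \<open>Thick subcategories\<close>

text \<open>A form suited to devissage. A zero object is a retract of any member, so nonemptiness
  suffices; closure under cones follows from closure under extensions by one rotation.\<close>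

lemma thickI:
  assumes "T \<subseteq> Obj C" and ne: "X0 \<in> T"
    and ret: "\<And>X Y. X \<in> T \<Longrightarrow> retract Y X \<Longrightarrow> Y \<in> T"
    and "\<And>X. X \<in> T \<Longrightarrow> Sho C X \<in> T" "\<And>X. X \<in> Obj C \<Longrightarrow> Sho C X \<in> T \<Longrightarrow> X \<in> T"
    and ext: "\<And>X Y Z f g h. tri X Y Z f g h \<Longrightarrow> X \<in> T \<Longrightarrow> Z \<in> T \<Longrightarrow> Y \<in> T"
  shows "thick C T"
  unfolding thick_def
proof (intro conjI)
  obtain O' where "zero_object C O'" using has_zero by blast
  then show "\<exists>Z\<in>T. zero_object C Z" using ret[OF ne] retract_zero_object assms(1) ne by blast
  show "iso_closed C T" unfolding iso_closed_def
    using ret isomorphic_retract isomorphic_sym assms(1) by blast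
  show "\<forall>X Y Z f g h. tri X Y Z f g h \<longrightarrow> X \<in> T \<longrightarrow> Y \<in> T \<longrightarrow> Z \<in> T"
    using ext[OF rot] assms(4) by blast
  show "\<forall>A B X. direct_sum2 C A B X \<longrightarrow> X \<in> T \<longrightarrow> A \<in> T \<and> B \<in> T"
    using ret direct_sum2_retracts by blast
  show "\<forall>X\<in>Obj C. (X \<in> T) = (Sho C X \<in> T)" using assms(4,5) by blast
qed (rule assms(1))

lemma thick_ext: "thick C D \<Longrightarrow> tri X Y Z f g h \<Longrightarrow> X \<in> D \<Longrightarrow> Z \<in> D \<Longrightarrow> Y \<in> D"
proof -
  assume D: "thick C D" and t: "tri X Y Z f g h" and "X \<in> D" "Z \<in> D"
  then have "Sho C X \<in> D" by (auto simp: thick_def)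
  then have "Sho C Y \<in> D" using D rot[OF rot[OF t]] \<open>Z \<in> D\<close> unfolding thick_def by blast
  then show ?thesis using D triD(1)[OF t] unfolding thick_def arr_def by blast
qed

lemma thick_fibre: "thick C D \<Longrightarrow> tri X Y Z f g h \<Longrightarrow> Y \<in> D \<Longrightarrow> Z \<in> D \<Longrightarrow> X \<in> D"
proof -
  assume D: "thick C D" and t: "tri X Y Z f g h" and "Y \<in> D" "Z \<in> D"
  then have "Sho C X \<in> D" using D rot[OF t] unfolding thick_def by blast
  then show ?thesis using D triD(1)[OF t] unfolding thick_def arr_def by blast
qed

section \<open>Shifts by integers\<close>

lemma Sho_pow_obj: "X \<in> Obj C \<Longrightarrow> (Sho C ^^ n) X \<in> Obj C"
  by (induct n) (auto intro: Sho_obj)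

lemma hom_zero_Sho_pow:
  "X \<in> Obj C \<Longrightarrow> Y \<in> Obj C \<Longrightarrow> hom_zero C ((Sho C ^^ n) X) ((Sho C ^^ n) Y) \<longleftrightarrow> hom_zero C X Y"
  by (induct n) (auto simp: hom_zero_Sho Sho_pow_obj)

lemma isomorphic_Sho_pow:
  "X \<in> Obj C \<Longrightarrow> Y \<in> Obj C \<Longrightarrow> isomorphic C ((Sho C ^^ n) X) ((Sho C ^^ n) Y) \<longleftrightarrow> isomorphic C X Y"
  by (induct n) (auto simp: isomorphic_Sho Sho_pow_obj)

lemma Sho_pow_surj: "X \<in> Obj C \<Longrightarrow> \<exists>Y\<in>Obj C. isomorphic C ((Sho C ^^ n) Y) X"
proof (induct n)
  case (Suc n)
  then obtain Y where Y: "Y \<in> Obj C" "isomorphic C ((Sho C ^^ n) Y) X" by blast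
  obtain Z where Z: "Z \<in> Obj C" "isomorphic C (Sho C Z) Y" using Sho_surj Y by blast
  have "isomorphic C ((Sho C ^^ n) (Sho C Z)) ((Sho C ^^ n) Y)"
    using isomorphic_Sho_pow Z Y Sho_obj by blast
  then have "isomorphic C ((Sho C ^^ Suc n) Z) X"
    using isomorphic_trans[OF _ Y(2)] Y Z Suc.prems Sho_pow_obj Sho_obj by (simp add: funpow_swap1)
  then show ?case using Z by blast
qed (auto intro: isomorphic_refl)

lemma shift_neg:
  assumes "X \<in> Obj C" "p \<le> 0"
  shows "shift C X p \<in> Obj C \<and> isomorphic C ((Sho C ^^ nat (- p)) (shift C X p)) X"
proof (cases "p = 0")
  case True
  then show ?thesis using assms by (simp add: shift_def isomorphic_refl)
next
  case False
  then show ?thesis using assms someI_ex[of "\<lambda>Y. Y \<in> Obj C \<and> isomorphic C ((Sho C ^^ nat (- p)) Y) X"]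
      Sho_pow_surj[OF assms(1), of "nat (- p)"] by (auto simp: shift_def)
qed

lemma shift_0: "shift C X 0 = X"
  by (simp add: shift_def)

lemma shift_obj: "X \<in> Obj C \<Longrightarrow> shift C X p \<in> Obj C"
  using shift_neg[of X p] Sho_pow_obj[of X "nat p"] by (cases "p \<le> 0") (auto simp: shift_def)

text \<open>In negative degrees \<open>shift\<close> is an arbitrary choice. After
  \<open>- (p + 1)\<close> further shifts both sides become isomorphic to \<open>X\<close>, and
  iterated shifts reflect isomorphism.\<close>

lemma Sho_shift: "X \<in> Obj C \<Longrightarrow> isomorphic C (Sho C (shift C X p)) (shift C X (p + 1))"
proof (cases "p \<ge> 0")
  case True
  assume "X \<in> Obj C"
  then show ?thesis using True isomorphic_refl[OF Sho_obj[OF shift_obj[of X p]]] by (simp add: shift_def nat_add_distrib)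
next
  case False
  assume X: "X \<in> Obj C"
  define n where "n = nat (- (p + 1))"
  have n: "nat (- p) = Suc n" using False by (simp add: n_def)
  have a: "shift C X p \<in> Obj C" "isomorphic C ((Sho C ^^ n) (Sho C (shift C X p))) X"
    using shift_neg[OF X, of p] False n by (auto simp: funpow_swap1)
  have b: "shift C X (p + 1) \<in> Obj C" "isomorphic C ((Sho C ^^ n) (shift C X (p + 1))) X"
    using shift_neg[OF X, of "p + 1"] False by (auto simp: n_def)
  have "isomorphic C ((Sho C ^^ n) (Sho C (shift C X p))) ((Sho C ^^ n) (shift C X (p + 1)))"
    using isomorphic_trans[OF a(2) isomorphic_sym[OF b(2)]] a b X Sho_obj Sho_pow_obj by blast
  then show ?thesis using isomorphic_Sho_pow a b Sho_obj by blast
qed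

lemma hom_zero_shift:
  assumes X: "X \<in> Obj C" and Y: "Y \<in> Obj C"
  shows "hom_zero C X (shift C Y p) \<longleftrightarrow> hom_zero C (shift C X (- p)) Y"
proof (cases "p \<ge> 0")
  case True
  define n where "n = nat p"
  have s: "shift C Y p = (Sho C ^^ n) Y" using True by (simp add: shift_def n_def)
  have a: "shift C X (- p) \<in> Obj C" "isomorphic C ((Sho C ^^ n) (shift C X (- p))) X"
    using shift_neg[OF X, of "- p"] True by (auto simp: n_def)
  have "hom_zero C (shift C X (- p)) Y \<longleftrightarrow> hom_zero C ((Sho C ^^ n) (shift C X (- p))) ((Sho C ^^ n) Y)"
    using hom_zero_Sho_pow a Y by simp
  also have "\<dots> \<longleftrightarrow> hom_zero C X ((Sho C ^^ n) Y)"
    by (rule hom_zero_iso) (use a X Y Sho_pow_obj isomorphic_refl in auto)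
  finally show ?thesis using s by simp
next
  case False
  define n where "n = nat (- p)"
  have s: "shift C X (- p) = (Sho C ^^ n) X" using False by (simp add: shift_def n_def)
  have a: "shift C Y p \<in> Obj C" "isomorphic C ((Sho C ^^ n) (shift C Y p)) Y"
    using shift_neg[OF Y, of p] False by (auto simp: n_def)
  have "hom_zero C X (shift C Y p) \<longleftrightarrow> hom_zero C ((Sho C ^^ n) X) ((Sho C ^^ n) (shift C Y p))"
    using hom_zero_Sho_pow a X by simp
  also have "\<dots> \<longleftrightarrow> hom_zero C ((Sho C ^^ n) X) Y"
    by (rule hom_zero_iso) (use a X Y Sho_pow_obj isomorphic_refl in auto)
  finally show ?thesis using s by simp
qed

end

section \<open>Cohomology with respect to a silting object\<close>

locale silting_category = triangulated_category K C
  for K :: "'k ring" and C :: "('k, 'o, 'm, 'z) tcat_scheme" (structure) +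
  fixes M :: 'o
  assumes silting: "silting C M"
begin

text \<open>\<open>Hom(N q, X)\<close> is the cohomology \<open>Hom(M, X[q])\<close>. Moving the
  shift to the fixed object means that exactness for a triangle applies in every degree without
  shifting the triangle.\<close>

definition N :: "int \<Rightarrow> 'o" where "N q = shift C M (- q)"

definition LE :: "int \<Rightarrow> 'o set" where
  "LE k = {X \<in> Obj C. \<forall>q>k. hom_zero C (N q) X}"

definition GE :: "int \<Rightarrow> 'o set" where
  "GE k = {X \<in> Obj C. \<forall>q<k. hom_zero C (N q) X}"

definition FD :: "int \<Rightarrow> 'o \<Rightarrow> bool" where
  "FD q X \<longleftrightarrow> X \<in> Obj C \<and> vectorspace.fin_dim K (Hom C (N q) X)"

lemma M_obj: "M \<in> Obj C"
  using silting by (simp add: silting_def)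

lemma N_obj: "N q \<in> Obj C"
  using shift_obj[OF M_obj] by (simp add: N_def)

lemma N_0: "N 0 = M"
  by (simp add: N_def shift_0)

lemma Sho_N: "isomorphic C (Sho C (N (q + 1))) (N q)"
  using Sho_shift[OF M_obj, of "- (q + 1)"] by (simp add: N_def)

lemma hom_zero_N: "X \<in> Obj C \<Longrightarrow> hom_zero C (N q) X \<longleftrightarrow> hom_zero C M (shift C X q)"
  using hom_zero_shift[OF M_obj, of X q] by (simp add: N_def)

lemma hom_zero_N_Sho: "X \<in> Obj C \<Longrightarrow> hom_zero C (N q) (Sho C X) \<longleftrightarrow> hom_zero C (N (q + 1)) X"
proof -
  assume X: "X \<in> Obj C"
  have "hom_zero C (N q) (Sho C X) \<longleftrightarrow> hom_zero C (Sho C (N (q + 1))) (Sho C X)"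
    by (rule hom_zero_iso) (use Sho_N X N_obj Sho_obj isomorphic_sym isomorphic_refl in auto)
  then show ?thesis using hom_zero_Sho[OF N_obj X] by simp
qed

lemma FD_retract: "FD q X \<Longrightarrow> retract Y X \<Longrightarrow> FD q Y"
  using fin_dim_retract_right N_obj retract_obj by (auto simp: FD_def)

lemma FD_Sho: "X \<in> Obj C \<Longrightarrow> FD q (Sho C X) \<longleftrightarrow> FD (q + 1) X"
proof -
  assume X: "X \<in> Obj C"
  have "vectorspace.fin_dim K (Hom C (N q) (Sho C X)) \<longleftrightarrow> vectorspace.fin_dim K (Hom C (Sho C (N (q + 1))) (Sho C X))"
    using fin_dim_retract_left Sho_N N_obj Sho_obj X isomorphic_retract isomorphic_sym by metis
  then show ?thesis using fin_dim_Sho[OF N_obj X] X Sho_obj by (simp add: FD_def)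
qed

lemma LE_obj: "X \<in> LE k \<Longrightarrow> X \<in> Obj C" and GE_obj: "X \<in> GE k \<Longrightarrow> X \<in> Obj C"
  by (auto simp: LE_def GE_def)

lemma LE_mono: "X \<in> LE k \<Longrightarrow> k \<le> l \<Longrightarrow> X \<in> LE l" and GE_mono: "X \<in> GE l \<Longrightarrow> k \<le> l \<Longrightarrow> X \<in> GE k"
  by (auto simp: LE_def GE_def)

lemma LE_retract: "X \<in> LE k \<Longrightarrow> retract Y X \<Longrightarrow> Y \<in> LE k"
  and GE_retract: "X \<in> GE k \<Longrightarrow> retract Y X \<Longrightarrow> Y \<in> GE k"
  using hom_zero_retract_right N_obj retract_obj by (auto simp: LE_def GE_def)

lemma LE_Sho: "X \<in> Obj C \<Longrightarrow> Sho C X \<in> LE k \<longleftrightarrow> X \<in> LE (k + 1)"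
proof -
  assume X: "X \<in> Obj C"
  have "(\<forall>q>k. hom_zero C (N (q + 1)) X) \<longleftrightarrow> (\<forall>q>k+1. hom_zero C (N q) X)"
    by (metis add_less_cancel_right diff_add_cancel)
  then show ?thesis using X by (simp add: LE_def hom_zero_N_Sho Sho_obj)
qed

lemma GE_Sho: "X \<in> Obj C \<Longrightarrow> Sho C X \<in> GE k \<longleftrightarrow> X \<in> GE (k + 1)"
proof -
  assume X: "X \<in> Obj C"
  have "(\<forall>q<k. hom_zero C (N (q + 1)) X) \<longleftrightarrow> (\<forall>q<k+1. hom_zero C (N q) X)"
    by (metis add_less_cancel_right diff_add_cancel)
  then show ?thesis using X by (simp add: GE_def hom_zero_N_Sho Sho_obj)
qed

lemma LE_ext: "tri X Y Z f g h \<Longrightarrow> X \<in> LE k \<Longrightarrow> Z \<in> LE k \<Longrightarrow> Y \<in> LE k"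
  and GE_ext: "tri X Y Z f g h \<Longrightarrow> X \<in> GE k \<Longrightarrow> Z \<in> GE k \<Longrightarrow> Y \<in> GE k"
  using tri_hom_zero(1)[OF _ N_obj] triD(1) by (auto simp: LE_def GE_def arr_def)

text \<open>The cone is an extension of \<open>X[1]\<close> by \<open>Y\<close>, and shifting lowers
  the bound on \<open>X\<close> by one.\<close>

lemma LE_cone: "tri X Y Z f g h \<Longrightarrow> X \<in> LE (k + 1) \<Longrightarrow> Y \<in> LE k \<Longrightarrow> Z \<in> LE k"
  using LE_ext[OF rot, of X Y Z f g h k] LE_Sho LE_obj by blast

lemma le0_eq: "le0 C M = LE 0" and ge0_eq: "ge0 C M = GE 0"
  by (auto simp: le0_def ge0_def LE_def GE_def hom_zero_N)

lemma M_LE: "M \<in> LE 0"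
  using silting M_obj by (simp add: LE_def hom_zero_N silting_def)

lemma silting_induct: "thick C T \<Longrightarrow> M \<in> T \<Longrightarrow> X \<in> Obj C \<Longrightarrow> X \<in> T"
  using silting by (auto simp: silting_def split_generates_def)

lemma Sho_pred:
  assumes "W \<in> Obj C"
  obtains W' where "W' \<in> Obj C" "retract (Sho C W') W" "retract W (Sho C W')"
  using Sho_surj[OF assms] isomorphic_retract isomorphic_sym assms Sho_obj by metis

section \<open>Devissage from the silting object\<close>

lemma LE_bounded: "X \<in> Obj C \<Longrightarrow> \<exists>m. X \<in> LE m"
proof -
  assume X: "X \<in> Obj C"
  have "thick C {X \<in> Obj C. \<exists>m. X \<in> LE m}"
  proof (rule thickI)
    show "M \<in> {X \<in> Obj C. \<exists>m. X \<in> LE m}" using M_obj M_LE by auto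
    show "Y \<in> {X \<in> Obj C. \<exists>m. X \<in> LE m}" if "X \<in> {X \<in> Obj C. \<exists>m. X \<in> LE m}" "retract Y X" for X Y
      using that LE_retract retract_obj by blast
    show "Sho C X \<in> {X \<in> Obj C. \<exists>m. X \<in> LE m}" if X: "X \<in> {X \<in> Obj C. \<exists>m. X \<in> LE m}" for X
    proof -
      obtain m where "X \<in> LE m" using X by blast
      then have "Sho C X \<in> LE (m - 1)" using LE_Sho[of X "m - 1"] X by simp
      then show ?thesis using X Sho_obj by auto
    qed
    show "X \<in> {X \<in> Obj C. \<exists>m. X \<in> LE m}" if "X \<in> Obj C" "Sho C X \<in> {X \<in> Obj C. \<exists>m. X \<in> LE m}" for X
      using that LE_Sho by blast
    show "Y \<in> {X \<in> Obj C. \<exists>m. X \<in> LE m}" if t: "tri X Y Z f g h"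
      and X: "X \<in> {X \<in> Obj C. \<exists>m. X \<in> LE m}" and Z: "Z \<in> {X \<in> Obj C. \<exists>m. X \<in> LE m}" for X Y Z f g h
    proof -
      obtain m n where "X \<in> LE m" "Z \<in> LE n" using X Z by blast
      then have "X \<in> LE (max m n)" "Z \<in> LE (max m n)" by (auto intro: LE_mono)
      then show ?thesis using LE_ext[OF t] LE_obj by blast
    qed
  qed auto
  then show ?thesis using silting_induct[OF _ _ X] M_obj M_LE by blast
qed

text \<open>The bound is uniform in \<open>W\<close>, so a map that factors through arbitrarily
  negative objects must vanish. For \<open>M\<close> the bound is -1, and an extension takes the
  minimum of the two bounds.\<close>

lemma LE_vanish: "X \<in> Obj C \<Longrightarrow> \<exists>k. \<forall>W\<in>LE k. hom_zero C X W"
proof -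
  assume X: "X \<in> Obj C"
  let ?T = "{X \<in> Obj C. \<exists>k. \<forall>W\<in>LE k. hom_zero C X W}"
  have hzM: "hom_zero C M W" if "W \<in> LE (-1)" for W
  proof -
    have "hom_zero C (N 0) W" using that by (simp add: LE_def)
    then show ?thesis by (simp add: N_0)
  qed
  then have M: "M \<in> ?T" using M_obj by blast
  have "thick C ?T"
  proof (rule thickI[OF _ M])
    show "Y \<in> ?T" if "X \<in> ?T" "retract Y X" for X Y
      using that hom_zero_retract_left retract_obj LE_obj by blast
    show "Sho C X \<in> ?T" if X: "X \<in> ?T" for X
    proof -
      obtain k where k: "\<forall>W\<in>LE k. hom_zero C X W" using X by blast
      have "hom_zero C (Sho C X) W" if W: "W \<in> LE (k - 1)" for W
      proof -
        obtain W' where W': "W' \<in> Obj C" "retract (Sho C W') W" "retract W (Sho C W')"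
          using Sho_pred LE_obj W by blast
        then have "W' \<in> LE k" using LE_retract[OF W W'(2)] LE_Sho[of W' "k - 1"] by simp
        then have "hom_zero C (Sho C X) (Sho C W')" using k hom_zero_Sho X W' by blast
        then show ?thesis using hom_zero_retract_right W' X Sho_obj by blast
      qed
      then show ?thesis using X Sho_obj by blast
    qed
    show "X \<in> ?T" if X: "X \<in> Obj C" and SX: "Sho C X \<in> ?T" for X
    proof -
      obtain k where k: "\<forall>W\<in>LE k. hom_zero C (Sho C X) W" using SX by blast
      have "hom_zero C X W" if W: "W \<in> LE (k + 1)" for W
        using k LE_Sho W LE_obj hom_zero_Sho X by blast
      then show ?thesis using X by blast
    qed
    show "Y \<in> ?T" if t: "tri X Y Z f g h" and X: "X \<in> ?T" and Z: "Z \<in> ?T" for X Y Z f g h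
    proof -
      obtain k l where k: "\<forall>W\<in>LE k. hom_zero C X W" "\<forall>W\<in>LE l. hom_zero C Z W" using X Z by blast
      have "hom_zero C Y W" if W: "W \<in> LE (min k l)" for W
        using tri_hom_zero(3)[OF t LE_obj[OF W]] k LE_mono[OF W] by simp
      then show ?thesis using triD(1)[OF t] arr_obj by blast
    qed
  qed auto
  then show ?thesis using silting_induct[OF _ M X] by blast
qed

text \<open>The objects without nonzero maps to any acyclic \<open>W\<close> form a thick
  subcategory containing \<open>M\<close>, hence contain \<open>U\<close>, so the identity of
  \<open>U\<close> is zero. All acyclic \<open>W\<close> are treated together because closure under
  the shift moves \<open>W\<close> as well.\<close>

lemma zero_object_if_all_hom_zero:
  assumes U: "U \<in> Obj C" and z: "\<And>q. hom_zero C (N q) U"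
  shows "zero_object C U"
proof -
  let ?P = "\<lambda>W. W \<in> Obj C \<and> (\<forall>q. hom_zero C (N q) W)"
  let ?T = "{X \<in> Obj C. \<forall>W. ?P W \<longrightarrow> hom_zero C X W}"
  have M: "M \<in> ?T" using M_obj N_0 by auto metis
  have "thick C ?T"
  proof (rule thickI[OF _ M])
    show "Y \<in> ?T" if "X \<in> ?T" "retract Y X" for X Y
      using that hom_zero_retract_left retract_obj by blast
    show "Sho C X \<in> ?T" if X: "X \<in> ?T" for X
    proof -
      have "hom_zero C (Sho C X) W" if W: "?P W" for W
      proof -
        obtain W' where W': "W' \<in> Obj C" "retract (Sho C W') W" "retract W (Sho C W')"
          using Sho_pred W by blast
        then have "hom_zero C (N q) W'" for q
          using hom_zero_N_Sho[of W' "q - 1"] hom_zero_retract_right[OF W'(2), of "N (q - 1)"] W N_obj by simp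
        then have "hom_zero C (Sho C X) (Sho C W')" using hom_zero_Sho X W' by blast
        then show ?thesis using hom_zero_retract_right W' X Sho_obj by blast
      qed
      then show ?thesis using X Sho_obj by blast
    qed
    show "X \<in> ?T" if X: "X \<in> Obj C" and SX: "Sho C X \<in> ?T" for X
    proof -
      have "hom_zero C X W" if W: "?P W" for W
        using W SX hom_zero_N_Sho Sho_obj hom_zero_Sho X by blast
      then show ?thesis using X by blast
    qed
    show "Y \<in> ?T" if t: "tri X Y Z f g h" and X: "X \<in> ?T" and Z: "Z \<in> ?T" for X Y Z f g h
      using tri_hom_zero(3)[OF t] X Z triD(1)[OF t] arr_obj by blast
  qed auto
  then have "hom_zero C U U" using silting_induct[OF _ M U] U z by blast
  then show ?thesis using U zero_object_iff hom_zeroD ide_arr by blast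
qed

section \<open>Finite dimensional top cohomology\<close>

definition fd_factor :: "int \<Rightarrow> 'm \<Rightarrow> 'o \<Rightarrow> 'o \<Rightarrow> bool" where
  "fd_factor p f X W \<longleftrightarrow> (\<exists>V a b. V \<in> LE p \<and> FD p V \<and> arr a X V \<and> arr b V W \<and> f = b \<star> a)"

lemma fd_factorI: "V \<in> LE p \<Longrightarrow> FD p V \<Longrightarrow> arr a X V \<Longrightarrow> arr b V W \<Longrightarrow> f = b \<star> a \<Longrightarrow> fd_factor p f X W"
  by (auto simp: fd_factor_def)

text \<open>The sum factors through the direct sum of the two intermediate objects, by the column
  with entries \<open>a\<close>, \<open>a'\<close> and the row with entries \<open>b\<close>,
  \<open>b'\<close>.\<close>

lemma fd_factor_add:
  assumes "fd_factor p f X W" "fd_factor p g X W"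
  shows "fd_factor p (f \<oplus>\<^bsub>Hom C X W\<^esub> g) X W"
proof -
  obtain V a b where 1: "V \<in> LE p" "FD p V" "arr a X V" "arr b V W" "f = b \<star> a"
    using assms(1) by (auto simp: fd_factor_def)
  obtain V' a' b' where 2: "V' \<in> LE p" "FD p V'" "arr a' X V'" "arr b' V' W" "g = b' \<star> a'"
    using assms(2) by (auto simp: fd_factor_def)
  obtain B where ds: "direct_sum2 C V V' B" using has_sums LE_obj 1 2 by blast
  obtain i1 i2 p1 p2 where s: "arr i1 V B" "arr i2 V' B" "arr p1 B V" "arr p2 B V'"
    "p1 \<star> i1 = Ide C V" "p2 \<star> i2 = Ide C V'" "p2 \<star> i1 = zero_mor C V V'" "p1 \<star> i2 = zero_mor C V' V"
    "\<And>f Z. arr f Z B \<Longrightarrow> p1 \<star> f = zero_mor C Z V \<Longrightarrow> p2 \<star> f = zero_mor C Z V' \<Longrightarrow> f = zero_mor C Z B"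
    by (rule direct_sum2E[OF ds]) blast
  have B: "B \<in> Obj C" using s arr_obj by blast
  have o: "V \<in> Obj C" "V' \<in> Obj C" "X \<in> Obj C" "W \<in> Obj C" using 1 2 arr_obj by blast+
  have LE: "B \<in> LE p"
  proof -
    have "hom_zero C (N q) B" if q: "q > p" for q
    proof -
      have "x = zero_mor C (N q) B" if x: "arr x (N q) B" for x
      proof (rule s(9)[OF x])
        show "p1 \<star> x = zero_mor C (N q) V"
          using hom_zeroD[OF _ comp_arr[OF x s(3)]] 1(1) q by (auto simp: LE_def)
        show "p2 \<star> x = zero_mor C (N q) V'"
          using hom_zeroD[OF _ comp_arr[OF x s(4)]] 2(1) q by (auto simp: LE_def)
      qed
      then show ?thesis using hom_zero_iff N_obj B by blast
    qed
    then show ?thesis using B by (simp add: LE_def)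
  qed
  have FD: "FD p B"
  proof -
    have "vectorspace.fin_dim K (Hom C (N p) B)"
    proof (rule fin_dim_exact[OF lin_post[OF s(1) N_obj] lin_post[OF s(4) N_obj]])
      fix v assume "v \<in> mor C (N p) B" and z: "p2 \<star> v = zero_mor C (N p) V'"
      then have v: "arr v (N p) B" using N_obj B by (simp add: arr_def)
      let ?w = "i1 \<star> (p1 \<star> v)"
      have pv: "arr (p1 \<star> v) (N p) V" using comp_arr[OF v s(3)] .
      have w: "arr ?w (N p) B" using comp_arr[OF pv s(1)] .
      have "v \<ominus>\<^bsub>Hom C (N p) B\<^esub> ?w = zero_mor C (N p) B"
      proof (rule s(9)[OF minus_arr[OF v w]])
        have "p1 \<star> ?w = p1 \<star> v"
          using arr_assoc[OF pv s(1) s(3)] s(5) arr_id_left[OF pv] by simp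
        then show "p1 \<star> (v \<ominus>\<^bsub>Hom C (N p) B\<^esub> ?w) = zero_mor C (N p) V"
          using comp_minus_right[OF s(3) v w] minus_self[OF pv] by simp
        have "p2 \<star> ?w = zero_mor C (N p) V'"
          using arr_assoc[OF pv s(1) s(4)] s(7) comp_zero_left[OF pv o(2)] by simp
        then show "p2 \<star> (v \<ominus>\<^bsub>Hom C (N p) B\<^esub> ?w) = zero_mor C (N p) V'"
          using comp_minus_right[OF s(4) v w] z minus_self[OF zero_arr[OF N_obj o(2)]] by simp
      qed
      then have "v = ?w" using minus_eq_zero[OF v w] by simp
      then show "v \<in> (\<lambda>f. i1 \<star> f) ` mor C (N p) V" using pv by (auto simp: arr_def)
    qed (use 1 2 in \<open>auto simp: FD_def\<close>)
    then show ?thesis using B by (simp add: FD_def)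
  qed
  let ?a = "(i1 \<star> a) \<oplus>\<^bsub>Hom C X B\<^esub> (i2 \<star> a')" and ?b = "(b \<star> p1) \<oplus>\<^bsub>Hom C B W\<^esub> (b' \<star> p2)"
  note ia = comp_arr[OF 1(3) s(1)] comp_arr[OF 2(3) s(2)]
  note bp = comp_arr[OF s(3) 1(4)] comp_arr[OF s(4) 2(4)]
  have a: "arr ?a X B" and b: "arr ?b B W" using add_arr ia bp by auto
  have p1a: "p1 \<star> ?a = a"
    using comp_add_right[OF s(3) ia] arr_assoc[OF 1(3) s(1) s(3)] arr_assoc[OF 2(3) s(2) s(3)] s(5,8)
      arr_id_left[OF 1(3)] comp_zero_left[OF 2(3) o(1)] add_zero[OF 1(3)] by simp
  have p2a: "p2 \<star> ?a = a'"
    using comp_add_right[OF s(4) ia] arr_assoc[OF 1(3) s(1) s(4)] arr_assoc[OF 2(3) s(2) s(4)] s(6,7)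
      arr_id_left[OF 2(3)] comp_zero_left[OF 1(3) o(2)] zero_add[OF 2(3)] by simp
  have "?b \<star> ?a = f \<oplus>\<^bsub>Hom C X W\<^esub> g"
    using comp_add_left[OF bp(1) a bp(2)] arr_assoc[OF a s(3) 1(4)] arr_assoc[OF a s(4) 2(4)] p1a p2a 1(5) 2(5) by simp
  then show ?thesis using fd_factorI[OF LE FD a b] by simp
qed

lemma fd_factor_comp: "fd_factor p f X W \<Longrightarrow> arr s Y X \<Longrightarrow> fd_factor p (f \<star> s) Y W"
proof -
  assume "fd_factor p f X W" and s: "arr s Y X"
  then obtain V a b where V: "V \<in> LE p" "FD p V" "arr a X V" "arr b V W" "f = b \<star> a"
    by (auto simp: fd_factor_def)
  then have "f \<star> s = b \<star> (a \<star> s)" using arr_assoc[OF s V(3,4)] by simp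
  then show ?thesis using V comp_arr[OF s V(3)] by (intro fd_factorI) auto
qed

definition fd_factors :: "'o \<Rightarrow> bool" where
  "fd_factors X \<longleftrightarrow> X \<in> Obj C \<and> (\<forall>p. \<forall>W\<in>LE p. \<forall>f. arr f X W \<longrightarrow> fd_factor p f X W)"

lemma fd_factors_Sho: "fd_factors X \<Longrightarrow> fd_factors (Sho C X)"
proof -
  assume X: "fd_factors X"
  then have Xo: "X \<in> Obj C" by (simp add: fd_factors_def)
  have "fd_factor p f (Sho C X) W" if W: "W \<in> LE p" and f: "arr f (Sho C X) W" for p W f
  proof -
    obtain W' where W': "W' \<in> Obj C" "isomorphic C (Sho C W') W" using Sho_surj LE_obj[OF W] by blast
    obtain e e' where e: "arr e (Sho C W') W" "arr e' W (Sho C W')" "e' \<star> e = Ide C (Sho C W')" "e \<star> e' = Ide C W"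
      using isomorphicE[OF W'(2) Sho_obj[OF W'(1)] LE_obj[OF W]] by metis
    have "retract (Sho C W') W" using e by (auto simp: retract_def)
    then have W'LE: "W' \<in> LE (p + 1)" using LE_retract[OF W] LE_Sho W' by blast
    obtain f' where f': "arr f' X W'" "Shm C f' = e' \<star> f"
      using Shm_full[OF comp_arr[OF f e(2)] Xo W'(1)] by blast
    obtain V a b where V: "V \<in> LE (p + 1)" "FD (p + 1) V" "arr a X V" "arr b V W'" "f' = b \<star> a"
      using X W'LE f' unfolding fd_factors_def fd_factor_def by blast
    note Sa = Shm_arr[OF V(3)] and Sb = Shm_arr[OF V(4)]
    have "Sho C V \<in> LE p" "FD p (Sho C V)" using V LE_Sho FD_Sho LE_obj by blast+
    moreover have "(e \<star> Shm C b) \<star> Shm C a = f"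
      using arr_assoc[OF Sa Sb e(1)] Shm_comp[OF V(3,4)] V(5) f'(2) arr_assoc[OF f e(2,1)] e(4) arr_id_left[OF f] by simp
    ultimately show ?thesis using Sa comp_arr[OF Sb e(1)] by (intro fd_factorI) auto
  qed
  then show ?thesis using Sho_obj[OF Xo] by (simp add: fd_factors_def)
qed

lemma fd_factors_Sho_imp: "fd_factors (Sho C X) \<Longrightarrow> X \<in> Obj C \<Longrightarrow> fd_factors X"
proof -
  assume X: "fd_factors (Sho C X)" and Xo: "X \<in> Obj C"
  have "fd_factor p f X W" if W: "W \<in> LE p" and f: "arr f X W" for p W f
  proof -
    have "Sho C W \<in> LE (p - 1)" using LE_Sho[of W "p - 1"] W LE_obj by simp
    then obtain V a b where V: "V \<in> LE (p - 1)" "FD (p - 1) V" "arr a (Sho C X) V" "arr b V (Sho C W)" "Shm C f = b \<star> a"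
      using X Shm_arr[OF f] unfolding fd_factors_def fd_factor_def by blast
    note Vo = LE_obj[OF V(1)]
    obtain V' where V': "V' \<in> Obj C" "isomorphic C (Sho C V') V" using Sho_surj Vo by blast
    obtain e e' where e: "arr e (Sho C V') V" "arr e' V (Sho C V')" "e' \<star> e = Ide C (Sho C V')" "e \<star> e' = Ide C V"
      using isomorphicE[OF V'(2) Sho_obj[OF V'(1)] Vo] by metis
    have "retract (Sho C V') V" using e by (auto simp: retract_def)
    then have LF: "V' \<in> LE p" "FD p V'"
      using LE_retract[OF V(1)] LE_Sho[OF V'(1), of "p - 1"] FD_retract[OF V(2)] FD_Sho[OF V'(1), of "p - 1"] by auto
    obtain a' where a': "arr a' X V'" "Shm C a' = e' \<star> a"
      using Shm_full[OF comp_arr[OF V(3) e(2)] Xo V'(1)] by blast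
    obtain b' where b': "arr b' V' W" "Shm C b' = b \<star> e"
      using Shm_full[OF comp_arr[OF e(1) V(4)] V'(1) LE_obj[OF W]] by blast
    have "Shm C (b' \<star> a') = (b \<star> e) \<star> (e' \<star> a)" using Shm_comp[OF a'(1) b'(1)] a' b' by simp
    also have "\<dots> = b \<star> ((e \<star> e') \<star> a)"
      using arr_assoc[OF comp_arr[OF V(3) e(2)] e(1) V(4)] arr_assoc[OF V(3) e(2,1)] by simp
    also have "\<dots> = Shm C f" using e(4) arr_id_left[OF V(3)] V(5) by simp
    finally have "b' \<star> a' = f" using Shm_inj comp_arr[OF a'(1) b'(1)] f by blast
    then show ?thesis using fd_factorI[OF LF a'(1) b'(1)] by simp
  qed
  then show ?thesis using Xo by (simp add: fd_factors_def)
qed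

text \<open>
  The map \<open>f : Y \<rightarrow> W\<close> restricted to \<open>X\<close> factors through some \<open>V\<close>, and the induced map from \<open>Z\<close> to the
  cone of \<open>V \<rightarrow> W\<close> factors through some \<open>V'\<close>. On an extension \<open>Y'\<close> of \<open>V'\<close> by \<open>V\<close> this yields a
  factored map \<open>Y \<rightarrow> Y' \<rightarrow> W\<close> that agrees with \<open>f\<close> on \<open>X\<close>; the difference factors through \<open>Z\<close>.
\<close>

lemma fd_factors_ext:
  assumes t: "tri X Y Z x y z" and X: "fd_factors X" and Z: "fd_factors Z"
  shows "fd_factors Y"
proof -
  note d = triD[OF t]
  have o: "X \<in> Obj C" "Y \<in> Obj C" "Z \<in> Obj C" using d arr_obj by blast+
  have "fd_factor p f Y W" if W: "W \<in> LE p" and f: "arr f Y W" for p W f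
  proof -
    obtain V a b where V: "V \<in> LE p" "FD p V" "arr a X V" "arr b V W" "f \<star> x = b \<star> a"
      using X W comp_arr[OF d(1) f] unfolding fd_factors_def fd_factor_def by blast
    obtain F u v where tF: "tri V W F b u v" using tri_cone[OF V(4)] by blast
    note dF = triD[OF tF]
    have FLE: "F \<in> LE p" using LE_cone[OF tF] LE_mono[OF V(1), of "p + 1"] W by simp
    obtain c where c: "arr c Z F" "u \<star> f = c \<star> y" "v \<star> c = Shm C a \<star> z"
      using TR3_arr[OF t tF V(3) f] V(5) by metis
    obtain V' a' b' where V': "V' \<in> LE p" "FD p V'" "arr a' Z V'" "arr b' V' F" "c = b' \<star> a'"
      using Z FLE c(1) unfolding fd_factors_def fd_factor_def by blast
    note vb' = comp_arr[OF V'(4) dF(3)]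
    obtain Y' k l where tY: "tri V Y' V' k l (v \<star> b')"
      using tri_extension[OF vb' LE_obj[OF V(1)]] by blast
    note dY = triD[OF tY]
    have Y'LE: "Y' \<in> LE p" using LE_ext[OF tY V(1) V'(1)] .
    have Y'FD: "FD p Y'"
      using tri_fin_dim[OF tY N_obj] V(2) V'(2) LE_obj[OF Y'LE] by (simp add: FD_def)
    note SV = Shm_arr[OF V(4)]
    \<comment> \<open>The obstruction to extending \<open>b\<close> from \<open>V\<close> to
      \<open>Y'\<close>; it vanishes because \<open>v\<close> is the connecting map of the cone of
      \<open>b\<close>.\<close>
    have "Shm C b \<star> (v \<star> b') = zero_mor C V' (Sho C W)"
      using arr_assoc[OF V'(4) dF(3) SV] tri_Shm_comp_zero[OF tF] comp_zero_left[OF V'(4) arr_obj(2)[OF SV]] by simp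
    then obtain g where g: "arr g Y' W" "g \<star> k = b" using coexact_X[OF tY V(4)] by blast
    note ka = comp_arr[OF V(3) dY(1)] and Sk = Shm_arr[OF dY(1)]
    have "(v \<star> b') \<star> a' = Shm C a \<star> z" using arr_assoc[OF V'(3,4) dF(3)] V'(5) c(3) by simp
    then have "Shm C (k \<star> a) \<star> z = zero_mor C Z (Sho C Y')"
      using Shm_comp[OF V(3) dY(1)] arr_assoc[OF d(3) Shm_arr[OF V(3)] Sk] tri_Shm_comp_zero[OF tY]
        arr_assoc[OF V'(3) dY(3) Sk] comp_zero_left[OF V'(3) arr_obj(2)[OF Sk]] by simp
    then obtain h where h: "arr h Y Y'" "h \<star> x = k \<star> a" using coexact_X[OF t ka] by blast
    note gh = comp_arr[OF h(1) g(1)]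
    have ghx: "(g \<star> h) \<star> x = f \<star> x"
      using arr_assoc[OF d(1) h(1) g(1)] h(2) arr_assoc[OF V(3) dY(1) g(1)] g(2) V(5) by simp
    have "(f \<ominus>\<^bsub>Hom C Y W\<^esub> (g \<star> h)) \<star> x = zero_mor C X W"
      using comp_minus_left[OF f d(1) gh] ghx minus_self[OF comp_arr[OF d(1) f]] by simp
    then obtain e where e: "arr e Z W" "e \<star> y = f \<ominus>\<^bsub>Hom C Y W\<^esub> (g \<star> h)"
      using coexact_Y[OF t minus_arr[OF f gh]] by blast
    have "fd_factor p e Z W" using Z W e(1) by (simp add: fd_factors_def)
    then have "fd_factor p (f \<ominus>\<^bsub>Hom C Y W\<^esub> (g \<star> h)) Y W" using fd_factor_comp d(2) e(2) by metis
    moreover have "fd_factor p (g \<star> h) Y W" using fd_factorI[OF Y'LE Y'FD h(1) g(1)] by simp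
    ultimately show ?thesis using fd_factor_add add_minus_cancel[OF f gh] by metis
  qed
  then show ?thesis using o by (simp add: fd_factors_def)
qed

text \<open>Factoring the identity of \<open>X\<close> makes \<open>X\<close> a retract of an object
  with finite dimensional degree \<open>p\<close>.\<close>

lemma LE_FD:
  assumes fdM: "vectorspace.fin_dim K (Hom C M M)" and X: "X \<in> LE p"
  shows "FD p X"
proof -
  have "fd_factors M"
  proof -
    have "fd_factor p f M W" if W: "W \<in> LE p" and f: "arr f M W" for p W f
    \<comment> \<open>For \<open>p \<ge> 0\<close> the map factors through \<open>M\<close> itself,
      whose degree \<open>p\<close> part is \<open>Hom(M, M)\<close> or zero. For
      \<open>p < 0\<close> the map is zero and factors through a zero object.\<close>
    proof (cases "p \<ge> 0")
      case True
      have "FD p M"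
      proof (cases "p = 0")
        case False
        then have "hom_zero C (N p) M" using M_LE True by (simp add: LE_def)
        then show ?thesis using hom_zero_fin_dim M_obj N_obj by (simp add: FD_def)
      qed (use fdM M_obj N_0 in \<open>simp add: FD_def\<close>)
      then show ?thesis using fd_factorI[OF LE_mono[OF M_LE True] _ ide_arr[OF M_obj] f] arr_id_right[OF f] by simp
    next
      case False
      obtain O' where O': "zero_object C O'" using has_zero by blast
      then have o: "O' \<in> Obj C" by (simp add: zero_object_def)
      have hz: "hom_zero C (N q) O'" for q using zero_object_homs(1)[OF O' N_obj] .
      have "hom_zero C (N 0) W" using W False by (simp add: LE_def)
      then have "hom_zero C M W" by (simp add: N_0)
      then have "f = zero_mor C M W" using hom_zeroD f by blast
      also have "\<dots> = zero_mor C O' W \<star> zero_mor C M O'"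
        using comp_zero_right[OF zero_arr[OF o LE_obj[OF W]] M_obj] by simp
      finally have "f = zero_mor C O' W \<star> zero_mor C M O'" .
      moreover have "O' \<in> LE p" "FD p O'" using o hz hom_zero_fin_dim[OF N_obj o hz] by (auto simp: LE_def FD_def)
      ultimately show ?thesis using fd_factorI zero_arr[OF M_obj o] zero_arr[OF o LE_obj[OF W]] by blast
    qed
    then show ?thesis using M_obj by (simp add: fd_factors_def)
  qed
  then have M: "M \<in> {X. fd_factors X}" by simp
  have "thick C {X. fd_factors X}"
  proof (rule thickI[OF _ M])
    show "Y \<in> {X. fd_factors X}" if X: "X \<in> {X. fd_factors X}" and r: "retract Y X" for X Y
    proof -
      obtain s r where sr: "arr s Y X" "arr r X Y" "r \<star> s = Ide C Y" using r by (auto simp: retract_def)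
      have "fd_factor p f Y W" if W: "W \<in> LE p" and f: "arr f Y W" for p W f
      proof -
        have "fd_factor p (f \<star> r) X W" using X W comp_arr[OF sr(2) f] by (simp add: fd_factors_def)
        then have "fd_factor p ((f \<star> r) \<star> s) Y W" using fd_factor_comp sr(1) by blast
        then show ?thesis using arr_assoc[OF sr(1,2) f] sr(3) arr_id_right[OF f] by simp
      qed
      then show ?thesis using retract_obj(1)[OF r] by (simp add: fd_factors_def)
    qed
    show "Sho C X \<in> {X. fd_factors X}" if "X \<in> {X. fd_factors X}" for X using that fd_factors_Sho by simp
    show "X \<in> {X. fd_factors X}" if "X \<in> Obj C" "Sho C X \<in> {X. fd_factors X}" for X
      using that fd_factors_Sho_imp by simp
    show "Y \<in> {X. fd_factors X}" if "tri X Y Z f g h" "X \<in> {X. fd_factors X}" "Z \<in> {X. fd_factors X}" for X Y Z f g h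
      using that fd_factors_ext by simp
  qed (auto simp: fd_factors_def)
  then have "fd_factors X" using silting_induct[OF _ M LE_obj[OF X]] by blast
  then have "fd_factor p (Ide C X) X X" using X ide_arr[OF LE_obj[OF X]] by (simp add: fd_factors_def)
  then obtain V a b where "FD p V" "arr a X V" "arr b V X" "Ide C X = b \<star> a"
    by (auto simp: fd_factor_def)
  then show ?thesis using FD_retract[of p V X] retract_def by metis
qed

end

section \<open>Idempotents and orthogonality\<close>

context linear_category begin

section \<open>Fitting's lemma for indecomposable objects\<close>

text \<open>Splitting \<open>e\<close> and the complementary idempotent \<open>f\<close> writes
  \<open>X\<close> as a direct sum; the summand that vanishes decides between the two cases.\<close>

lemma idempotent_trivial:
  assumes sc: "split_closed C" and ind: "indecomposable C X" and e: "arr e X X" and ee: "e \<star> e = e"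
  shows "e = zero_mor C X X \<or> e = Ide C X"
proof -
  have X: "X \<in> Obj C" using e arr_obj by blast
  define f where "f = Ide C X \<ominus>\<^bsub>Hom C X X\<^esub> e"
  have f: "arr f X X" using minus_arr[OF ide_arr[OF X] e] by (simp add: f_def)
  have fe: "f \<star> e = zero_mor C X X"
    using comp_minus_left[OF ide_arr[OF X] e e] arr_id_left[OF e] ee minus_self[OF e] by (simp add: f_def)
  have ef: "e \<star> f = zero_mor C X X"
    using comp_minus_right[OF e ide_arr[OF X] e] arr_id_right[OF e] ee minus_self[OF e] by (simp add: f_def)
  have "f \<star> f = f \<star> Ide C X \<ominus>\<^bsub>Hom C X X\<^esub> f \<star> e"
    using comp_minus_right[OF f ide_arr[OF X] e] by (simp add: f_def)
  also have "\<dots> = f \<oplus>\<^bsub>Hom C X X\<^esub> zero_mor C X X"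
    using arr_id_right[OF f] fe neg_zero[OF X X] by (simp add: a_minus_def)
  finally have ff: "f \<star> f = f" using add_zero[OF f] by simp
  obtain Y r s where Y: "arr r X Y" "arr s Y X" "r \<star> s = Ide C Y" "s \<star> r = e"
    using sc X e ee unfolding split_closed_def arr_def by blast
  obtain Y' r' s' where Y': "arr r' X Y'" "arr s' Y' X" "r' \<star> s' = Ide C Y'" "s' \<star> r' = f"
    using sc X f ff unfolding split_closed_def arr_def by blast
  \<comment> \<open>Composing the product of the two idempotents with \<open>q\<close> on the left
    and \<open>t\<close> on the right gives back \<open>q \<star> t\<close>. Orthogonal idempotents
    thus have vanishing off-diagonal entries.\<close>
  have cross: "q \<star> t = zero_mor C A B"
    if q: "arr q X B" "arr q' B X" "q \<star> q' = Ide C B" and t: "arr t A X" "arr t' X A" "t' \<star> t = Ide C A"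
      and z: "(q' \<star> q) \<star> (t \<star> t') = zero_mor C X X" for q q' t t' A B
  proof -
    have oo: "A \<in> Obj C" "B \<in> Obj C" using q t arr_obj by blast+
    note qt = comp_arr[OF t(1) q(1)]
    have 1: "(q' \<star> q) \<star> (t \<star> t') = q' \<star> ((q \<star> t) \<star> t')"
      using arr_assoc[OF comp_arr[OF t(2,1)] q(1,2)] arr_assoc[OF t(2,1) q(1)] by simp
    have "q \<star> t = (q \<star> q') \<star> ((q \<star> t) \<star> (t' \<star> t))"
      using q(3) t(3) arr_id_left[OF qt] arr_id_right[OF qt] by simp
    also have "\<dots> = q \<star> (q' \<star> ((q \<star> t) \<star> t') \<star> t)"
      using arr_assoc[OF t(1,2) qt] arr_assoc[OF comp_arr[OF t(1) comp_arr[OF t(2) qt]] q(2,1)]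
        arr_assoc[OF t(1) comp_arr[OF t(2) qt] q(2)] by simp
    also have "\<dots> = zero_mor C A B"
      using 1 z comp_zero_left[OF t(1) X] comp_zero_right[OF q(1) oo(1)] by simp
    finally show ?thesis .
  qed
  have "direct_sum2 C Y Y' X"
  proof (rule direct_sum2I[OF Y(2) Y'(2) Y(1) Y'(1) Y(3) Y'(3)])
    show "r' \<star> s = zero_mor C Y Y'" using cross[OF Y'(1,2,3) Y(2,1,3)] Y Y' fe by simp
    show "r \<star> s' = zero_mor C Y' Y" using cross[OF Y(1,2,3) Y'(2,1,3)] Y Y' ef by simp
    show "(s \<star> r) \<oplus>\<^bsub>Hom C X X\<^esub> (s' \<star> r') = Ide C X"
      using Y(4) Y'(4) add_minus_cancel[OF ide_arr[OF X] e] by (simp add: f_def)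
  qed
  then have "zero_object C Y \<or> zero_object C Y'" using ind by (auto simp: indecomposable_def)
  then show ?thesis
  proof
    assume "zero_object C Y"
    then have "s = zero_mor C Y X" using hom_zeroD[OF zero_object_homs(2) Y(2)] X by blast
    then show ?thesis using Y(4) comp_zero_left[OF Y(1) X] by simp
  next
    assume "zero_object C Y'"
    then have "s' = zero_mor C Y' X" using hom_zeroD[OF zero_object_homs(2) Y'(2)] X by blast
    then have "f = zero_mor C X X" using Y'(4) comp_zero_left[OF Y'(1) X] by simp
    then show ?thesis using minus_eq_zero[OF ide_arr[OF X] e] by (simp add: f_def)
  qed
qed

text \<open>The right and the left ideals generated by powers of \<open>w\<close> both stabilize, so
  a high power \<open>z\<close> satisfies \<open>z = (z \<star> z) \<star> b\<close> and
  \<open>z = b' \<star> (z \<star> z)\<close>. Then \<open>z \<star> b = b' \<star> z\<close> is an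
  idempotent fixing \<open>z\<close>. If it is zero, so is \<open>z\<close>; if it is the identity,
  \<open>w\<close> has a right inverse.\<close>

lemma endomorphism_nilpotent_or_invertible:
  assumes sc: "split_closed C" and ind: "indecomposable C X"
    and fd: "vectorspace.fin_dim K (Hom C X X)" and w: "arr w X X"
  shows "(\<exists>v. arr v X X \<and> w \<star> v = Ide C X) \<or> (\<exists>n. ((\<lambda>f. w \<star> f) ^^ n) (Ide C X) = zero_mor C X X)"
proof -
  have X: "X \<in> Obj C" using w arr_obj by blast
  note I = ide_arr[OF X]
  define L where "L = (\<lambda>f. w \<star> f)"
  define R where "R = (\<lambda>f. f \<star> w)"
  define pw where "pw k = (L ^^ k) (Ide C X)" for k
  have pw0: "pw 0 = Ide C X" and pwS: "pw (Suc k) = w \<star> pw k" for k by (simp_all add: pw_def L_def)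
  have pw: "arr (pw k) X X" for k by (induct k) (simp_all add: pw0 pwS I comp_arr[OF _ w])
  have Lk: "(L ^^ k) f = pw k \<star> f" if f: "arr f X X" for k f
  proof (induct k)
    case (Suc k)
    then show ?case using arr_assoc[OF f pw w, of k] by (simp add: pwS L_def)
  qed (simp add: pw0 arr_id_left[OF f])
  have pwS': "pw (Suc k) = pw k \<star> w" for k
  proof (induct k)
    case (Suc k)
    then show ?case using arr_assoc[OF w pw w, of k] by (simp add: pwS)
  qed (simp add: pw0 pwS arr_id_left[OF w] arr_id_right[OF w])
  have Rk: "(R ^^ k) f = f \<star> pw k" if f: "arr f X X" for k f
  proof (induct k)
    case (Suc k)
    then show ?case using arr_assoc[OF w pw f, of k] by (simp add: pwS' R_def)
  qed (simp add: pw0 arr_id_right[OF f])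
  have pw_add: "pw (j + k) = pw j \<star> pw k" for j k
  proof (induct j)
    case (Suc j)
    then show ?case using arr_assoc[OF pw pw w, of j k] by (simp add: pwS)
  qed (simp add: pw0 arr_id_left[OF pw])
  have stab: "(T ^^ n) ` V = (T ^^ m) ` V" if "(T ^^ n0) ` V = (T ^^ Suc n0) ` V" "n0 \<le> n" "n0 \<le> m" for T :: "'m \<Rightarrow> 'm" and V n0 n m
  proof -
    have s: "(T ^^ (n0 + k)) ` V = (T ^^ n0) ` V" for k
    proof (induct k)
      case (Suc k)
      have "(T ^^ (n0 + Suc k)) ` V = T ` (T ^^ (n0 + k)) ` V" by (simp add: image_comp comp_def)
      also have "\<dots> = T ` (T ^^ n0) ` V" using Suc by simp
      also have "\<dots> = (T ^^ Suc n0) ` V" by (simp add: image_comp comp_def)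
      finally show ?case using that(1) by simp
    qed simp
    show ?thesis using s[of "n - n0"] s[of "m - n0"] that by simp
  qed
  obtain n1 where n1: "(L ^^ n1) ` mor C X X = (L ^^ Suc n1) ` mor C X X"
    using image_powers_stabilize[OF lin_post[OF w X] fd] unfolding L_def by blast
  obtain n2 where n2: "(R ^^ n2) ` mor C X X = (R ^^ Suc n2) ` mor C X X"
    using image_powers_stabilize[OF lin_pre[OF w X] fd] unfolding R_def by blast
  \<comment> \<open>The maximum puts both chains in their stable range; the successor guarantees a
    factor \<open>w\<close> to split off from \<open>z\<close>.\<close>
  define n where "n = Suc (max n1 n2)"
  define z where "z = pw n"
  have z: "arr z X X" using pw by (simp add: z_def)
  have zz: "pw (n + n) = z \<star> z" by (simp add: z_def pw_add)
  have "z \<in> (L ^^ n) ` mor C X X" using Lk[OF I, of n] arr_id_right[OF z] arr_mor[OF I] by (force simp: z_def)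
  then have "z \<in> (L ^^ (n + n)) ` mor C X X" using stab[OF n1, of n "n + n"] by (simp add: n_def)
  then obtain b where b: "arr b X X" "z = (z \<star> z) \<star> b" using Lk[of _ "n + n"] X zz by (auto simp: arr_def)
  have "z \<in> (R ^^ n) ` mor C X X" using Rk[OF I, of n] arr_id_left[OF z] arr_mor[OF I] by (force simp: z_def)
  then have "z \<in> (R ^^ (n + n)) ` mor C X X" using stab[OF n2, of n "n + n"] by (simp add: n_def)
  then obtain b' where b': "arr b' X X" "z = b' \<star> (z \<star> z)" using Rk[of _ "n + n"] X zz by (auto simp: arr_def)
  define e where "e = z \<star> b"
  have e: "arr e X X" using comp_arr[OF b(1) z] by (simp add: e_def)
  have "b' \<star> z = b' \<star> ((z \<star> z) \<star> b)" using b(2) by simp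
  also have "\<dots> = (b' \<star> (z \<star> z)) \<star> b" using arr_assoc[OF b(1) comp_arr[OF z z] b'(1)] by simp
  also have "\<dots> = e" using b'(2) by (simp add: e_def)
  finally have e': "b' \<star> z = e" .
  have ez: "e \<star> z = z" using e' arr_assoc[OF z z b'(1)] b'(2) by metis
  have ee: "e \<star> e = e" using arr_assoc[OF b(1) z e] ez by (simp add: e_def)
  from idempotent_trivial[OF sc ind e ee] show ?thesis
  proof
    assume "e = zero_mor C X X"
    then have "z = zero_mor C X X" using ez comp_zero_left[OF z X] by simp
    then show ?thesis unfolding z_def pw_def L_def by blast
  next
    assume "e = Ide C X"
    moreover have "z = w \<star> pw (max n1 n2)" by (simp add: z_def n_def pwS)
    ultimately have "w \<star> (pw (max n1 n2) \<star> b) = Ide C X" using arr_assoc[OF b(1) pw w] by (simp add: e_def)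
    then show ?thesis using comp_arr[OF b(1) pw] by blast
  qed
qed

end

locale silting_fd_category = silting_category +
  assumes fin_dim_M: "vectorspace.fin_dim K (Hom C M M)"
begin

section \<open>Killing top cohomology, and orthogonality\<close>

lemma hom_zero_M_GE: "Y \<in> GE 1 \<Longrightarrow> hom_zero C M Y"
proof -
  assume "Y \<in> GE 1"
  then have "hom_zero C (N 0) Y" by (simp add: GE_def)
  then show ?thesis by (simp add: N_0)
qed

lemma LE_minus_1: "X \<in> LE 0 \<Longrightarrow> hom_zero C M X \<Longrightarrow> X \<in> LE (-1)"
proof -
  assume X: "X \<in> LE 0" and z: "hom_zero C M X"
  have "hom_zero C (N q) X" if "q > -1" for q
    using X z N_0 that by (cases "q = 0") (auto simp: LE_def)
  then show ?thesis using X by (simp add: LE_def)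
qed

lemma hom_zero_M_Sho_LE: "P \<in> LE 0 \<Longrightarrow> hom_zero C M (Sho C P)"
proof -
  assume P: "P \<in> LE 0"
  then have "hom_zero C (N 0) (Sho C P)" using hom_zero_N_Sho[of P 0] by (auto simp: LE_def)
  then show ?thesis by (simp add: N_0)
qed

text \<open>\<open>P[1]\<close> receives no map from \<open>M\<close>, so maps from \<open>M\<close>
  or its retracts to the cone lift to \<open>X\<close>. On \<open>Hom(M, -)\<close> the map
  \<open>c\<close> is thus onto, and it kills the nonzero element \<open>x \<star> y\<close>. The
  object \<open>P\<close> will be \<open>M\<close> or one of its summands.\<close>

lemma cone_dim_less:
  assumes X: "X \<in> LE 0" and P: "P \<in> LE 0" and x: "arr x P X"
    and y: "arr y M P" "x \<star> y \<noteq> zero_mor C M X"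
  obtains X1 c h where "tri P X X1 x c h" "X1 \<in> LE 0"
    "\<And>Q a. retract Q M \<Longrightarrow> arr a Q X1 \<Longrightarrow> \<exists>b. arr b Q X \<and> c \<star> b = a"
    "vectorspace.dim K (Hom C M X1) < vectorspace.dim K (Hom C M X)"
proof -
  obtain X1 c h where t: "tri P X X1 x c h" using tri_cone[OF x] by blast
  note d = triD[OF t]
  have X1: "X1 \<in> LE 0" using LE_cone[OF t, of 0] LE_mono[OF P, of 1] X by simp
  have lift: "\<exists>b. arr b Q X \<and> c \<star> b = a" if Q: "retract Q M" and a: "arr a Q X1" for Q a
  proof (rule exact_Z[OF t a])
    have "hom_zero C Q (Sho C P)"
      using hom_zero_retract_left[OF Q hom_zero_M_Sho_LE[OF P]] Sho_obj LE_obj[OF P] by blast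
    then show "h \<star> a = zero_mor C Q (Sho C P)" using hom_zeroD comp_arr[OF a d(3)] by blast
  qed
  have MM: "retract M M" using ide_arr[OF M_obj] arr_id_left unfolding retract_def by blast
  have "vectorspace.dim K (Hom C M X1) < vectorspace.dim K (Hom C M X)"
  proof (rule dim_less_if_surj[OF lin_post[OF d(2) M_obj]])
    show "(\<lambda>f. c \<star> f) ` mor C M X = mor C M X1"
    proof
      show "(\<lambda>f. c \<star> f) ` mor C M X \<subseteq> mor C M X1"
        using comp_arr[OF _ d(2)] M_obj LE_obj[OF X] by (auto simp: arr_def)
      show "mor C M X1 \<subseteq> (\<lambda>f. c \<star> f) ` mor C M X"
        using lift[OF MM] M_obj LE_obj[OF X1] by (auto simp: arr_def)
    qed
    show "vectorspace.fin_dim K (Hom C M X)"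
      using LE_FD[OF fin_dim_M X] by (simp add: FD_def N_0)
    show "x \<star> y \<in> mor C M X" using arr_mor[OF comp_arr[OF y(1) x]] .
    show "c \<star> (x \<star> y) = zero_mor C M X1"
      using arr_assoc[OF y(1) x d(2)] tri_comp_zero[OF t] comp_zero_left[OF y(1) LE_obj[OF X1]] by simp
  qed (rule y(2))
  then show thesis using that[OF t X1 lift] by blast
qed

text \<open>The factorization is stated for every map that vanishes on all maps from
  \<open>M\<close>, whatever its target. This generality is used for maps into \<open>S i\<close>,
  which lies in \<open>GE 0\<close> but need not lie in \<open>GE 1\<close>. Each cone lowers the
  dimension of \<open>Hom(M, X)\<close>, so the process stops.\<close>

lemma kill_top_cohomology:
  assumes "X \<in> LE 0"
  shows "\<exists>X' c. X' \<in> LE (-1) \<and> arr c X X' \<and>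
    (\<forall>Y f. arr f X Y \<longrightarrow> (\<forall>v. arr v M X \<longrightarrow> f \<star> v = zero_mor C M Y) \<longrightarrow> (\<exists>g. arr g X' Y \<and> g \<star> c = f))"
  using assms
proof (induct "vectorspace.dim K (Hom C M X)" arbitrary: X rule: less_induct)
  case less
  note X = less.prems
  show ?case
  proof (cases "hom_zero C M X")
    case True
    show ?thesis
      using LE_minus_1[OF X True] ide_arr[OF LE_obj[OF X]] arr_id_right by (intro exI[of _ X] exI[of _ "Ide C X"]) blast
  next
    case False
    then obtain x where x: "arr x M X" "x \<noteq> zero_mor C M X" using hom_zero_iff M_obj LE_obj[OF X] by blast
    have "x \<star> Ide C M \<noteq> zero_mor C M X" using x arr_id_right by simp
    then obtain X1 c h where t: "tri M X X1 x c h" and X1: "X1 \<in> LE 0"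
      and lift: "\<And>Q a. retract Q M \<Longrightarrow> arr a Q X1 \<Longrightarrow> \<exists>b. arr b Q X \<and> c \<star> b = a"
      and dim: "vectorspace.dim K (Hom C M X1) < vectorspace.dim K (Hom C M X)"
      using cone_dim_less[OF X M_LE x(1) ide_arr[OF M_obj]] by blast
    note d = triD[OF t]
    have MM: "retract M M" using ide_arr[OF M_obj] arr_id_left unfolding retract_def by blast
    obtain X' c' where X': "X' \<in> LE (-1)" "arr c' X1 X'" and
      fac: "\<And>Y f. arr f X1 Y \<Longrightarrow> (\<And>v. arr v M X1 \<Longrightarrow> f \<star> v = zero_mor C M Y) \<Longrightarrow> \<exists>g. arr g X' Y \<and> g \<star> c' = f"
      using less.hyps[OF dim X1] by blast
    have "\<exists>g. arr g X' Y \<and> g \<star> (c' \<star> c) = f" if f: "arr f X Y" and z: "\<forall>v. arr v M X \<longrightarrow> f \<star> v = zero_mor C M Y" for Y f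
    proof -
      obtain f1 where f1: "arr f1 X1 Y" "f1 \<star> c = f" using coexact_Y[OF t f] z x by blast
      have "f1 \<star> v = zero_mor C M Y" if v: "arr v M X1" for v
      proof -
        obtain v' where "arr v' M X" "c \<star> v' = v" using lift[OF MM v] by blast
        then show ?thesis using arr_assoc[OF _ d(2) f1(1)] f1(2) z by metis
      qed
      then obtain g where g: "arr g X' Y" "g \<star> c' = f1" using fac[OF f1(1)] by blast
      have "g \<star> (c' \<star> c) = f" using arr_assoc[OF d(2) X'(2) g(1)] g(2) f1(2) by simp
      then show ?thesis using g by blast
    qed
    then show ?thesis using X'(1) comp_arr[OF d(2) X'(2)] by blast
  qed
qed

text \<open>Killing the top degree pushes the source into \<open>LE (-1)\<close>. Source and target
  are then desuspended, the induction hypothesis is applied to the desuspended map, and its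
  factorization is shifted back, which gains one degree.\<close>

lemma factor_through_LE:
  assumes "X \<in> LE 0" "Y \<in> GE 1" "arr f X Y"
  shows "\<exists>W a b. W \<in> LE (- int r) \<and> arr a X W \<and> arr b W Y \<and> b \<star> a = f"
  using assms
proof (induct r arbitrary: X Y f)
  case 0
  then show ?case
    by (intro exI[of _ X] exI[of _ "Ide C X"] exI[of _ f]) (simp add: ide_arr LE_obj arr_id_right)
next
  case (Suc r)
  note X = Suc.prems(1) and Y = Suc.prems(2) and f = Suc.prems(3)
  obtain X' c where X': "X' \<in> LE (-1)" and c: "arr c X X'" and
    fac: "\<And>Y f. arr f X Y \<Longrightarrow> (\<And>v. arr v M X \<Longrightarrow> f \<star> v = zero_mor C M Y) \<Longrightarrow> \<exists>g. arr g X' Y \<and> g \<star> c = f"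
    using kill_top_cohomology[OF X] by blast
  have "f \<star> v = zero_mor C M Y" if "arr v M X" for v
    using hom_zeroD[OF hom_zero_M_GE[OF Y]] comp_arr[OF that f] by blast
  then obtain g where g: "arr g X' Y" "g \<star> c = f" using fac[OF f] by blast
  obtain X0 where X0: "X0 \<in> Obj C" "isomorphic C (Sho C X0) X'" using Sho_surj LE_obj[OF X'] by blast
  obtain e e' where e: "arr e (Sho C X0) X'" "arr e' X' (Sho C X0)" "e' \<star> e = Ide C (Sho C X0)" "e \<star> e' = Ide C X'"
    using isomorphicE[OF X0(2) Sho_obj[OF X0(1)] LE_obj[OF X']] by metis
  obtain Y0 where Y0: "Y0 \<in> Obj C" "isomorphic C (Sho C Y0) Y" using Sho_surj GE_obj[OF Y] by blast
  obtain k k' where k: "arr k (Sho C Y0) Y" "arr k' Y (Sho C Y0)" "k' \<star> k = Ide C (Sho C Y0)" "k \<star> k' = Ide C Y"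
    using isomorphicE[OF Y0(2) Sho_obj[OF Y0(1)] GE_obj[OF Y]] by metis
  have "Sho C X0 \<in> LE (-1)" using LE_retract[OF X'] e by (auto simp: retract_def)
  then have X0LE: "X0 \<in> LE 0" using LE_Sho[OF X0(1), of "-1"] by simp
  have "Sho C Y0 \<in> GE 1" using GE_retract[OF Y] k by (auto simp: retract_def)
  \<comment> \<open>Desuspension moves the target up to \<open>GE 2\<close>; it is weakened to
    \<open>GE 1\<close> so that the induction hypothesis applies.\<close>
  then have Y0GE: "Y0 \<in> GE 1" using GE_Sho[OF Y0(1)] GE_mono by fastforce
  note ge = comp_arr[OF e(1) g(1)]
  obtain g0 where g0: "arr g0 X0 Y0" "Shm C g0 = k' \<star> (g \<star> e)"
    using Shm_full[OF comp_arr[OF ge k(2)] X0(1) Y0(1)] by blast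
  obtain W a b where W: "W \<in> LE (- int r)" "arr a X0 W" "arr b W Y0" "b \<star> a = g0"
    using Suc.hyps[OF X0LE Y0GE g0(1)] by blast
  note Sa = Shm_arr[OF W(2)] and Sb = Shm_arr[OF W(3)]
  have SW: "Sho C W \<in> LE (- int (Suc r))" using LE_Sho[OF LE_obj[OF W(1)], of "- int (Suc r)"] W(1) by simp
  note a' = comp_arr[OF c comp_arr[OF e(2) Sa]] and b' = comp_arr[OF Sb k(1)]
  have "(k \<star> Shm C b) \<star> (Shm C a \<star> e') = k \<star> ((Shm C b \<star> Shm C a) \<star> e')"
    using arr_assoc[OF comp_arr[OF e(2) Sa] Sb k(1)] arr_assoc[OF e(2) Sa Sb] by simp
  also have "\<dots> = k \<star> ((k' \<star> (g \<star> e)) \<star> e')" using Shm_comp[OF W(2,3)] W(4) g0(2) by simp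
  also have "\<dots> = (k \<star> k') \<star> ((g \<star> e) \<star> e')"
    using arr_assoc[OF e(2) ge k(2)] arr_assoc[OF comp_arr[OF e(2) ge] k(2,1)] by simp
  also have "\<dots> = g" using k(4) arr_assoc[OF e(2,1) g(1)] e(4) arr_id_right[OF g(1)] arr_id_left[OF g(1)] by simp
  finally have "(k \<star> Shm C b) \<star> ((Shm C a \<star> e') \<star> c) = f"
    using arr_assoc[OF c comp_arr[OF e(2) Sa] b'] g(2) by simp
  then show ?case using SW a' b' by blast
qed

lemma orthogonal: "X \<in> LE 0 \<Longrightarrow> Y \<in> GE 1 \<Longrightarrow> hom_zero C X Y"
proof -
  assume X: "X \<in> LE 0" and Y: "Y \<in> GE 1"
  obtain k where k: "\<forall>W\<in>LE k. hom_zero C X W" using LE_vanish LE_obj[OF X] by blast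
  have "f = zero_mor C X Y" if f: "arr f X Y" for f
  proof -
    \<comment> \<open>The number of iterations is chosen so that \<open>- int (nat (- k))\<close> is
      at most \<open>k\<close>, whatever the sign of \<open>k\<close>.\<close>
    obtain W a b where W: "W \<in> LE (- int (nat (- k)))" "arr a X W" "arr b W Y" "b \<star> a = f"
      using factor_through_LE[OF X Y f] by blast
    have "W \<in> LE k" using LE_mono[OF W(1)] by simp
    then have "a = zero_mor C X W" using k hom_zeroD W(2) by blast
    then show ?thesis using W(4) comp_zero_right[OF W(3) LE_obj[OF X]] by simp
  qed
  then show ?thesis using hom_zero_iff LE_obj[OF X] GE_obj[OF Y] by blast
qed

lemma orthogonal': "X \<in> LE (-1) \<Longrightarrow> Y \<in> GE 0 \<Longrightarrow> hom_zero C X Y"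
proof -
  assume X: "X \<in> LE (-1)" and Y: "Y \<in> GE 0"
  obtain X0 where X0: "X0 \<in> Obj C" "retract (Sho C X0) X" "retract X (Sho C X0)"
    using Sho_pred LE_obj[OF X] by blast
  obtain Y0 where Y0: "Y0 \<in> Obj C" "retract (Sho C Y0) Y" "retract Y (Sho C Y0)"
    using Sho_pred GE_obj[OF Y] by blast
  have "X0 \<in> LE 0" "Y0 \<in> GE 1"
    using LE_retract[OF X X0(2)] LE_Sho[OF X0(1), of "-1"] GE_retract[OF Y Y0(2)] GE_Sho[OF Y0(1), of 0] by auto
  then have "hom_zero C (Sho C X0) (Sho C Y0)" using orthogonal hom_zero_Sho X0 Y0 by blast
  then show ?thesis
    using hom_zero_retract_left[OF X0(3)] hom_zero_retract_right[OF Y0(3)] Sho_obj LE_obj[OF X] Y0(1) by blast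
qed

end

section \<open>Simple objects and truncation\<close>

text \<open>The decomposition of \<open>M\<close> enters through fixed inclusions and projections,
  and through joint detection of zero maps by the inclusions.\<close>

locale silting_simples = silting_fd_category K C M
  for K :: "'k ring" and C :: "('k, 'o, 'm, 'z) tcat_scheme" (structure) and M :: 'o +
  fixes D :: "'o set" and n :: nat and Ms S :: "nat \<Rightarrow> 'o" and inc prj :: "nat \<Rightarrow> 'm"
  assumes split: "split_closed C"
    and D_thick: "thick C D"
    and inc: "i \<in> {1..n} \<Longrightarrow> arr (inc i) (Ms i) M"
    and prj: "i \<in> {1..n} \<Longrightarrow> arr (prj i) M (Ms i)"
    and prj_inc: "i \<in> {1..n} \<Longrightarrow> prj i \<star> inc i = Ide C (Ms i)"
    and prj_inc_zero: "i \<in> {1..n} \<Longrightarrow> j \<in> {1..n} \<Longrightarrow> i \<noteq> j \<Longrightarrow> prj j \<star> inc i = zero_mor C (Ms i) (Ms j)"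
    and zero_if_inc: "arr f M X \<Longrightarrow> (\<And>i. i \<in> {1..n} \<Longrightarrow> f \<star> inc i = zero_mor C (Ms i) X) \<Longrightarrow> f = zero_mor C M X"
    and Ms_indecomposable: "i \<in> {1..n} \<Longrightarrow> indecomposable C (Ms i)"
    and S_generates: "split_generates C (S ` {1..n}) D"
    and hom_Ms_S: "i \<in> {1..n} \<Longrightarrow> lin_isomorphic K (Hom C (Ms i) (S i)) (self_module K)"
    and hom_zero_Ms_S: "i \<in> {1..n} \<Longrightarrow> j \<in> {1..n} \<Longrightarrow> i \<noteq> j \<or> p \<noteq> 0 \<Longrightarrow> hom_zero C (Ms i) (shift C (S j) p)"
begin

lemma D_obj: "X \<in> D \<Longrightarrow> X \<in> Obj C"
  using D_thick by (auto simp: thick_def)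

lemma S_D: "i \<in> {1..n} \<Longrightarrow> S i \<in> D"
  using S_generates by (auto simp: split_generates_def)

lemma D_iso: "X \<in> D \<Longrightarrow> isomorphic C X Y \<Longrightarrow> Y \<in> Obj C \<Longrightarrow> Y \<in> D"
  using D_thick by (auto simp: thick_def iso_closed_def)

lemma D_Sho: "X \<in> Obj C \<Longrightarrow> Sho C X \<in> D \<longleftrightarrow> X \<in> D"
  using D_thick by (auto simp: thick_def)

lemma zero_object_D: "zero_object C Z \<Longrightarrow> Z \<in> D"
proof -
  assume Z: "zero_object C Z"
  obtain O' where O': "O' \<in> D" "zero_object C O'" using D_thick by (auto simp: thick_def)
  have o: "Z \<in> Obj C" "O' \<in> Obj C" using Z D_obj[OF O'(1)] by (auto simp: zero_object_def)
  have "isomorphic C O' Z"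
  proof (rule isomorphicI[OF zero_arr[OF o(2,1)] zero_arr[OF o]])
    show "zero_mor C Z O' \<star> zero_mor C O' Z = Ide C O'"
      using hom_zeroD[OF zero_object_homs(1)[OF O'(2) o(2)] ide_arr[OF o(2)]]
        comp_zero_left[OF zero_arr[OF o(2,1)] o(2)] by simp
    show "zero_mor C O' Z \<star> zero_mor C Z O' = Ide C Z"
      using hom_zeroD[OF zero_object_homs(1)[OF Z o(1)] ide_arr[OF o(1)]]
        comp_zero_left[OF zero_arr[OF o] o(1)] by simp
  qed
  then show ?thesis using D_iso O' o by blast
qed

lemma Ms_retract: "i \<in> {1..n} \<Longrightarrow> retract (Ms i) M"
  using inc prj prj_inc unfolding retract_def by blast

lemma Ms_obj: "i \<in> {1..n} \<Longrightarrow> Ms i \<in> Obj C"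
  using retract_obj(1)[OF Ms_retract] .

lemma hom_zero_M:
  assumes X: "X \<in> Obj C" and z: "\<And>i. i \<in> {1..n} \<Longrightarrow> hom_zero C (Ms i) X"
  shows "hom_zero C M X"
proof -
  have "f = zero_mor C M X" if f: "arr f M X" for f
    by (rule zero_if_inc[OF f]) (use hom_zeroD[OF z] comp_arr[OF inc f] in blast)
  then show ?thesis using hom_zero_iff M_obj X by blast
qed

lemma S_obj: "i \<in> {1..n} \<Longrightarrow> S i \<in> Obj C"
  using S_D D_obj by blast

lemma hom_zero_N_S: "j \<in> {1..n} \<Longrightarrow> q \<noteq> 0 \<Longrightarrow> hom_zero C (N q) (S j)"
  using hom_zero_M[OF shift_obj[OF S_obj]] hom_zero_Ms_S hom_zero_N[OF S_obj] by blast

lemma S_LE: "j \<in> {1..n} \<Longrightarrow> S j \<in> LE 0" and S_GE: "j \<in> {1..n} \<Longrightarrow> S j \<in> GE 0"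
  using hom_zero_N_S S_obj by (auto simp: LE_def GE_def)

lemma hom_zero_Ms_S': "i \<in> {1..n} \<Longrightarrow> j \<in> {1..n} \<Longrightarrow> i \<noteq> j \<Longrightarrow> hom_zero C (Ms i) (S j)"
  using hom_zero_Ms_S[of i j 0] by (simp add: shift_0)

section \<open>Maps from the summands of M to the simples\<close>

text \<open>A basis vector of the line \<open>Hom(M_i, S_i)\<close>, chosen once so that later
  statements can refer to it.\<close>

definition \<sigma> :: "nat \<Rightarrow> 'm" where
  "\<sigma> i = (SOME s. arr s (Ms i) (S i) \<and> s \<noteq> zero_mor C (Ms i) (S i) \<and>
     (\<forall>f. arr f (Ms i) (S i) \<longrightarrow> (\<exists>c\<in>carrier K. f = c \<odot>\<^bsub>Hom C (Ms i) (S i)\<^esub> s)))"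

text \<open>The preimage of 1 under an isomorphism \<open>T\<close> onto the ground field is such a
  vector: the coefficient of \<open>f\<close> is \<open>T f\<close>.\<close>

lemma sigma:
  assumes i: "i \<in> {1..n}"
  shows sigma_arr: "arr (\<sigma> i) (Ms i) (S i)" and sigma_nonzero: "\<sigma> i \<noteq> zero_mor C (Ms i) (S i)"
    and sigma_span: "arr f (Ms i) (S i) \<Longrightarrow> \<exists>c\<in>carrier K. f = c \<odot>\<^bsub>Hom C (Ms i) (S i)\<^esub> \<sigma> i"
proof -
  let ?H = "Hom C (Ms i) (S i)"
  obtain T where T: "linear_map K ?H (self_module K) T" "bij_betw T (mor C (Ms i) (S i)) (carrier (self_module K))"
    using hom_Ms_S[OF i] by (auto simp: lin_isomorphic_def linear_iso_def)
  interpret H: vectorspace K ?H using hom_vectorspace Ms_obj S_obj i by blast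
  interpret T: linear_map K ?H "self_module K" T by fact
  have sm: "carrier (self_module K) = carrier K" "\<zero>\<^bsub>self_module K\<^esub> = \<zero>\<^bsub>K\<^esub>"
    "\<And>c x. c \<odot>\<^bsub>self_module K\<^esub> x = c \<otimes>\<^bsub>K\<^esub> x" by (simp_all add: self_module_def)
  have inj: "inj_on T (carrier ?H)" and im: "T ` carrier ?H = carrier K"
    using T(2) sm by (auto simp: bij_betw_def)
  have "\<one>\<^bsub>K\<^esub> \<in> T ` carrier ?H" unfolding im by simp
  then obtain s where s: "s \<in> carrier ?H" "T s = \<one>\<^bsub>K\<^esub>" by (metis imageE)
  have "s \<noteq> \<zero>\<^bsub>?H\<^esub>"
  proof
    assume "s = \<zero>\<^bsub>?H\<^esub>"
    then have "T s = \<zero>\<^bsub>K\<^esub>" using T.f0_is_0 sm(2) by simp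
    then show False using s(2) by simp
  qed
  moreover have "\<exists>c\<in>carrier K. f = c \<odot>\<^bsub>?H\<^esub> s" if f: "f \<in> carrier ?H" for f
  proof -
    have c: "T f \<in> carrier K" using f im by blast
    have "T (T f \<odot>\<^bsub>?H\<^esub> s) = T f" using T.f_smult[OF c s(1)] s(2) sm(3) c by simp
    then have "T f \<odot>\<^bsub>?H\<^esub> s = f" using inj f H.smult_closed[OF c s(1)] by (meson inj_onD)
    then show ?thesis using c by metis
  qed
  moreover have "arr s (Ms i) (S i)" using s(1) Ms_obj S_obj i by (simp add: arr_def)
  ultimately have "\<exists>s. arr s (Ms i) (S i) \<and> s \<noteq> zero_mor C (Ms i) (S i) \<and>
     (\<forall>f. arr f (Ms i) (S i) \<longrightarrow> (\<exists>c\<in>carrier K. f = c \<odot>\<^bsub>?H\<^esub> s))" by (metis arr_mor)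
  then have *: "arr (\<sigma> i) (Ms i) (S i) \<and> \<sigma> i \<noteq> zero_mor C (Ms i) (S i) \<and>
     (\<forall>f. arr f (Ms i) (S i) \<longrightarrow> (\<exists>c\<in>carrier K. f = c \<odot>\<^bsub>?H\<^esub> \<sigma> i))"
    unfolding \<sigma>_def by (rule someI_ex)
  then show "arr (\<sigma> i) (Ms i) (S i)" "\<sigma> i \<noteq> zero_mor C (Ms i) (S i)"
    "arr f (Ms i) (S i) \<Longrightarrow> \<exists>c\<in>carrier K. f = c \<odot>\<^bsub>?H\<^esub> \<sigma> i" by auto
qed

text \<open>The other summands have no nonzero maps to \<open>S i\<close>, so \<open>g\<close> is
  determined by its restriction to \<open>Ms i\<close>.\<close>

lemma hom_M_S: "i \<in> {1..n} \<Longrightarrow> arr g M (S i) \<Longrightarrow> \<exists>c\<in>carrier K. g = (c \<odot>\<^bsub>Hom C (Ms i) (S i)\<^esub> \<sigma> i) \<star> prj i"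
proof -
  assume i: "i \<in> {1..n}" and g: "arr g M (S i)"
  obtain c where c: "c \<in> carrier K" "g \<star> inc i = c \<odot>\<^bsub>Hom C (Ms i) (S i)\<^esub> \<sigma> i"
    using sigma_span[OF i comp_arr[OF inc[OF i] g]] by blast
  let ?s = "g \<star> inc i"
  note s = comp_arr[OF inc[OF i] g]
  note sp = comp_arr[OF prj[OF i] s]
  have "g \<ominus>\<^bsub>Hom C M (S i)\<^esub> ?s \<star> prj i = zero_mor C M (S i)"
  proof (rule zero_if_inc[OF minus_arr[OF g sp]])
    fix j assume j: "j \<in> {1..n}"
    note gj = comp_arr[OF inc[OF j] g]
    have "(?s \<star> prj i) \<star> inc j = g \<star> inc j"
    proof (cases "i = j")
      case True
      then show ?thesis using arr_assoc[OF inc[OF i] prj[OF i] s] prj_inc[OF i] arr_id_right[OF s] by simp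
    next
      case False
      have "g \<star> inc j = zero_mor C (Ms j) (S i)" using hom_zeroD[OF hom_zero_Ms_S'[OF j i] gj] False by blast
      then show ?thesis
        using arr_assoc[OF inc[OF j] prj[OF i] s] prj_inc_zero[OF j i] False comp_zero_right[OF s Ms_obj[OF j]] by simp
    qed
    then show "(g \<ominus>\<^bsub>Hom C M (S i)\<^esub> ?s \<star> prj i) \<star> inc j = zero_mor C (Ms j) (S i)"
      using comp_minus_left[OF g inc[OF j] sp] minus_self[OF gj] by simp
  qed
  then have "g = ?s \<star> prj i" using minus_eq_zero[OF g sp] by blast
  then show ?thesis using c by metis
qed

text \<open>It is enough to test on summands, and only the component \<open>w\<close> from
  \<open>Ms i\<close> to itself can matter. It is not right invertible, as that would force
  \<open>x = 0\<close>; hence it is nilpotent. Since \<open>Hom(M_i, S_i)\<close> is a line,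
  \<open>\<sigma> i\<close> is an eigenvector for precomposition with \<open>w\<close>, and the
  eigenvalue of a nilpotent operator is zero.\<close>

lemma sigma_kills_radical:
  assumes i: "i \<in> {1..n}" and x: "arr x (Ms i) X" "x \<noteq> zero_mor C (Ms i) X"
    and u: "arr u M (Ms i)" "x \<star> u = zero_mor C M X"
  shows "\<sigma> i \<star> u = zero_mor C M (S i)"
proof (rule zero_if_inc[OF comp_arr[OF u(1) sigma_arr[OF i]]])
  fix k assume k: "k \<in> {1..n}"
  note s = sigma_arr[OF i] and Mi = Ms_obj[OF i] and Si = S_obj[OF i]
  have X: "X \<in> Obj C" using x arr_obj by blast
  let ?w = "u \<star> inc k"
  note w = comp_arr[OF inc[OF k] u(1)]
  have xw: "x \<star> ?w = zero_mor C (Ms k) X"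
    using arr_assoc[OF inc[OF k] u(1) x(1)] u(2) comp_zero_left[OF inc[OF k] X] by simp
  have "\<sigma> i \<star> ?w = zero_mor C (Ms k) (S i)"
  proof (cases "k = i")
    case False
    then show ?thesis using hom_zeroD[OF hom_zero_Ms_S'[OF k i] comp_arr[OF w s]] by blast
  next
    case True
    have w': "arr ?w (Ms i) (Ms i)" using w True by simp
    have fd: "vectorspace.fin_dim K (Hom C (Ms i) (Ms i))"
      using fin_dim_retract_left[OF Ms_retract[OF i] Mi]
        fin_dim_retract_right[OF Ms_retract[OF i] M_obj fin_dim_M] by blast
    from endomorphism_nilpotent_or_invertible[OF split Ms_indecomposable[OF i] fd w']
    show ?thesis
    proof
      assume "\<exists>v. arr v (Ms i) (Ms i) \<and> ?w \<star> v = Ide C (Ms i)"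
      then obtain v where v: "arr v (Ms i) (Ms i)" "?w \<star> v = Ide C (Ms i)" by blast
      have "x = (x \<star> ?w) \<star> v" using arr_assoc[OF v(1) w' x(1)] v(2) arr_id_right[OF x(1)] by simp
      then have "x = zero_mor C (Ms i) X" using xw True comp_zero_left[OF v(1) X] by simp
      then show ?thesis using x(2) by blast
    next
      assume "\<exists>m. ((\<lambda>f. ?w \<star> f) ^^ m) (Ide C (Ms i)) = zero_mor C (Ms i) (Ms i)"
      then obtain m where m: "((\<lambda>f. ?w \<star> f) ^^ m) (Ide C (Ms i)) = zero_mor C (Ms i) (Ms i)" by blast
      define pw where "pw m = ((\<lambda>f. ?w \<star> f) ^^ m) (Ide C (Ms i))" for m
      have pw0: "pw 0 = Ide C (Ms i)" and pwS: "pw (Suc m) = ?w \<star> pw m" for m by (simp_all add: pw_def)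
      have pw: "arr (pw m) (Ms i) (Ms i)" for m
        by (induct m) (simp_all add: pw0 pwS ide_arr[OF Mi] comp_arr[OF _ w'])
      show ?thesis
      proof (rule ccontr)
        assume nz: "\<sigma> i \<star> ?w \<noteq> zero_mor C (Ms k) (S i)"
        interpret H: vectorspace K "Hom C (Ms i) (S i)" using hom_vectorspace Mi Si by blast
        obtain c where c: "c \<in> carrier K" "\<sigma> i \<star> ?w = c \<odot>\<^bsub>Hom C (Ms i) (S i)\<^esub> \<sigma> i"
          using sigma_span[OF i comp_arr[OF w' s]] by blast
        have c0: "c \<noteq> \<zero>\<^bsub>K\<^esub>" using nz c(2) arr_mor[OF s] True by auto
        have "\<sigma> i \<star> pw m \<noteq> zero_mor C (Ms i) (S i)" for m
        proof (induct m)
          case 0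
          then show ?case using sigma_nonzero[OF i] arr_id_right[OF s] by (simp add: pw0)
        next
          case (Suc m)
          note sm = comp_arr[OF pw s, of m]
          have "\<sigma> i \<star> pw (Suc m) = c \<odot>\<^bsub>Hom C (Ms i) (S i)\<^esub> (\<sigma> i \<star> pw m)"
            using arr_assoc[OF pw w' s, of m] c comp_smult_left[OF s pw c(1), of m] by (simp add: pwS)
          moreover have "\<sigma> i \<star> pw m = zero_mor C (Ms i) (S i)"
            if "c \<odot>\<^bsub>Hom C (Ms i) (S i)\<^esub> (\<sigma> i \<star> pw m) = zero_mor C (Ms i) (S i)"
            using H.mult_inverse[OF c(1) arr_mor[OF sm] that c0] c(1) c0
            by (simp add: H.field_Units)
          ultimately show ?case using Suc by auto
        qed
        then show False using m comp_zero_right[OF s Mi] by (metis pw_def)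
      qed
    qed
  qed
  then show "(\<sigma> i \<star> u) \<star> inc k = zero_mor C (Ms k) (S i)" using arr_assoc[OF inc[OF k] u(1) s] by simp
qed

lemma Ms_LE: "i \<in> {1..n} \<Longrightarrow> Ms i \<in> LE 0"
  using LE_retract[OF M_LE Ms_retract] .

text \<open>The obstruction desuspends to \<open>\<sigma> i \<star> h0\<close>, where
  \<open>x\<close> kills \<open>h0\<close>. By \<open>sigma_kills_radical\<close> it vanishes on all
  maps from \<open>M\<close>, so it factors through an object of \<open>LE (-1)\<close>; from there
  every map to \<open>S i\<close> is zero by orthogonality. The assumption on \<open>Y\<close> puts
  the source \<open>Y0\<close> of \<open>h0\<close> into \<open>LE 0\<close>.\<close>

lemma sigma_extends:
  assumes i: "i \<in> {1..n}" and x: "x \<noteq> zero_mor C (Ms i) X"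
    and t: "tri (Ms i) X Y x c h" and Y: "Y \<in> LE (-1)"
  shows "\<exists>f. arr f X (S i) \<and> f \<star> x = \<sigma> i"
proof (rule coexact_X[OF t sigma_arr[OF i]])
  note d = triD[OF t] and s = sigma_arr[OF i]
  have Xo: "X \<in> Obj C" using d arr_obj by blast
  obtain Y0 where Y0: "Y0 \<in> Obj C" "isomorphic C (Sho C Y0) Y" using Sho_surj LE_obj[OF Y] by blast
  obtain e e' where e: "arr e (Sho C Y0) Y" "arr e' Y (Sho C Y0)" "e' \<star> e = Ide C (Sho C Y0)" "e \<star> e' = Ide C Y"
    using isomorphicE[OF Y0(2) Sho_obj[OF Y0(1)] LE_obj[OF Y]] by metis
  have "Sho C Y0 \<in> LE (-1)" using LE_retract[OF Y] e by (auto simp: retract_def)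
  then have Y0LE: "Y0 \<in> LE 0" using LE_Sho[OF Y0(1), of "-1"] by simp
  obtain h0 where h0: "arr h0 Y0 (Ms i)" "Shm C h0 = h \<star> e"
    using Shm_full[OF comp_arr[OF e(1) d(3)] Y0(1) Ms_obj[OF i]] by blast
  have xh0: "x \<star> h0 = zero_mor C Y0 X"
  proof (rule Shm_inj[OF _ comp_arr[OF h0(1) d(1)] zero_arr[OF Y0(1) Xo]])
    show "Shm C (x \<star> h0) = Shm C (zero_mor C Y0 X)"
      using Shm_comp[OF h0(1) d(1)] h0(2) arr_assoc[OF e(1) d(3) Shm_arr[OF d(1)]] tri_Shm_comp_zero[OF t]
        comp_zero_left[OF e(1) Sho_obj[OF Xo]] Shm_zero[OF Y0(1) Xo] by simp
  qed
  obtain Y' k where Y': "Y' \<in> LE (-1)" "arr k Y0 Y'" and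
    fac: "\<And>Z f. arr f Y0 Z \<Longrightarrow> (\<And>v. arr v M Y0 \<Longrightarrow> f \<star> v = zero_mor C M Z) \<Longrightarrow> \<exists>g. arr g Y' Z \<and> g \<star> k = f"
    using kill_top_cohomology[OF Y0LE] by blast
  note sh = comp_arr[OF h0(1) s]
  have "(\<sigma> i \<star> h0) \<star> v = zero_mor C M (S i)" if v: "arr v M Y0" for v
  proof -
    have "x \<star> (h0 \<star> v) = zero_mor C M X"
      using arr_assoc[OF v h0(1) d(1)] xh0 comp_zero_left[OF v Xo] by simp
    then show ?thesis
      using sigma_kills_radical[OF i d(1) x comp_arr[OF v h0(1)]] arr_assoc[OF v h0(1) s] by simp
  qed
  then obtain g where g: "arr g Y' (S i)" "g \<star> k = \<sigma> i \<star> h0" using fac[OF sh] by blast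
  have "g = zero_mor C Y' (S i)" using hom_zeroD[OF orthogonal'[OF Y'(1) S_GE[OF i]] g(1)] .
  then have z: "\<sigma> i \<star> h0 = zero_mor C Y0 (S i)" using g(2) comp_zero_left[OF Y'(2) S_obj[OF i]] by simp
  have "Shm C (\<sigma> i) \<star> h = Shm C (\<sigma> i) \<star> ((h \<star> e) \<star> e')"
    using arr_assoc[OF e(2,1) d(3)] e(4) arr_id_right[OF d(3)] by simp
  also have "\<dots> = Shm C (\<sigma> i \<star> h0) \<star> e'"
    using arr_assoc[OF e(2) comp_arr[OF e(1) d(3)] Shm_arr[OF s]] h0(2) Shm_comp[OF h0(1) s] by simp
  also have "\<dots> = zero_mor C Y (Sho C (S i))"
    using z Shm_zero[OF Y0(1) S_obj[OF i]] comp_zero_left[OF e(2) Sho_obj[OF S_obj[OF i]]] by simp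
  finally show "Shm C (\<sigma> i) \<star> h = zero_mor C Y (Sho C (S i))" .
qed

lemma map_to_simple:
  assumes "X \<in> LE 0" "\<not> hom_zero C M X"
  shows "\<exists>i\<in>{1..n}. \<exists>x f. arr x (Ms i) X \<and> arr f X (S i) \<and> f \<star> x = \<sigma> i"
  using assms
proof (induct "vectorspace.dim K (Hom C M X)" arbitrary: X rule: less_induct)
  case less
  note X = less.prems(1)
  have "\<not> (\<forall>i\<in>{1..n}. hom_zero C (Ms i) X)" using hom_zero_M LE_obj[OF X] less.prems(2) by blast
  then obtain i x where i: "i \<in> {1..n}" and x: "arr x (Ms i) X" "x \<noteq> zero_mor C (Ms i) X"
    using hom_zero_iff Ms_obj LE_obj[OF X] by blast
  have "x \<star> prj i \<noteq> zero_mor C M X"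
  proof
    assume "x \<star> prj i = zero_mor C M X"
    then have "(x \<star> prj i) \<star> inc i = zero_mor C (Ms i) X" using comp_zero_left[OF inc[OF i] LE_obj[OF X]] by simp
    then show False using x arr_assoc[OF inc[OF i] prj[OF i] x(1)] prj_inc[OF i] arr_id_right[OF x(1)] by simp
  qed
  then obtain X1 c h where t: "tri (Ms i) X X1 x c h" and X1: "X1 \<in> LE 0"
    and lift: "\<And>Q a. retract Q M \<Longrightarrow> arr a Q X1 \<Longrightarrow> \<exists>b. arr b Q X \<and> c \<star> b = a"
    and dim: "vectorspace.dim K (Hom C M X1) < vectorspace.dim K (Hom C M X)"
    using cone_dim_less[OF X Ms_LE[OF i] x(1) prj[OF i]] by blast
  note d = triD[OF t]
  show ?case
  proof (cases "hom_zero C M X1")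
    case True
    then show ?thesis using sigma_extends[OF i x(2) t] LE_minus_1[OF X1] x(1) i by blast
  next
    case False
    obtain j x1 f1 where j: "j \<in> {1..n}" "arr x1 (Ms j) X1" "arr f1 X1 (S j)" "f1 \<star> x1 = \<sigma> j"
      using less.hyps[OF dim X1 False] by blast
    \<comment> \<open>A solution for the cone gives one for \<open>X\<close>: the map to the simple
      is composed with \<open>c\<close>, and \<open>x1\<close> lifts along \<open>c\<close> because
      \<open>Ms j\<close> is a retract of \<open>M\<close>.\<close>
    obtain x' where x': "arr x' (Ms j) X" "c \<star> x' = x1" using lift[OF Ms_retract[OF j(1)] j(2)] by blast
    have "(f1 \<star> c) \<star> x' = \<sigma> j" using arr_assoc[OF x'(1) d(2) j(3)] x'(2) j(4) by simp
    then show ?thesis using j(1) x'(1) comp_arr[OF d(2) j(3)] by blast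
  qed
qed

section \<open>Truncation triangles\<close>

text \<open>No upper bound is imposed on \<open>U\<close>: the relation is then transitive, and
  partial truncations can be composed while the bound is tracked separately.\<close>

definition truncated :: "int \<Rightarrow> 'o \<Rightarrow> 'o \<Rightarrow> bool" where
  "truncated k U X \<longleftrightarrow> U \<in> Obj C \<and> (\<exists>V f g h. tri U X V f g h \<and> V \<in> D \<and> V \<in> GE k)"

lemma truncated_refl: "X \<in> Obj C \<Longrightarrow> truncated k X X"
proof -
  assume X: "X \<in> Obj C"
  obtain O' where O': "zero_object C O'" using has_zero by blast
  have "O' \<in> GE k" using O' zero_object_homs(1)[OF O' N_obj] by (auto simp: GE_def zero_object_def)
  then show ?thesis unfolding truncated_def using TR1_id[OF X O'] zero_object_D[OF O'] X by blast
qed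

text \<open>The octahedral axiom presents the cone of the composite as an extension of the two given
  third terms, and both \<open>D\<close> and \<open>GE k\<close> are closed under
  extensions.\<close>

lemma truncated_trans:
  assumes "truncated k U Y" "truncated k Y X"
  shows "truncated k U X"
proof -
  obtain V f g h where V: "tri U Y V f g h" "V \<in> D" "V \<in> GE k" using assms(1) by (auto simp: truncated_def)
  obtain W f' g' h' where W: "tri Y X W f' g' h'" "W \<in> D" "W \<in> GE k" using assms(2) by (auto simp: truncated_def)
  have ff: "arr (f' \<star> f) U X" using triD(1)[OF V(1)] triD(1)[OF W(1)] comp_arr by blast
  obtain Q k' l where Q: "tri U X Q (f' \<star> f) k' l" using tri_cone[OF ff] by blast
  obtain u v where "tri V Q W u v (Shm C g \<star> h')" using TR4[OF V(1) W(1) Q] by blast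
  then have "Q \<in> D" "Q \<in> GE k" using thick_ext[OF D_thick] GE_ext V W by blast+
  then show ?thesis unfolding truncated_def using Q ff arr_obj by blast
qed

lemma truncated_unshift:
  assumes t: "truncated k U (Sho C X)" and U: "U \<in> LE l" and X: "X \<in> Obj C"
  shows "\<exists>U'\<in>LE (l + 1). truncated (k + 1) U' X"
proof -
  obtain V f g h where V: "tri U (Sho C X) V f g h" "V \<in> D" "V \<in> GE k" using t by (auto simp: truncated_def)
  obtain U' V' f' g' h' where t': "tri U' X V' f' g' h'" "isomorphic C (Sho C U') U" "isomorphic C (Sho C V') V"
    using tri_unshift[OF V(1) X] .
  have o: "U' \<in> Obj C" "V' \<in> Obj C" using triD[OF t'(1)] arr_obj by blast+
  have so: "Sho C U' \<in> Obj C" "Sho C V' \<in> Obj C" "V \<in> Obj C" using o Sho_obj D_obj V by auto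
  have "U' \<in> LE (l + 1)" using LE_retract[OF U isomorphic_retract[OF t'(2) so(1) LE_obj[OF U]]] LE_Sho[OF o(1)] by simp
  moreover have "V' \<in> GE (k + 1)" using GE_retract[OF V(3) isomorphic_retract[OF t'(3) so(2,3)]] GE_Sho[OF o(2)] by simp
  moreover have "V' \<in> D" using D_iso[OF V(2) isomorphic_sym[OF t'(3) so(2,3)] so(2)] D_Sho[OF o(2)] by simp
  ultimately show ?thesis unfolding truncated_def using t'(1) o by blast
qed

text \<open>Every map from \<open>M\<close> to \<open>S i\<close> is a multiple of
  \<open>\<sigma> i \<star> prj i\<close>, and \<open>\<sigma> i\<close> factors through
  \<open>f\<close>; hence \<open>f\<close> is onto on degree 0, which forces degree 1 of
  \<open>U\<close> to vanish. Degree 0 of \<open>U\<close> embeds into that of \<open>X\<close>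
  because \<open>S i\<close> has no cohomology in degree -1.\<close>

lemma simple_fibre:
  assumes X: "X \<in> LE 0" and i: "i \<in> {1..n}" and x: "arr x (Ms i) X" and f: "arr f X (S i)" and fx: "f \<star> x = \<sigma> i"
    and t: "tri U X (S i) u f h"
  shows "U \<in> LE 0" and "vectorspace.dim K (Hom C M U) < vectorspace.dim K (Hom C M X)"
proof -
  note d = triD[OF t]
  have Uo: "U \<in> Obj C" using d arr_obj by blast
  have Si: "S i \<in> Obj C" using S_obj[OF i] .
  note s = sigma_arr[OF i]
  have onto: "\<exists>y. arr y M X \<and> f \<star> y = b" if b: "arr b M (S i)" for b
  proof -
    obtain c where c: "c \<in> carrier K" "b = (c \<odot>\<^bsub>Hom C (Ms i) (S i)\<^esub> \<sigma> i) \<star> prj i" using hom_M_S[OF i b] by blast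
    let ?y = "(c \<odot>\<^bsub>Hom C (Ms i) X\<^esub> x) \<star> prj i"
    note cx = smult_arr[OF c(1) x]
    have "f \<star> ?y = (f \<star> (c \<odot>\<^bsub>Hom C (Ms i) X\<^esub> x)) \<star> prj i" using arr_assoc[OF prj[OF i] cx f] by simp
    also have "\<dots> = b" using comp_smult_right[OF f x c(1)] fx c(2) by simp
    finally show ?thesis using comp_arr[OF prj[OF i] cx] by blast
  qed
  \<comment> \<open>The kernel of composition with \<open>u\<close> comes from the connecting map
    \<open>h\<close>, so it is trivial once \<open>h\<close> kills all maps from
    \<open>Sho C Q\<close> to \<open>S i\<close>.\<close>
  have inj: "a = zero_mor C Q U" if Q: "Q \<in> Obj C" and a: "arr a Q U" and ua: "u \<star> a = zero_mor C Q X"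
    and lift: "\<And>b. arr b (Sho C Q) (S i) \<Longrightarrow> h \<star> b = zero_mor C (Sho C Q) (Sho C U)" for Q a
  proof -
    have "Shm C u \<star> Shm C a = zero_mor C (Sho C Q) (Sho C X)"
      using Shm_comp[OF a d(1)] ua Shm_zero[OF Q LE_obj[OF X]] by simp
    then obtain b where "arr b (Sho C Q) (S i)" "h \<star> b = Shm C a" using exact_SX[OF t Shm_arr[OF a]] by blast
    then have "Shm C a = Shm C (zero_mor C Q U)" using lift Shm_zero[OF Q Uo] by metis
    then show ?thesis using Shm_inj a zero_arr[OF Q Uo] by blast
  qed
  have "hom_zero C (N q) U" if q: "q > 0" for q
  proof -
    have "h \<star> b = zero_mor C (Sho C (N q)) (Sho C U)" if b: "arr b (Sho C (N q)) (S i)" for b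
    \<comment> \<open>\<open>Sho C (N q)\<close> stands for degree \<open>q - 1\<close> of
      \<open>S i\<close>. For \<open>q = 1\<close> this is degree 0, where \<open>h\<close> vanishes
      because \<open>f\<close> is onto; for larger \<open>q\<close> there are no nonzero maps at
      all.\<close>
    proof (cases "q = 1")
      case True
      have "isomorphic C (Sho C (N q)) M" using Sho_N[of 0] True by (simp add: N_0)
      then obtain e e' where e: "arr e (Sho C (N q)) M" "arr e' M (Sho C (N q))"
        "e' \<star> e = Ide C (Sho C (N q))" "e \<star> e' = Ide C M"
        using isomorphicE Sho_obj[OF N_obj] M_obj by metis
      obtain y where y: "arr y M X" "f \<star> y = b \<star> e'" using onto[OF comp_arr[OF e(2) b]] by blast
      have "b = (b \<star> e') \<star> e" using arr_assoc[OF e(1,2) b] e(3) arr_id_right[OF b] by simp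
      also have "\<dots> = f \<star> (y \<star> e)" using arr_assoc[OF e(1) y(1) f] y(2) by simp
      finally have "h \<star> b = (h \<star> f) \<star> (y \<star> e)" using arr_assoc[OF comp_arr[OF e(1) y(1)] f d(3)] by simp
      then show ?thesis
        using tri_comp_zero'[OF t] comp_zero_left[OF comp_arr[OF e(1) y(1)] Sho_obj[OF Uo]] by simp
    next
      case False
      have "hom_zero C (Sho C (N q)) (S i)"
        using hom_zero_retract_left[OF isomorphic_retract[OF Sho_N[of "q - 1"]] hom_zero_N_S[OF i] Si]
          Sho_obj N_obj False by simp
      then have "b = zero_mor C (Sho C (N q)) (S i)" using hom_zeroD b by blast
      then show ?thesis using comp_zero_right[OF d(3) Sho_obj[OF N_obj]] by simp
    qed
    moreover have "u \<star> a = zero_mor C (N q) X" if "arr a (N q) U" for a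
      using X q hom_zeroD[OF _ comp_arr[OF that d(1)]] by (auto simp: LE_def)
    ultimately show ?thesis using inj[OF N_obj] hom_zero_iff[OF N_obj Uo] by blast
  qed
  then show "U \<in> LE 0" using Uo by (simp add: LE_def)
  have SM: "hom_zero C (Sho C M) (S i)"
  proof -
    have "isomorphic C (Sho C M) (N (-1))" using Sho_N[of "-1"] by (simp add: N_0)
    then show ?thesis
      using hom_zero_retract_left[OF isomorphic_retract hom_zero_N_S[OF i] Si] Sho_obj[OF M_obj] N_obj by simp
  qed
  show "vectorspace.dim K (Hom C M U) < vectorspace.dim K (Hom C M X)"
  proof (rule fin_dim_if_inj(2)[OF lin_post[OF d(1) M_obj]])
    show "inj_on (\<lambda>a. u \<star> a) (mor C M U)"
    proof (rule inj_onI)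
      fix a a' assume "a \<in> mor C M U" "a' \<in> mor C M U" and eq: "u \<star> a = u \<star> a'"
      then have a: "arr a M U" "arr a' M U" using M_obj Uo by (auto simp: arr_def)
      have "u \<star> (a \<ominus>\<^bsub>Hom C M U\<^esub> a') = zero_mor C M X"
        using comp_minus_right[OF d(1) a] eq minus_self[OF comp_arr[OF a(2) d(1)]] by simp
      moreover have "h \<star> b = zero_mor C (Sho C M) (Sho C U)" if "arr b (Sho C M) (S i)" for b
        using hom_zeroD[OF SM that] comp_zero_right[OF d(3) Sho_obj[OF M_obj]] by simp
      ultimately show "a = a'" using inj[OF M_obj minus_arr[OF a]] minus_eq_zero[OF a] by blast
    qed
    show "vectorspace.fin_dim K (Hom C M X)" using LE_FD[OF fin_dim_M X] by (simp add: FD_def N_0)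
    show "(\<lambda>a. u \<star> a) ` mor C M U \<noteq> mor C M X"
    proof
      \<comment> \<open>The element \<open>x \<star> prj i\<close> is missed: \<open>f\<close> kills
        the image of \<open>u\<close>, but sends this element to
        \<open>\<sigma> i \<star> prj i\<close>, whose restriction to \<open>Ms i\<close> is
        nonzero.\<close>
      assume "(\<lambda>a. u \<star> a) ` mor C M U = mor C M X"
      then obtain a where "a \<in> mor C M U" "x \<star> prj i = u \<star> a" using arr_mor[OF comp_arr[OF prj[OF i] x]] by blast
      then have a: "arr a M U" "x \<star> prj i = u \<star> a" using M_obj Uo by (auto simp: arr_def)
      have "\<sigma> i = (f \<star> (x \<star> prj i)) \<star> inc i"
        using arr_assoc[OF prj[OF i] x f] fx arr_assoc[OF inc[OF i] prj[OF i] s] prj_inc[OF i] arr_id_right[OF s] by simp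
      also have "\<dots> = ((f \<star> u) \<star> a) \<star> inc i" using a(2) arr_assoc[OF a(1) d(1) f] by simp
      also have "\<dots> = zero_mor C (Ms i) (S i)"
        using tri_comp_zero[OF t] comp_zero_left[OF a(1) Si] comp_zero_left[OF inc[OF i] Si] by simp
      finally show False using sigma_nonzero[OF i] by blast
    qed
  qed
qed

lemma truncate_step:
  assumes "X \<in> LE 0"
  shows "\<exists>U\<in>LE (-1). truncated 0 U X"
  using assms
proof (induct "vectorspace.dim K (Hom C M X)" arbitrary: X rule: less_induct)
  case less
  note X = less.prems
  show ?case
  proof (cases "hom_zero C M X")
    case True
    then show ?thesis using LE_minus_1[OF X] truncated_refl[OF LE_obj[OF X]] by blast
  next
    case False
    then obtain i x f where i: "i \<in> {1..n}" and xf: "arr x (Ms i) X" "arr f X (S i)" "f \<star> x = \<sigma> i"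
      using map_to_simple[OF X] by blast
    obtain U u h where t: "tri U X (S i) u f h" using tri_fibre[OF xf(2)] by blast
    note U = simple_fibre[OF X i xf t]
    obtain U' where U': "U' \<in> LE (-1)" "truncated 0 U' U" using less.hyps[OF U(2,1)] by blast
    have "truncated 0 U X" unfolding truncated_def using t S_D[OF i] S_GE[OF i] LE_obj[OF U(1)] by blast
    then show ?thesis using U' truncated_trans by blast
  qed
qed

text \<open>Induction on an upper bound for \<open>X\<close>. The hypothesis for
  \<open>X[1]\<close>, desuspended, leaves an object of \<open>LE 1\<close> with third term in
  \<open>GE 2\<close>; one desuspended use of \<open>truncate_step\<close> then removes degree
  1.\<close>

lemma truncate:
  assumes "X \<in> Obj C"
  shows "\<exists>U\<in>LE 0. truncated 1 U X"
proof -
  have "\<exists>U\<in>LE 0. truncated 1 U X" if "X \<in> LE (int k)" for k X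
    using that
  proof (induct k arbitrary: X)
    case 0
    then show ?case using truncated_refl[OF LE_obj] by auto
  next
    case (Suc k)
    note Xo = LE_obj[OF Suc.prems]
    have "Sho C X \<in> LE (int k)" using LE_Sho[OF Xo, of "int k"] Suc.prems by (simp add: add.commute)
    then obtain U where U: "U \<in> LE 0" "truncated 1 U (Sho C X)" using Suc.hyps by blast
    obtain U1 where U1: "U1 \<in> LE 1" "truncated 2 U1 X" using truncated_unshift[OF U(2,1) Xo] by auto
    \<comment> \<open>The third term is weakened from \<open>GE 2\<close> to \<open>GE 1\<close> so
      that both truncations compose at the same level.\<close>
    then have X1: "truncated 1 U1 X" unfolding truncated_def using GE_mono[of _ 2 1] by fastforce
    have "Sho C U1 \<in> LE 0" using LE_Sho[OF LE_obj[OF U1(1)], of 0] U1(1) by simp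
    then obtain U2 where U2: "U2 \<in> LE (-1)" "truncated 0 U2 (Sho C U1)" using truncate_step by blast
    obtain U3 where "U3 \<in> LE 0" "truncated 1 U3 U1" using truncated_unshift[OF U2(2,1) LE_obj[OF U1(1)]] by auto
    then show ?case using truncated_trans X1 by blast
  qed
  moreover obtain m where "X \<in> LE m" using LE_bounded assms by blast
  then have "X \<in> LE (int (nat m))" using LE_mono by auto
  ultimately show ?thesis by blast
qed

lemma GE_subset_D: "GE 0 \<subseteq> D"
proof
  fix Y assume Y: "Y \<in> GE 0"
  obtain Y0 where Y0: "Y0 \<in> Obj C" "isomorphic C (Sho C Y0) Y" using Sho_surj GE_obj[OF Y] by blast
  have "retract (Sho C Y0) Y" using isomorphic_retract[OF Y0(2) Sho_obj[OF Y0(1)] GE_obj[OF Y]] .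
  then have Y0GE: "Y0 \<in> GE 1" using GE_retract[OF Y] GE_Sho[OF Y0(1), of 0] by simp
  obtain U V f g h where U: "U \<in> LE 0" and t: "tri U Y0 V f g h" and V: "V \<in> D" "V \<in> GE 1"
    using truncate[OF Y0(1)] by (auto simp: truncated_def)
  note Uo = LE_obj[OF U]
  have "hom_zero C (N q) U" for q
  proof (cases "q > 0")
    case True
    then show ?thesis using U by (simp add: LE_def)
  next
    case False
    \<comment> \<open>Degree \<open>q\<close> of \<open>U\<close> sits between degree
      \<open>q - 1\<close> of \<open>V\<close> and degree \<open>q\<close> of \<open>Y0\<close>; for
      \<open>q \<le> 0\<close> both lie below 1.\<close>
    have "hom_zero C (N (q - 1)) V" "hom_zero C (N (q - 1)) (Sho C Y0)"
      using V(2) Y0GE False hom_zero_N_Sho[OF Y0(1), of "q - 1"] by (auto simp: GE_def)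
    then have "hom_zero C (N (q - 1)) (Sho C U)" using tri_hom_zero(2)[OF rot[OF t] N_obj] by blast
    then show ?thesis using hom_zero_N_Sho[OF Uo, of "q - 1"] by simp
  qed
  then have "U \<in> D" using zero_object_if_all_hom_zero[OF Uo] zero_object_D by blast
  then have "Y0 \<in> D" using thick_ext[OF D_thick t] V by blast
  then show "Y \<in> D" using D_Sho[OF Y0(1)] D_iso Y0(2) GE_obj[OF Y] by blast
qed

section \<open>The t-structures on C and on D\<close>

lemma iso_closed_LE: "iso_closed C (LE k)" and iso_closed_GE: "iso_closed C (GE k)"
  unfolding iso_closed_def
  using LE_retract GE_retract isomorphic_retract isomorphic_sym LE_obj GE_obj by blast+

lemma truncation_triangle:
  assumes X: "X \<in> Obj C"
  obtains U V f g h where "U \<in> LE 0" "V \<in> D" "Sho C V \<in> GE 0" "tri U X V f g h"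
proof -
  obtain U V f g h where "U \<in> LE 0" "tri U X V f g h" "V \<in> D" "V \<in> GE 1"
    using truncate[OF X] by (auto simp: truncated_def)
  moreover have "Sho C V \<in> GE 0" using GE_Sho[of V 0] calculation GE_obj by simp
  ultimately show thesis using that by blast
qed

lemma Sho_LE0: "X \<in> LE 0 \<Longrightarrow> Sho C X \<in> LE 0"
  using LE_Sho[of X 0] LE_mono[of X 0 1] LE_obj by simp

lemma Sho_GE0: "Y \<in> Obj C \<Longrightarrow> Sho C Y \<in> GE 0 \<Longrightarrow> Y \<in> GE 1"
  using GE_Sho[of Y 0] by simp

lemma t_structure: "t_structure_on C (Obj C) (LE 0) (GE 0)"
  unfolding t_structure_on_def
proof (intro conjI ballI impI)
  fix X assume "X \<in> Obj C"
  then show "\<exists>U\<in>LE 0. \<exists>V\<in>Obj C. Sho C V \<in> GE 0 \<and> (\<exists>f g h. tri U X V f g h)"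
    using truncation_triangle D_obj by metis
next
  show "Y \<in> GE 0" if "Y \<in> Obj C" "Sho C Y \<in> GE 0" for Y using Sho_GE0[OF that] GE_mono[of Y 1 0] by simp
qed (use LE_obj GE_obj iso_closed_LE iso_closed_GE Sho_LE0 orthogonal Sho_GE0 in auto)

lemma t_structure_D: "t_structure_on C D (D \<inter> LE 0) (D \<inter> GE 0)"
  unfolding t_structure_on_def
proof (intro conjI ballI impI)
  show "iso_closed C (D \<inter> LE 0)" "iso_closed C (D \<inter> GE 0)"
    using iso_closed_LE iso_closed_GE D_iso unfolding iso_closed_def by blast+
  show "Sho C X \<in> D \<inter> LE 0" if "X \<in> D \<inter> LE 0" for X using that Sho_LE0 D_Sho D_obj by blast
  show "Y \<in> D \<inter> GE 0" if "Y \<in> D" "Sho C Y \<in> D \<inter> GE 0" for Y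
    using that Sho_GE0[of Y] GE_mono[of Y 1 0] D_obj by simp
  show "hom_zero C X Y" if "X \<in> D \<inter> LE 0" "Y \<in> D" "Sho C Y \<in> D \<inter> GE 0" for X Y
    using that orthogonal Sho_GE0 D_obj by blast
  fix X assume X: "X \<in> D"
  obtain U V f g h where U: "U \<in> LE 0" "V \<in> D" "Sho C V \<in> GE 0" "tri U X V f g h"
    by (rule truncation_triangle[OF D_obj[OF X]])
  \<comment> \<open>The truncation of an object of \<open>D\<close> stays in \<open>D\<close>,
    because the third term of every truncation triangle was built inside \<open>D\<close>.\<close>
  moreover have "U \<in> D" using thick_fibre[OF D_thick U(4) X U(2)] .
  ultimately show "\<exists>U\<in>D \<inter> LE 0. \<exists>V\<in>D. Sho C V \<in> D \<inter> GE 0 \<and> (\<exists>f g h. tri U X V f g h)"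
    using D_Sho D_obj by blast
qed auto

section \<open>Devissage from the simples: boundedness and finiteness on D\<close>

lemma D_induct: "thick C T \<Longrightarrow> (\<And>i. i \<in> {1..n} \<Longrightarrow> S i \<in> T) \<Longrightarrow> X \<in> D \<Longrightarrow> X \<in> T"
  using S_generates unfolding split_generates_def by blast

lemma GE_bounded: "X \<in> D \<Longrightarrow> \<exists>k. X \<in> GE k"
proof -
  assume X: "X \<in> D"
  let ?T = "{X \<in> Obj C. \<exists>k. X \<in> GE k}"
  obtain O' where O': "zero_object C O'" using has_zero by blast
  have O'T: "O' \<in> ?T" using O' zero_object_homs(1)[OF O' N_obj] by (auto simp: GE_def zero_object_def)
  have "thick C ?T"
  proof (rule thickI[OF _ O'T])
    show "Y \<in> ?T" if "X \<in> ?T" "retract Y X" for X Y using that GE_retract retract_obj by blast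
    show "Sho C X \<in> ?T" if X: "X \<in> ?T" for X
    proof -
      obtain k where "X \<in> GE k" using X by blast
      then have "Sho C X \<in> GE (k - 1)" using GE_Sho[of X "k - 1"] X by simp
      then show ?thesis using X Sho_obj by auto
    qed
    show "X \<in> ?T" if "X \<in> Obj C" "Sho C X \<in> ?T" for X using that GE_Sho by blast
    show "Y \<in> ?T" if t: "tri X Y Z f g h" and X: "X \<in> ?T" and Z: "Z \<in> ?T" for X Y Z f g h
    proof -
      obtain k l where "X \<in> GE k" "Z \<in> GE l" using X Z by blast
      then have "X \<in> GE (min k l)" "Z \<in> GE (min k l)" by (auto intro: GE_mono)
      then show ?thesis using GE_ext[OF t] GE_obj by blast
    qed
  qed auto
  moreover have "S i \<in> ?T" if "i \<in> {1..n}" for i using S_GE S_obj that by blast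
  ultimately show ?thesis using D_induct[of ?T] X by blast
qed

lemma shift_members:
  assumes X: "X \<in> Obj C"
  shows "(shift C X p \<in> LE k \<longleftrightarrow> X \<in> LE (k + p)) \<and> (shift C X p \<in> GE k \<longleftrightarrow> X \<in> GE (k + p)) \<and> (shift C X p \<in> D \<longleftrightarrow> X \<in> D)"
proof -
  have step: "shift C X (p + 1) \<in> LE k \<longleftrightarrow> shift C X p \<in> LE (k + 1)"
    "shift C X (p + 1) \<in> GE k \<longleftrightarrow> shift C X p \<in> GE (k + 1)"
    "shift C X (p + 1) \<in> D \<longleftrightarrow> shift C X p \<in> D" for p k
  proof -
    have o: "shift C X p \<in> Obj C" "Sho C (shift C X p) \<in> Obj C" "shift C X (p + 1) \<in> Obj C"
      using shift_obj[OF X] Sho_obj by auto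
    note i = Sho_shift[OF X, of p] isomorphic_sym[OF Sho_shift[OF X, of p] o(2,3)]
    note r = isomorphic_retract[OF i(1) o(2,3)] isomorphic_retract[OF i(2) o(3,2)]
    show "shift C X (p + 1) \<in> LE k \<longleftrightarrow> shift C X p \<in> LE (k + 1)" using LE_retract r LE_Sho[OF o(1)] by blast
    show "shift C X (p + 1) \<in> GE k \<longleftrightarrow> shift C X p \<in> GE (k + 1)" using GE_retract r GE_Sho[OF o(1)] by blast
    show "shift C X (p + 1) \<in> D \<longleftrightarrow> shift C X p \<in> D" using D_iso i o D_Sho[OF o(1)] by blast
  qed
  show ?thesis
  proof (induct p arbitrary: k rule: int_induct[where k = 0])
    case base
    then show ?case by (simp add: shift_0)
  next
    case (step1 p)
    then show ?case using step(1,2)[of p k] step(3)[of p] by (simp add: add.assoc add.commute[of 1])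
  next
    case (step2 p)
    have eq: "k + (p - 1) = k - 1 + p" by simp
    show ?case using step2(2)[of "k - 1"] step(1,2)[of "p - 1" "k - 1"] step(3)[of "p - 1"] unfolding eq by simp
  qed
qed

lemma bounded_t_structure: "bounded_t_structure_on C D (D \<inter> LE 0) (D \<inter> GE 0)"
  unfolding bounded_t_structure_on_def
proof (intro conjI ballI t_structure_D)
  fix X assume X: "X \<in> D"
  obtain k where "X \<in> LE k" using LE_bounded D_obj[OF X] by blast
  moreover obtain l where "X \<in> GE l" using GE_bounded X by blast
  ultimately show "\<exists>m n. shift C X m \<in> D \<inter> LE 0 \<and> shift C X n \<in> D \<inter> GE 0"
    using shift_members[OF D_obj[OF X], of _ 0] X by auto
qed

lemma FD_S: "i \<in> {1..n} \<Longrightarrow> FD q (S i)"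
  using LE_FD[OF fin_dim_M S_LE] hom_zero_N_S hom_zero_fin_dim[OF N_obj S_obj] S_obj
  by (cases "q = 0") (auto simp: FD_def)

text \<open>All degrees are treated at once to make the class closed under shifts. This works over
  the simples, whose cohomology sits in degree 0, where \<open>LE_FD\<close> bounds it.\<close>

lemma fin_dim_hom_M_D: "X \<in> D \<Longrightarrow> vectorspace.fin_dim K (Hom C M X)"
proof -
  assume X: "X \<in> D"
  let ?T = "{X. \<forall>q. FD q X}"
  obtain O' where O': "zero_object C O'" using has_zero by blast
  then have o: "O' \<in> Obj C" by (simp add: zero_object_def)
  have O'T: "O' \<in> ?T" using hom_zero_fin_dim[OF N_obj o zero_object_homs(1)[OF O' N_obj]] o by (simp add: FD_def)
  have "thick C ?T"
  proof (rule thickI[OF _ O'T])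
    show "?T \<subseteq> Obj C" by (auto simp: FD_def)
    show "Y \<in> ?T" if "X \<in> ?T" "retract Y X" for X Y using that FD_retract by blast
    show "Sho C X \<in> ?T" if "X \<in> ?T" for X using that FD_Sho by (auto simp: FD_def)
    show "X \<in> ?T" if "X \<in> Obj C" "Sho C X \<in> ?T" for X
    proof -
      have "FD q X" for q using that FD_Sho[OF that(1), of "q - 1"] by simp
      then show ?thesis by simp
    qed
    show "Y \<in> ?T" if t: "tri X Y Z f g h" and "X \<in> ?T" "Z \<in> ?T" for X Y Z f g h
      using tri_fin_dim[OF t N_obj] that arr_obj[OF triD(1)[OF t]] by (simp add: FD_def)
  qed
  then have "X \<in> ?T" using D_induct[of ?T] FD_S X by blast
  then have "FD 0 X" by blast
  then show ?thesis by (simp add: FD_def N_0)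
qed

lemma ST_triple: "ST_triple K C D M"
  unfolding ST_triple_def le0_eq ge0_eq
  using triangulated_category_axioms split M_obj D_thick silting fin_dim_hom_M_D t_structure GE_subset_D
    bounded_t_structure by blast

end

theorem lemma1p1:
  fixes K :: "'k ring"
    and C :: "('k, 'o, 'm) tcat"
    and E :: "('k, 'p, 'a) ecat"
    and D :: "'o set"
    and M :: 'o
    and n :: nat
    and Ms S :: "nat \<Rightarrow> 'o"
  assumes "algebraically_closed K" and "char_zero K"
    and "triangulated_category K C" and "split_closed C" and "algebraic_model K C E"
    and "thick C D"
    and "silting C M"
    and "finite_direct_sum C {1..n} Ms M"
    and "\<forall>i\<in>{1..n}. indecomposable C (Ms i)"
    and "\<forall>i\<in>{1..n}. \<forall>j\<in>{1..n}. i \<noteq> j \<longrightarrow> \<not> isomorphic C (Ms i) (Ms j)"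
    and "vectorspace.fin_dim K (Hom C M M)"
    and "split_generates C (S ` {1..n}) D"
    and "\<forall>i\<in>{1..n}. \<forall>j\<in>{1..n}. \<forall>p::int.
      if i = j \<and> p = 0
      then lin_isomorphic K (Hom C (Ms i) (shift C (S j) p)) (self_module K)
      else hom_zero C (Ms i) (shift C (S j) p)"
  shows "ST_triple K C D M \<and>
    (\<forall>d::nat. 1 \<le> d \<longrightarrow> relative_CY K C D (d + 1) \<longrightarrow> CY_triple K C D M (d + 1))"
proof -
  interpret triangulated_category K C by fact
  have "ST_triple K C D M"
  proof (rule finite_direct_sumE[OF assms(8)])
    fix inc prj
    assume sum: "\<And>i. i \<in> {1..n} \<Longrightarrow> arr (inc i) (Ms i) M" "\<And>i. i \<in> {1..n} \<Longrightarrow> arr (prj i) M (Ms i)"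
      "\<And>i. i \<in> {1..n} \<Longrightarrow> prj i \<star>\<^bsub>C\<^esub> inc i = Ide C (Ms i)"
      "\<And>i j. i \<in> {1..n} \<Longrightarrow> j \<in> {1..n} \<Longrightarrow> i \<noteq> j \<Longrightarrow> prj j \<star>\<^bsub>C\<^esub> inc i = zero_mor C (Ms i) (Ms j)"
      "\<And>f X. arr f M X \<Longrightarrow> (\<And>i. i \<in> {1..n} \<Longrightarrow> f \<star>\<^bsub>C\<^esub> inc i = zero_mor C (Ms i) X) \<Longrightarrow> f = zero_mor C M X"
    interpret silting_simples K C M D n Ms S inc prj
    proof unfold_locales
      show "lin_isomorphic K (Hom C (Ms i) (S i)) (self_module K)" if "i \<in> {1..n}" for i
        using assms(13) that by (metis shift_0)
      show "hom_zero C (Ms i) (shift C (S j) p)" if "i \<in> {1..n}" "j \<in> {1..n}" "i \<noteq> j \<or> p \<noteq> 0" for i j p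
        using assms(13) that by metis
      show "f = zero_mor C M X" if "arr f M X" "\<And>i. i \<in> {1..n} \<Longrightarrow> f \<star>\<^bsub>C\<^esub> inc i = zero_mor C (Ms i) X" for f X
        using sum(5) that .
    qed (use assms sum(1-4) in auto)
    show ?thesis by (rule ST_triple)
  qed
  then show ?thesis by (simp add: CY_triple_def)
qed

end
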